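(* As $n\to\infty$, $$\eta_2^o(n)\sim\frac38\sqrt n\;e^{\frac{\pi}{3}\sqrt{3n-1}}.$$
   Context: An odd Durfee symbol $\begin{pmatrix}a_1&a_2&\cdots&a_i\\ b_1&b_2&\cdots&b_j\end{pmatrix}_N$ consists of two (possibly empty) non-increasing rows of odd positive integers, all at most $2N+1$, with subscript $N\ge0$; the number being partitioned is $2N^2+2N+1+\sum a_m+\sum b_m$. (Such symbols are associated to partitions into pairs of consecutive integers, excepting one instance of the largest part.) Its odd rank is the number of entries in the top row minus the number of entries in the bottom row. $N^o(m,n)$ is the number of partitions of $n$ related to an odd Durfee symbol with odd rank $m$. Define $\eta_2^o(n):=\sum_{m\in\mathbb{Z}}\binom{m+1}{2}N^o(m,n)$ with $\binom{m+1}2=\frac{m(m+1)}2$; equivalently $\sum_{n\ge1}\eta_2^o(n)q^n=\frac{1}{(q^2;q^2)_\infty}\sum_{n\in\mathbb{Z}}(-1)^n\frac{q^{3n^2+5n+2}}{(1-q^{2n+1})^3}$, where $(q^2;q^2)_\infty=\prod_{j\ge1}(1-q^{2j})$. *)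

theory Defs
  imports "HOL-Analysis.Analysis" "HOL-Library.Landau_Symbols"
begin

text \<open>A symbol is a triple of top row, bottom row and subscript.\<close>

type_synonym durfee_symbol = "nat list \<times> nat list \<times> nat"

definition odd_durfee_row :: "nat \<Rightarrow> nat list \<Rightarrow> bool" where
  "odd_durfee_row N r \<longleftrightarrow> sorted_wrt (\<ge>) r \<and> (\<forall>x\<in>set r. odd x \<and> x \<le> 2 * N + 1)"

fun odd_durfee_symbol :: "durfee_symbol \<Rightarrow> bool" where
  "odd_durfee_symbol (as, bs, N) \<longleftrightarrow> odd_durfee_row N as \<and> odd_durfee_row N bs"

fun odd_durfee_size :: "durfee_symbol \<Rightarrow> nat" where
  "odd_durfee_size (as, bs, N) = 2 * N\<^sup>2 + 2 * N + 1 + sum_list as + sum_list bs"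

fun odd_rank :: "durfee_symbol \<Rightarrow> int" where
  "odd_rank (as, bs, N) = int (length as) - int (length bs)"

definition odd_durfee_symbols :: "int \<Rightarrow> nat \<Rightarrow> durfee_symbol set" where
  "odd_durfee_symbols m n =
     {s. odd_durfee_symbol s \<and> odd_durfee_size s = n \<and> odd_rank s = m}"

text \<open>
  Partitions with odd rank \<open>m\<close> correspond one-to-one to their odd Durfee symbols,
  so \<open>N\<^sup>o(m,n)\<close> is counted on symbols.
\<close>

definition odd_rank_count :: "int \<Rightarrow> nat \<Rightarrow> nat" where
  "odd_rank_count m n = card (odd_durfee_symbols m n)"

definition eta2_odd :: "nat \<Rightarrow> real" where
  "eta2_odd n =
     (\<Sum>\<^sub>\<infinity>m\<in>(UNIV :: int set). (real_of_int m * (real_of_int m + 1) / 2) * real (odd_rank_count m n))"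

text \<open>
  Neither \<^const>\<open>card\<close> nor \<^const>\<open>infsum\<close> takes its default value here:
  the sets of symbols are finite, and only finitely many ranks contribute.
\<close>

lemma odd_durfee_row_bounds:
  assumes "odd_durfee_row N r"
  shows "length r \<le> sum_list r" "set r \<subseteq> {..sum_list r}"
proof -
  have "\<forall>x\<in>set r. 1 \<le> x"
    using assms by (auto simp: odd_durfee_row_def Suc_le_eq intro: odd_pos)
  then show "length r \<le> sum_list r"
    by (induction r) auto
  show "set r \<subseteq> {..sum_list r}"
    by (auto intro: member_le_sum_list)
qed

lemma finite_odd_durfee_symbols: "finite (odd_durfee_symbols m n)"
proof (rule finite_subset)
  let ?L = "{xs. set xs \<subseteq> {..n} \<and> length xs \<le> n}"
  show "odd_durfee_symbols m n \<subseteq> ?L \<times> ?L \<times> {..n}"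
    by (fastforce simp: odd_durfee_symbols_def dest: odd_durfee_row_bounds)
  show "finite (?L \<times> ?L \<times> {..n})"
    by (simp add: finite_lists_length_le)
qed

lemma odd_rank_count_eq_0:
  assumes "int n < \<bar>m\<bar>"
  shows "odd_rank_count m n = 0"
proof -
  have "odd_durfee_symbols m n = {}"
  proof (rule equals0I)
    fix s assume s: "s \<in> odd_durfee_symbols m n"
    obtain xs ys N where "s = (xs, ys, N)"
      by (cases s)
    with s have "length xs \<le> sum_list xs" "length ys \<le> sum_list ys"
      "sum_list xs + sum_list ys \<le> n" "m = int (length xs) - int (length ys)"
      by (auto simp: odd_durfee_symbols_def odd_durfee_row_bounds)
    with assms show False
      by linarith
  qed
  then show ?thesis
    by (simp add: odd_rank_count_def)
qed

lemma eta2_odd_finite_sum: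
  "eta2_odd n =
     (\<Sum>m = - int n..int n. (real_of_int m * (real_of_int m + 1) / 2) * real (odd_rank_count m n))"
proof -
  have "eta2_odd n = infsum (\<lambda>m. (real_of_int m * (real_of_int m + 1) / 2) * real (odd_rank_count m n))
      {- int n..int n}"
    unfolding eta2_odd_def by (rule infsum_cong_neutral) (auto intro!: odd_rank_count_eq_0)
  then show ?thesis
    by simp
qed

end

theory Submission
  imports Defs "HOL-Probability.Probability" "HOL-Complex_Analysis.Complex_Analysis" "HOL-Real_Asymp.Real_Asymp"
begin

text \<open>
  The proof has an algebraic half, which finds a closed form for the generating function of
  \<open>eta2_odd\<close>, and an analytic half, which runs the circle method on it.
  
  Swapping the rows of a symbol negates its rank, so the weight \<open>m (m + 1) / 2\<close> can be replaced by
  \<open>m\<^sup>2 / 2\<close>. For a fixed subscript \<open>N\<close> the weighted sum over pairs of rows is therefore a variance-like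
  expression in the moments of the row length; it equals
  \<open>D\<^sub>N = (\<Prod>j\<le>N. 1 / (1 - x\<^sub>j)\<^sup>2) * (\<Sum>j\<le>N. x\<^sub>j / (1 - x\<^sub>j)\<^sup>2)\<close> with \<open>x\<^sub>j = q ^ (2 * j + 1)\<close>.
  This is the derivative at \<open>u = 2\<close> of \<open>\<Prod>j\<le>N. 1 / (1 + x\<^sub>j\<^sup>2 - x\<^sub>j * u)\<close>, where \<open>u\<close> stands for
  \<open>z + 1 / z\<close> and \<open>z\<close> marks the rank. Expanding in partial fractions in \<open>u\<close> and summing over \<open>N\<close> first,
  each coefficient becomes, up to sign and a power of \<open>q\<close>, a Durfee rectangle sum, and these are all equal to
  \<open>1 / (q\<^sup>2; q\<^sup>2)\<^sub>\<infinity>\<close>. Hence the generating function is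
  \<open>S(q) / (q\<^sup>2; q\<^sup>2)\<^sub>\<infinity>\<close> with
  \<open>S(q) = (\<Sum>k. (-1) ^ k * q ^ (3 * k\<^sup>2 + 3 * k + 1) * x\<^sub>k * (1 + x\<^sub>k) / (1 - x\<^sub>k) ^ 3)\<close>
  (\<open>eta2_odd_generating_function\<close>).
  
  On the circle of radius \<open>exp (- u)\<close> the sum \<open>S\<close> is bounded by a constant times \<open>u ^ (-3)\<close>. Close to \<open>q = 1\<close>
  it is asymptotic to \<open>2 * u ^ (-3) * (\<Sum>k. (-1) ^ k / (2 * k + 1) ^ 3) = \<pi>\<^sup>3 / 16 * u ^ (-3)\<close>, and close to
  \<open>q = -1\<close> it is of smaller order because each denominator stays away from \<open>0\<close>. The factor
  \<open>1 / (q\<^sup>2; q\<^sup>2)\<^sub>\<infinity>\<close> is larger near \<open>q = 1\<close> and \<open>q = -1\<close> than elsewhere, by an exponential factor. So only the arc around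
  \<open>q = 1\<close> contributes.
  
  Put \<open>q\<^sup>2 = exp (- \<tau>)\<close>. Up to the factor \<open>sqrt (\<tau> / (2 * \<pi>))\<close> the partition product is
  asymptotically \<open>exp (\<pi>\<^sup>2 / (6 * \<tau>))\<close>, and \<open>n * \<tau> / 2 + \<pi>\<^sup>2 / (6 * \<tau>)\<close> has its saddle point at
  \<open>\<tau>\<^sub>0 = \<pi> / sqrt (3 * n)\<close>. With \<open>\<tau> = \<tau>\<^sub>0 + \<i> * v * \<tau>\<^sub>0 powr (3 / 2)\<close> the normalised integrand tends to
  \<open>\<pi>\<^sup>3 / 16 * exp (- \<pi>\<^sup>2 * v\<^sup>2 / 6)\<close> and is dominated by a multiple of \<open>1 / (1 + v\<^sup>2)\<close> over the whole
  circle at once, so that a single application of dominated convergence replaces the usual division into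
  major and minor arcs (\<open>eta2_odd_normalised_limit\<close>).
  
  The two facts about the partition product are obtained without its modular transformation. On the real axis
  its logarithm is compared with that of the product formula for \<open>sinh\<close>, which supplies the factor
  \<open>sqrt (\<tau> / (2 * \<pi>))\<close> (\<open>partition_log_real_asymptotics\<close>); off the axis only a Lipschitz bound for the
  difference to \<open>\<pi>\<^sup>2 / (6 * \<tau>)\<close> is needed (\<open>partition_log_defect_lipschitz\<close>).
\<close>

section \<open>Sums over odd Durfee symbols\<close>

text \<open>
  The symbol is used for two notions of absolute summability; below it means the one for unconditional sums.
\<close>

no_notation Infinite_Set_Sum.abs_summable_on (infix "abs'_summable'_on" 50)

text \<open>
  Tonelli and Fubini in one step: the iterated sums of the norms give absolute summability over the dependent
  product, and then iterated summation identifies the value.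
\<close>

lemma has_sum_Sigma_abs:
  fixes f :: "'a \<times> 'b \<Rightarrow> 'c :: banach"
  assumes f: "\<And>x. x \<in> A \<Longrightarrow> ((\<lambda>y. f (x, y)) has_sum g x) (B x)"
    and nf: "\<And>x. x \<in> A \<Longrightarrow> ((\<lambda>y. norm (f (x, y))) has_sum G x) (B x)"
    and G: "G summable_on A" and g: "(g has_sum s) A"
  shows "f abs_summable_on Sigma A B" "(f has_sum s) (Sigma A B)"
proof -
  have G0: "G x \<ge> 0" if "x \<in> A" for x
    using nf[OF that] by (rule has_sum_nonneg) auto
  show abs: "f abs_summable_on Sigma A B"
    unfolding Infinite_Sum.abs_summable_on_Sigma_iff
  proof safe
    fix x assume "x \<in> A"
    then show "(\<lambda>y. f (x, y)) abs_summable_on B x"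
      using nf has_sum_imp_summable by blast
  next
    have "(\<lambda>x. norm (infsum (\<lambda>y. norm (f (x, y))) (B x))) summable_on A \<longleftrightarrow> G summable_on A"
      by (rule summable_on_cong) (use infsumI[OF nf] G0 in simp)
    with G show "(\<lambda>x. norm (infsum (\<lambda>y. norm (f (x, y))) (B x))) summable_on A"
      by blast
  qed
  have "f summable_on Sigma A B"
    using abs by (rule abs_summable_summable)
  then obtain t where t: "(f has_sum t) (Sigma A B)"
    by (auto simp: summable_on_def)
  have "(g has_sum t) A"
    using has_sum_Sigma[OF isUCont_plus t f] by simp
  with g t show "(f has_sum s) (Sigma A B)"
    using has_sum_unique by blast
qed

lemma has_sum_Times_mult:
  fixes f :: "'a \<Rightarrow> 'c :: {banach, real_normed_field}"
  assumes f: "(f has_sum a) A" "f abs_summable_on A"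
    and g: "(g has_sum b) B" "g abs_summable_on B"
  shows "((\<lambda>(x, y). f x * g y) has_sum (a * b)) (A \<times> B)"
    "(\<lambda>(x, y). f x * g y) abs_summable_on (A \<times> B)"
proof -
  define b' where "b' = infsum (\<lambda>x. norm (g x)) B"
  have b': "((\<lambda>x. norm (g x)) has_sum b') B"
    using g(2) unfolding b'_def by (rule has_sum_infsum)
  note * = has_sum_Sigma_abs[where f = "\<lambda>(x, y). f x * g y" and g = "\<lambda>x. f x * b"
      and G = "\<lambda>x. norm (f x) * b'" and A = A and B = "\<lambda>_. B" and s = "a * b"]
  show "((\<lambda>(x, y). f x * g y) has_sum (a * b)) (A \<times> B)"
    by (rule *(2))
      (use f g b' in \<open>auto simp: norm_mult intro!: has_sum_cmult_left has_sum_cmult_right summable_on_cmult_left\<close>)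
  show "(\<lambda>(x, y). f x * g y) abs_summable_on (A \<times> B)"
    by (rule *(1))
      (use f g b' in \<open>auto simp: norm_mult intro!: has_sum_cmult_left has_sum_cmult_right summable_on_cmult_left\<close>)
qed

text \<open>
  Bounding the entries strictly by \<open>2 * M\<close> instead of by \<open>2 * N + 1\<close> makes the empty row the only one for
  \<open>M = 0\<close>, where the inductions below start.
\<close>

definition odd_rows :: "nat \<Rightarrow> nat list set" where
  "odd_rows M = {r. sorted_wrt (\<ge>) r \<and> (\<forall>x\<in>set r. odd x \<and> x < 2 * M)}"

lemma sorted_wrt_replicate_ge: "sorted_wrt (\<ge>) (replicate k (x :: nat))"
  by (induction k) auto

lemma takeWhile_dropWhile_replicate:
  assumes "c \<notin> set r"
  shows "takeWhile ((=) c) (replicate k c @ r) = replicate k c" "dropWhile ((=) c) (replicate k c @ r) = r"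
proof -
  have "takeWhile ((=) c) r = [] \<and> dropWhile ((=) c) r = r"
    using assms by (cases r) auto
  then show "takeWhile ((=) c) (replicate k c @ r) = replicate k c" "dropWhile ((=) c) (replicate k c @ r) = r"
    by (induction k) auto
qed

text \<open>
  A row is determined by the multiplicity of the largest admissible entry and the rest of the row. This is the
  combinatorial content of the factor \<open>1 / (1 - z * q ^ (2 * M + 1))\<close> in the generating function of the rows.
\<close>

lemma odd_rows_Suc_bij:
  "bij_betw (\<lambda>(k, r). replicate k (2 * M + 1) @ r) (UNIV \<times> odd_rows M) (odd_rows (Suc M))"
proof -
  let ?P = "(=) (2 * M + 1)" and ?f = "\<lambda>(k, r). replicate k (2 * M + 1) @ r"
  let ?g = "\<lambda>r. (length (takeWhile ?P r), dropWhile ?P r)"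
  show ?thesis
  proof (rule bij_betw_byWitness[where f' = ?g])
    show "\<forall>a\<in>UNIV \<times> odd_rows M. ?g (?f a) = a"
    proof
      fix a :: "nat \<times> nat list" assume a: "a \<in> UNIV \<times> odd_rows M"
      obtain k r where kr: "a = (k, r)" by (cases a)
      have r: "r \<in> odd_rows M" using a kr by simp
      have nin: "2 * M + 1 \<notin> set r" using r by (auto simp: odd_rows_def)
      show "?g (?f a) = a"
        unfolding kr prod.case takeWhile_dropWhile_replicate[OF nin] by simp
    qed
    show "\<forall>a'\<in>odd_rows (Suc M). ?f (?g a') = a'"
    proof
      fix r :: "nat list"
      have *: "replicate (length (takeWhile ((=) c) r)) c = takeWhile ((=) c) r" for c :: nat
        by (rule replicate_length_same) (auto dest: set_takeWhileD)
      show "?f (?g r) = r"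
        unfolding prod.case * by (rule takeWhile_dropWhile_id)
    qed
    show "?f ` (UNIV \<times> odd_rows M) \<subseteq> odd_rows (Suc M)"
    proof safe
      fix k r assume r: "r \<in> odd_rows M"
      then have "\<forall>x\<in>set r. x \<le> 2 * M + 1" "\<forall>x\<in>set r. x < 2 * Suc M" by (auto simp: odd_rows_def)
      then show "replicate k (2 * M + 1) @ r \<in> odd_rows (Suc M)"
        using r by (simp add: odd_rows_def sorted_wrt_append sorted_wrt_replicate_ge ball_Un)
    qed
    show "?g ` odd_rows (Suc M) \<subseteq> UNIV \<times> odd_rows M"
    proof safe
      fix r assume r: "r \<in> odd_rows (Suc M)"
      let ?d = "dropWhile ?P r"
      have sub: "set ?d \<subseteq> set r" by (auto dest: set_dropWhileD)
      have sd: "sorted_wrt (\<ge>) ?d"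
        using r unfolding odd_rows_def by (auto simp: sorted_wrt_dropWhile)
      have "x < 2 * M" if x: "x \<in> set ?d" for x
      proof -
        obtain y ys where y: "?d = y # ys" using x by (metis list.set_cases)
        then have "y \<noteq> 2 * M + 1"
          by (metis hd_dropWhile list.distinct(1) list.sel(1))
        moreover have "y \<in> set r" using sub y by auto
        then have "odd y" "y < 2 * Suc M" using r by (auto simp: odd_rows_def)
        moreover have "x \<le> y" using x y sd by auto
        ultimately show ?thesis by presburger
      qed
      then show "?d \<in> odd_rows M"
        using sd sub r by (auto simp: odd_rows_def)
    qed auto
  qed
qed

lemma abs_summable_on_plus:
  fixes f g :: "'a \<Rightarrow> 'c :: banach"
  assumes "f abs_summable_on A" "g abs_summable_on A"
  shows "(\<lambda>x. f x + g x) abs_summable_on A"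
proof (rule Infinite_Sum.abs_summable_on_comparison_test)
  show "(\<lambda>x. norm (f x) + norm (g x)) abs_summable_on A"
    using summable_on_add[OF assms] by simp
  show "norm (f x + g x) \<le> norm (norm (f x) + norm (g x))" for x
    by (simp add: norm_triangle_ineq)
qed

lemma geometric_moments:
  fixes x :: "'a :: {banach, real_normed_field}"
  assumes x: "norm x < 1"
  shows "((\<lambda>k. x ^ k) has_sum (1 / (1 - x))) UNIV" "(\<lambda>k. x ^ k) abs_summable_on UNIV"
    "((\<lambda>k. of_nat k * x ^ k) has_sum (x / (1 - x)\<^sup>2)) UNIV" "(\<lambda>k. of_nat k * x ^ k) abs_summable_on UNIV"
    "((\<lambda>k. (of_nat k)\<^sup>2 * x ^ k) has_sum (x * (1 + x) / (1 - x) ^ 3)) UNIV"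
    "(\<lambda>k. (of_nat k)\<^sup>2 * x ^ k) abs_summable_on UNIV"
proof -
  have d1: "summable (\<lambda>n. diffs (\<lambda>_. 1) n * y ^ n)" if "norm y < 1" for y :: real
    by (rule termdiff_converges[OF that]) (simp add: summable_geometric)
  have d2: "summable (\<lambda>n. diffs (diffs (\<lambda>_. 1)) n * norm x ^ n)"
    by (rule termdiff_converges[of _ 1]) (use d1 x in auto)
  have n2: "summable (\<lambda>k. norm ((of_nat k)\<^sup>2 * x ^ k))"
    by (rule summable_comparison_test'[OF d2])
      (simp add: diffs_def norm_mult norm_power power2_eq_square mult_mono' mult_right_mono)
  have n1: "summable (\<lambda>k. norm (of_nat k * x ^ k))"
  proof (rule summable_comparison_test'[OF n2])
    fix k :: nat
    have "real k \<le> real k ^ 2" by (cases k) (auto simp: power2_eq_square)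
    then show "norm (norm (of_nat k * x ^ k)) \<le> norm ((of_nat k)\<^sup>2 * x ^ k)"
      by (simp add: norm_mult norm_power mult_right_mono)
  qed
  have n0: "summable (\<lambda>k. norm (x ^ k))"
    using x by (simp add: norm_power summable_geometric)
  have ne: "1 - x \<noteq> 0" using x by auto
  define S0 S1 S2 where "S0 = (\<Sum>k. x ^ k)" and "S1 = (\<Sum>k. of_nat k * x ^ k)"
    and "S2 = (\<Sum>k. (of_nat k)\<^sup>2 * x ^ k)"
  have s0: "(\<lambda>k. x ^ k) sums S0"
    unfolding S0_def by (intro summable_sums summable_norm_cancel[OF n0])
  have s1: "(\<lambda>k. of_nat k * x ^ k) sums S1"
    unfolding S1_def by (intro summable_sums summable_norm_cancel[OF n1])
  have s2: "(\<lambda>k. (of_nat k)\<^sup>2 * x ^ k) sums S2"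
    unfolding S2_def by (intro summable_sums summable_norm_cancel[OF n2])
  have S0: "S0 = 1 / (1 - x)"
    using x by (simp add: S0_def suminf_geometric)
  have "(\<lambda>k. x * (of_nat k * x ^ k + x ^ k)) sums (x * (S1 + S0))"
    by (intro sums_mult sums_add s0 s1)
  then have "(\<lambda>k. of_nat (Suc k) * x ^ Suc k) sums (x * (S1 + S0))"
    by (simp add: algebra_simps)
  then have "(\<lambda>k. of_nat k * x ^ k) sums (x * (S1 + S0))"
    by (subst (asm) sums_Suc_iff) simp
  then have "S1 = x * (S1 + S0)"
    using s1 sums_unique2 by blast
  then have S1: "S1 = x / (1 - x)\<^sup>2"
    using ne unfolding S0 by (simp add: divide_simps power2_eq_square) (simp add: algebra_simps)
  have "(\<lambda>k. x * ((of_nat k)\<^sup>2 * x ^ k + 2 * (of_nat k * x ^ k) + x ^ k)) sums (x * (S2 + 2 * S1 + S0))"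
    by (intro sums_mult sums_add s0 s1 s2)
  then have "(\<lambda>k. (of_nat (Suc k))\<^sup>2 * x ^ Suc k) sums (x * (S2 + 2 * S1 + S0))"
    by (simp add: algebra_simps power2_eq_square)
  then have "(\<lambda>k. (of_nat k)\<^sup>2 * x ^ k) sums (x * (S2 + 2 * S1 + S0))"
    by (subst (asm) sums_Suc_iff) simp
  then have "S2 = x * (S2 + 2 * S1 + S0)"
    using s2 sums_unique2 by blast
  then have "S2 * (1 - x) = x * (2 * S1 + S0)"
    by (simp add: algebra_simps)
  then have "S2 = x * (2 * S1 + S0) / (1 - x)"
    using ne by (simp add: field_simps)
  also have "\<dots> = x * (1 + x) / (1 - x) ^ 3"
    using ne unfolding S0 S1 by (simp add: divide_simps power2_eq_square power3_eq_cube)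
  finally have S2: "S2 = x * (1 + x) / (1 - x) ^ 3" .
  show "((\<lambda>k. x ^ k) has_sum (1 / (1 - x))) UNIV"
    using norm_summable_imp_has_sum[OF n0 s0] by (simp only: S0)
  show "((\<lambda>k. of_nat k * x ^ k) has_sum (x / (1 - x)\<^sup>2)) UNIV"
    using norm_summable_imp_has_sum[OF n1 s1] by (simp only: S1)
  show "((\<lambda>k. (of_nat k)\<^sup>2 * x ^ k) has_sum (x * (1 + x) / (1 - x) ^ 3)) UNIV"
    using norm_summable_imp_has_sum[OF n2 s2] by (simp only: S2)
  have nn: "f summable_on UNIV" if "summable f" "\<And>k. f k \<ge> 0" for f :: "nat \<Rightarrow> real"
    using that by (intro norm_summable_imp_summable_on) simp
  show "(\<lambda>k. x ^ k) abs_summable_on UNIV" "(\<lambda>k. of_nat k * x ^ k) abs_summable_on UNIV"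
    "(\<lambda>k. (of_nat k)\<^sup>2 * x ^ k) abs_summable_on UNIV"
    using nn[OF n0] nn[OF n1] nn[OF n2] by simp_all
qed

text \<open>
  The generating function of the rows in \<open>z\<close> and \<open>q\<close> is \<open>\<Prod>j<M. 1 / (1 - z * x\<^sub>j)\<close> with
  \<open>x\<^sub>j = q ^ (2 * j + 1)\<close>; the three sums are its value and its first two moments at \<open>z = 1\<close>, that is, what
  logarithmic differentiation would give. The induction splits off the copies of the largest entry.
\<close>

lemma odd_rows_moments:
  fixes q :: "'a :: {banach, real_normed_field}" and M :: nat
  assumes q: "norm q < 1"
  defines "P \<equiv> \<lambda>M. \<Prod>j<M. 1 / (1 - q ^ (2 * j + 1))"
    and "A \<equiv> \<lambda>M. \<Sum>j<M. q ^ (2 * j + 1) / (1 - q ^ (2 * j + 1))"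
    and "B \<equiv> \<lambda>M. \<Sum>j<M. q ^ (2 * j + 1) / (1 - q ^ (2 * j + 1))\<^sup>2"
  shows "((\<lambda>r. q ^ sum_list r) has_sum P M) (odd_rows M)"
    "(\<lambda>r. q ^ sum_list r) abs_summable_on odd_rows M"
    "((\<lambda>r. of_nat (length r) * q ^ sum_list r) has_sum (P M * A M)) (odd_rows M)"
    "(\<lambda>r. of_nat (length r) * q ^ sum_list r) abs_summable_on odd_rows M"
    "((\<lambda>r. (of_nat (length r))\<^sup>2 * q ^ sum_list r) has_sum (P M * ((A M)\<^sup>2 + B M))) (odd_rows M)"
    "(\<lambda>r. (of_nat (length r))\<^sup>2 * q ^ sum_list r) abs_summable_on odd_rows M"
proof (induction M)
  case 0
  have "odd_rows 0 = {[]}" by (auto simp: odd_rows_def)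
  then show
    "((\<lambda>r. q ^ sum_list r) has_sum P 0) (odd_rows 0)"
    "(\<lambda>r. q ^ sum_list r) abs_summable_on odd_rows 0"
    "((\<lambda>r. of_nat (length r) * q ^ sum_list r) has_sum (P 0 * A 0)) (odd_rows 0)"
    "(\<lambda>r. of_nat (length r) * q ^ sum_list r) abs_summable_on odd_rows 0"
    "((\<lambda>r. (of_nat (length r))\<^sup>2 * q ^ sum_list r) has_sum (P 0 * ((A 0)\<^sup>2 + B 0))) (odd_rows 0)"
    "(\<lambda>r. (of_nat (length r))\<^sup>2 * q ^ sum_list r) abs_summable_on odd_rows 0"
    by (simp_all add: has_sum_finiteI P_def A_def B_def)
next
  case (Suc M)
  define x where "x = q ^ (2 * M + 1)"
  have x: "norm x < 1"
    using q unfolding x_def norm_power by (simp add: power_less_one_iff del: power_Suc)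
  then have ne: "1 - x \<noteq> 0" by auto
  define p a b where "p = P M" and "a = A M" and "b = B M"
  have suc: "P (Suc M) = p / (1 - x)" "A (Suc M) = a + x / (1 - x)" "B (Suc M) = b + x / (1 - x)\<^sup>2"
    by (simp_all add: p_def a_def b_def P_def A_def B_def x_def)
  note IH = Suc.IH[folded p_def a_def b_def]
  note g = geometric_moments[OF x]
  let ?h = "\<lambda>(k, r). replicate k (2 * M + 1) @ r"
  have re: "(f has_sum s) (odd_rows (Suc M)) \<longleftrightarrow> ((\<lambda>p. f (?h p)) has_sum s) (UNIV \<times> odd_rows M)" for f :: "_ \<Rightarrow> 'a" and s
    by (rule has_sum_reindex_bij_betw[OF odd_rows_Suc_bij, symmetric])
  have re': "f abs_summable_on odd_rows (Suc M) \<longleftrightarrow> (\<lambda>p. f (?h p)) abs_summable_on (UNIV \<times> odd_rows M)" for f :: "_ \<Rightarrow> 'a"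
    by (rule summable_on_reindex_bij_betw[OF odd_rows_Suc_bij, symmetric])
  have w: "q ^ sum_list (replicate k (2 * M + 1) @ r) = x ^ k * q ^ sum_list r" for k r
  proof -
    have "x ^ k = q ^ (k * (2 * M + 1))"
      unfolding x_def power_mult[symmetric] by (simp only: mult.commute)
    then show ?thesis
      unfolding sum_list_append sum_list_replicate power_add by simp
  qed
  have l: "of_nat (length (replicate k (2 * M + 1) @ r)) = (of_nat k + of_nat (length r) :: 'a)" for k r
    by simp
  have f0: "q ^ sum_list (?h p) = (\<lambda>(k, r). x ^ k * q ^ sum_list r) p" for p
    by (simp only: w prod.case split_beta)
  have f1: "of_nat (length (?h p)) * q ^ sum_list (?h p) =
     (\<lambda>(k, r). (of_nat k * x ^ k) * q ^ sum_list r) p + (\<lambda>(k, r). x ^ k * (of_nat (length r) * q ^ sum_list r)) p" for p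
    by (simp only: w l split_beta, simp add: algebra_simps)
  have f2: "(of_nat (length (?h p)))\<^sup>2 * q ^ sum_list (?h p) =
     (\<lambda>(k, r). ((of_nat k)\<^sup>2 * x ^ k) * q ^ sum_list r) p
        + ((\<lambda>(k, r). (of_nat k * x ^ k) * (of_nat (length r) * q ^ sum_list r)) p
        + (\<lambda>(k, r). (of_nat k * x ^ k) * (of_nat (length r) * q ^ sum_list r)) p)
        + (\<lambda>(k, r). x ^ k * ((of_nat (length r))\<^sup>2 * q ^ sum_list r)) p" for p
    by (simp only: w l split_beta, simp add: algebra_simps power2_eq_square)
  note T = has_sum_Times_mult
  show "((\<lambda>r. q ^ sum_list r) has_sum P (Suc M)) (odd_rows (Suc M))"
    unfolding re f0 suc using T(1)[OF g(1,2) IH(1,2)] by simp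
  show "(\<lambda>r. q ^ sum_list r) abs_summable_on odd_rows (Suc M)"
    unfolding re' f0 by (rule T(2)[OF g(1,2) IH(1,2)])
  have e1: "x / (1 - x)\<^sup>2 * p + 1 / (1 - x) * (p * a) = p / (1 - x) * (a + x / (1 - x))"
    using ne by (simp add: divide_simps power2_eq_square) (simp add: algebra_simps)
  show "((\<lambda>r. of_nat (length r) * q ^ sum_list r) has_sum (P (Suc M) * A (Suc M)))
      (odd_rows (Suc M))"
    unfolding re f1 suc e1[symmetric]
    by (intro has_sum_add T(1)[OF g(3,4) IH(1,2)] T(1)[OF g(1,2) IH(3,4)])
  show "(\<lambda>r. of_nat (length r) * q ^ sum_list r) abs_summable_on odd_rows (Suc M)"
    unfolding re' f1
    by (intro abs_summable_on_plus T(2)[OF g(3,4) IH(1,2)] T(2)[OF g(1,2) IH(3,4)])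
  have e2: "x * (1 + x) / (1 - x) ^ 3 * p + (x / (1 - x)\<^sup>2 * (p * a) + x / (1 - x)\<^sup>2 * (p * a))
       + 1 / (1 - x) * (p * (a\<^sup>2 + b))
      = p / (1 - x) * ((a + x / (1 - x))\<^sup>2 + (b + x / (1 - x)\<^sup>2))"
    using ne by (simp add: divide_simps power2_eq_square power3_eq_cube) (simp add: algebra_simps)
  show "((\<lambda>r. (of_nat (length r))\<^sup>2 * q ^ sum_list r) has_sum (P (Suc M) * ((A (Suc M))\<^sup>2 + B (Suc M))))
      (odd_rows (Suc M))"
    unfolding re f2 suc e2[symmetric]
    by (intro has_sum_add T(1)[OF g(5,6) IH(1,2)] T(1)[OF g(3,4) IH(3,4)] T(1)[OF g(1,2) IH(5,6)])
  show "(\<lambda>r. (of_nat (length r))\<^sup>2 * q ^ sum_list r) abs_summable_on odd_rows (Suc M)"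
    unfolding re' f2
    by (intro abs_summable_on_plus T(2)[OF g(5,6) IH(1,2)] T(2)[OF g(3,4) IH(3,4)] T(2)[OF g(1,2) IH(5,6)])
qed

lemma odd_durfee_row_odd_rows: "{r. odd_durfee_row N r} = odd_rows (Suc N)"
  by (auto simp: odd_durfee_row_def odd_rows_def)

text \<open>
  With \<open>l\<close> and \<open>l'\<close> the two row lengths, twice the weight is \<open>l\<^sup>2 + l'\<^sup>2 - 2 * l * l' + l - l'\<close>. The linear
  terms cancel by symmetry and the rest combines to \<open>P * P * (A\<^sup>2 + B) - (P * A)\<^sup>2\<close>, where the contribution of
  the mean \<open>A\<close> disappears.
\<close>

lemma symbol_pairs_has_sum:
  fixes q :: "'a :: {banach, real_normed_field}" and M :: nat
  assumes q: "norm q < 1"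
  defines "P \<equiv> \<Prod>j<M. 1 / (1 - q ^ (2 * j + 1))"
    and "B \<equiv> \<Sum>j<M. q ^ (2 * j + 1) / (1 - q ^ (2 * j + 1))\<^sup>2"
  shows "((\<lambda>(as, bs). of_int ((int (length as) - int (length bs)) * (int (length as) - int (length bs) + 1)) / 2
      * q ^ (sum_list as + sum_list bs)) has_sum (P\<^sup>2 * B)) (odd_rows M \<times> odd_rows M)"
proof -
  define A where "A = (\<Sum>j<M. q ^ (2 * j + 1) / (1 - q ^ (2 * j + 1)))"
  note m = odd_rows_moments[OF q, of M, folded P_def A_def B_def]
  note T = has_sum_Times_mult(1)
  let ?l = "\<lambda>r. of_nat (length r) :: 'a" and ?w = "\<lambda>r. q ^ sum_list r"
  have "((\<lambda>p. (((\<lambda>(as, bs). ((?l as)\<^sup>2 * ?w as) * ?w bs) p + (\<lambda>(as, bs). ?w as * ((?l bs)\<^sup>2 * ?w bs)) p)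
          + (\<lambda>(as, bs). (?l as * ?w as) * ?w bs) p
          + ((-1) * (\<lambda>(as, bs). ?w as * (?l bs * ?w bs)) p
          + (-2) * (\<lambda>(as, bs). (?l as * ?w as) * (?l bs * ?w bs)) p)) * (1 / 2))
      has_sum (((P * (A\<^sup>2 + B) * P + P * (P * (A\<^sup>2 + B))) + P * A * P
         + ((-1) * (P * (P * A)) + (-2) * (P * A * (P * A)))) * (1 / 2))) (odd_rows M \<times> odd_rows M)"
    by (intro has_sum_add has_sum_cmult_left has_sum_cmult_right T m)
  also have "((P * (A\<^sup>2 + B) * P + P * (P * (A\<^sup>2 + B))) + P * A * P
         + ((-1) * (P * (P * A)) + (-2) * (P * A * (P * A)))) * (1 / 2) = P\<^sup>2 * B"
    by (simp add: power2_eq_square field_simps)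
  finally show ?thesis
    by (rule has_sum_cong[THEN iffD1, rotated])
      (auto simp: power_add power2_eq_square field_simps)
qed

section \<open>The series for the logarithm of a partition product and Durfee rectangles\<close>

text \<open>
  The finite product \<open>(Q; Q)\<^sub>n\<close>.
\<close>

definition qfact :: "'a :: comm_ring_1 \<Rightarrow> nat \<Rightarrow> 'a" where
  "qfact Q n = (\<Prod>j=1..n. 1 - Q ^ j)"

lemma qfact_0 [simp]: "qfact Q 0 = 1"
  and qfact_Suc: "qfact Q (Suc n) = qfact Q n * (1 - Q ^ Suc n)"
  by (simp_all add: qfact_def)

lemma norm_power_less_one:
  fixes Q :: "'a :: real_normed_field"
  assumes "norm Q < 1" "n > 0"
  shows "norm (Q ^ n) < 1"
  using assms by (simp add: norm_power power_less_one_iff)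

lemma one_minus_power_nonzero:
  fixes Q :: "'a :: real_normed_field"
  assumes "norm Q < 1" "n > 0"
  shows "1 - Q ^ n \<noteq> 0"
proof
  assume "1 - Q ^ n = 0"
  then have "norm Q ^ n = 1" by (metis eq_iff_diff_eq_0 norm_one norm_power)
  with assms show False using power_less_one_iff[of "norm Q" n] by simp
qed

lemma qfact_nonzero:
  fixes Q :: "'a :: real_normed_field"
  assumes "norm Q < 1"
  shows "qfact Q n \<noteq> 0"
  using one_minus_power_nonzero[OF assms] by (simp add: qfact_def)

text \<open>
  The Lambert series of \<open>- ln (Q; Q)\<^sub>\<infinity>\<close>. Working with the series instead of the product avoids choosing a
  branch of the logarithm, and the exponential of the series is the generating function of the partitions.
\<close>

definition partition_log :: "complex \<Rightarrow> complex" where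
  "partition_log Q = (\<Sum>m. Q ^ Suc m / (of_nat (Suc m) * (1 - Q ^ Suc m)))"

lemma partition_log_bound:
  fixes Q :: "'a :: {real_normed_field}"
  assumes "norm Q < 1"
  shows "norm (Q ^ Suc m / (of_nat (Suc m) * (1 - Q ^ Suc m))) \<le> norm Q ^ Suc m / (of_nat (Suc m) * (1 - norm Q ^ Suc m))"
proof -
  have "1 - norm Q ^ Suc m \<le> norm (1 - Q ^ Suc m)"
    by (metis norm_one norm_power norm_triangle_ineq2)
  moreover have "norm Q ^ Suc m < 1" using assms power_less_one_iff[of "norm Q" "Suc m"] by simp
  ultimately show ?thesis
    unfolding norm_divide norm_mult norm_power norm_of_nat
    by (intro divide_left_mono mult_left_mono mult_pos_pos) auto
qed

lemma partition_log_summable_real: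
  fixes r :: real
  assumes "0 \<le> r" "r < 1"
  shows "summable (\<lambda>m. r ^ Suc m / (of_nat (Suc m) * (1 - r ^ Suc m)))"
proof (rule summable_comparison_test')
  show "summable (\<lambda>m. r ^ Suc m * (1 / (1 - r)))"
    using assms by (intro summable_mult2) (simp add: summable_mult summable_geometric)
  fix m :: nat
  have "r ^ Suc m \<le> r" using assms power_decreasing[of 1 "Suc m" r] by simp
  moreover have "1 * (1 - r) \<le> real (Suc m) * (1 - r ^ Suc m)"
    using assms \<open>r ^ Suc m \<le> r\<close> by (intro mult_mono) auto
  ultimately show "norm (r ^ Suc m / (of_nat (Suc m) * (1 - r ^ Suc m))) \<le> r ^ Suc m * (1 / (1 - r))"
    using assms by (auto simp: divide_simps intro!: divide_left_mono mult_left_mono)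
qed

lemma partition_log_summable:
  assumes "norm Q < 1"
  shows "summable (\<lambda>m. norm (Q ^ Suc m / (of_nat (Suc m) * (1 - Q ^ Suc m)) :: complex))"
  by (rule summable_comparison_test'[OF partition_log_summable_real[of "norm Q"]])
    (use assms partition_log_bound[OF assms] in auto)

text \<open>
  Expanding each \<open>ln (1 - Q ^ j)\<close> in powers of \<open>Q ^ j\<close> and summing the geometric series over \<open>j \<le> n\<close> first
  leaves a single series in which the limit \<open>n \<rightarrow> \<infinity>\<close> can be taken termwise.
\<close>

lemma qfact_eq_exp:
  assumes Q: "norm (Q :: complex) < 1"
  shows "qfact Q n = exp (- (\<Sum>m. Q ^ Suc m * (1 - (Q ^ Suc m) ^ n) / (of_nat (Suc m) * (1 - Q ^ Suc m))))"
proof -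
  have Ln: "(\<lambda>m. - ((Q ^ j) ^ Suc m / of_nat (Suc m))) sums Ln (1 - Q ^ j)" if j: "j > 0" for j
  proof -
    have nj: "norm (- (Q ^ j)) < 1"
      using Q j power_less_one_iff[of "norm Q" j] by (simp add: norm_power)
    have "(\<lambda>m. (- 1) ^ Suc m / of_nat m * (- (Q ^ j)) ^ m) sums Ln (1 + - (Q ^ j))"
      by (rule Ln_series[OF nj])
    then have "(\<lambda>m. (- 1) ^ Suc (Suc m) / of_nat (Suc m) * (- (Q ^ j)) ^ Suc m) sums Ln (1 + - (Q ^ j))"
      by (subst sums_Suc_iff) simp
    also have "(\<lambda>m. (- 1) ^ Suc (Suc m) / of_nat (Suc m) * (- (Q ^ j)) ^ Suc m)
        = (\<lambda>m. - ((Q ^ j) ^ Suc m / of_nat (Suc m)))"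
      by (auto simp: fun_eq_iff power_minus[of "Q ^ j"])
    finally show ?thesis by simp
  qed
  have "(\<lambda>m. \<Sum>j=1..n. - ((Q ^ j) ^ Suc m / of_nat (Suc m))) sums (\<Sum>j=1..n. Ln (1 - Q ^ j))"
    by (intro sums_sum Ln) auto
  also have "(\<lambda>m. \<Sum>j=1..n. - ((Q ^ j) ^ Suc m / of_nat (Suc m)))
     = (\<lambda>m. - (Q ^ Suc m * (1 - (Q ^ Suc m) ^ n) / (of_nat (Suc m) * (1 - Q ^ Suc m))))"
  proof
    fix m
    define y where "y = Q ^ Suc m"
    have y1: "y \<noteq> 1" using one_minus_power_nonzero[OF Q, of "Suc m"] by (auto simp: y_def)
    have "(\<Sum>j=1..n. - ((Q ^ j) ^ Suc m / of_nat (Suc m))) = - ((\<Sum>j=1..n. y ^ j) / of_nat (Suc m))"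
      unfolding y_def by (simp add: sum_negf sum_divide_distrib mult.commute flip: power_mult power_Suc)
    also have "(\<Sum>j=1..n. y ^ j) = y * (1 - y ^ n) / (1 - y)"
    proof -
      have "(\<Sum>j=1..n. y ^ j) = (\<Sum>j<n. y ^ Suc j)"
        by (rule sum.reindex_bij_witness[of _ Suc "\<lambda>j. j - 1"]) auto
      also have "\<dots> = y * (\<Sum>j<n. y ^ j)" by (simp add: sum_distrib_left)
      also have "(\<Sum>j<n. y ^ j) = (1 - y ^ n) / (1 - y)" using y1 sum_gp_strict[of y n] by simp
      finally show ?thesis by simp
    qed
    finally show "(\<Sum>j=1..n. - ((Q ^ j) ^ Suc m / of_nat (Suc m)))
        = - (Q ^ Suc m * (1 - (Q ^ Suc m) ^ n) / (of_nat (Suc m) * (1 - Q ^ Suc m)))"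
      by (simp add: y_def mult.commute)
  qed
  finally have S: "(\<lambda>m. - (Q ^ Suc m * (1 - (Q ^ Suc m) ^ n) / (of_nat (Suc m) * (1 - Q ^ Suc m)))) sums (\<Sum>j=1..n. Ln (1 - Q ^ j))" .
  have "qfact Q n = (\<Prod>j=1..n. exp (Ln (1 - Q ^ j)))"
    unfolding qfact_def using one_minus_power_nonzero[OF Q] by (intro prod.cong) auto
  also have "\<dots> = exp (\<Sum>j=1..n. Ln (1 - Q ^ j))"
    by (simp add: exp_sum)
  also have "(\<Sum>j=1..n. Ln (1 - Q ^ j)) = - (\<Sum>m. Q ^ Suc m * (1 - (Q ^ Suc m) ^ n) / (of_nat (Suc m) * (1 - Q ^ Suc m)))"
  proof -
    have "(\<lambda>m. Q ^ Suc m * (1 - (Q ^ Suc m) ^ n) / (of_nat (Suc m) * (1 - Q ^ Suc m))) sums - (\<Sum>j=1..n. Ln (1 - Q ^ j))"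
      using sums_minus[OF S] by (simp only: minus_minus)
    from sums_unique[OF this, symmetric] show ?thesis
      by (simp only: minus_minus)
  qed
  finally show ?thesis .
qed

lemma qfact_tendsto:
  assumes Q: "norm (Q :: complex) < 1"
  shows "(\<lambda>n. qfact Q n) \<longlonglongrightarrow> exp (- partition_log Q)"
proof -
  let ?a = "\<lambda>m n. Q ^ Suc m * (1 - (Q ^ Suc m) ^ n) / (of_nat (Suc m) * (1 - Q ^ Suc m))"
  have "((\<lambda>n. \<Sum>m. ?a m n) \<longlongrightarrow> (\<Sum>m. Q ^ Suc m / (of_nat (Suc m) * (1 - Q ^ Suc m)))) sequentially"
  proof (rule tannerys_theorem[THEN conjunct2, THEN conjunct2])
    fix m
    have "(\<lambda>n. (Q ^ Suc m) ^ n) \<longlonglongrightarrow> 0"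
      by (intro LIMSEQ_power_zero norm_power_less_one Q) simp
    then have "(\<lambda>n. ?a m n) \<longlonglongrightarrow> Q ^ Suc m * (1 - 0) / (of_nat (Suc m) * (1 - Q ^ Suc m))"
      by (intro tendsto_intros one_minus_power_nonzero Q no_zero_divisors)
        (use norm_power_less_one[OF Q, of "Suc m"] in \<open>simp_all del: of_nat_Suc\<close>)
    then show "(\<lambda>n. ?a m n) \<longlonglongrightarrow> Q ^ Suc m / (of_nat (Suc m) * (1 - Q ^ Suc m))" by simp
  next
    show "\<forall>\<^sub>F (m, n) in sequentially \<times>\<^sub>F sequentially. norm (?a m n)
        \<le> norm (Q ^ Suc m / (of_nat (Suc m) * (1 - Q ^ Suc m))) * 2"
    proof (intro always_eventually allI, safe)
      fix m n
      have "norm ((Q ^ Suc m) ^ n) \<le> 1"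
        using Q by (simp add: norm_power power_le_one del: power_Suc)
      then have "norm (1 - (Q ^ Suc m) ^ n) \<le> 2"
        using norm_triangle_ineq4[of 1 "(Q ^ Suc m) ^ n"] by simp
      then have "norm (Q ^ Suc m / (of_nat (Suc m) * (1 - Q ^ Suc m))) * norm (1 - (Q ^ Suc m) ^ n)
         \<le> norm (Q ^ Suc m / (of_nat (Suc m) * (1 - Q ^ Suc m))) * 2"
        by (intro mult_left_mono) auto
      then show "norm (?a m n) \<le> norm (Q ^ Suc m / (of_nat (Suc m) * (1 - Q ^ Suc m))) * 2"
        by (simp only: norm_mult[symmetric] times_divide_eq_left)
    qed
  qed (use partition_log_summable[OF Q] summable_mult2 in auto)
  then have "(\<lambda>n. exp (- (\<Sum>m. ?a m n))) \<longlonglongrightarrow> exp (- partition_log Q)"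
    unfolding partition_log_def by (intro tendsto_intros)
  then show ?thesis
    by (simp only: qfact_eq_exp[OF Q])
qed

lemma qfact_inverse_bounded:
  assumes Q: "norm (Q :: complex) < 1"
  shows "\<exists>C>0. \<forall>n. norm (1 / qfact Q n) \<le> C"
proof -
  have "(\<lambda>n. 1 / qfact Q n) \<longlonglongrightarrow> 1 / exp (- partition_log Q)"
    by (intro tendsto_intros qfact_tendsto Q) auto
  then have "Bseq (\<lambda>n. 1 / qfact Q n)"
    using convergent_def convergent_imp_Bseq by blast
  then show ?thesis by (auto simp: Bseq_def)
qed

definition durfee_rect :: "complex \<Rightarrow> nat \<Rightarrow> nat \<Rightarrow> complex" where
  "durfee_rect Q r M = Q ^ (M\<^sup>2 + M * r) / (qfact Q M * qfact Q (M + r))"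

lemma durfee_rect_summable:
  assumes Q: "norm (Q :: complex) < 1" and C: "\<And>n. norm (1 / qfact Q n) \<le> C"
  shows "norm (durfee_rect Q r M) \<le> C\<^sup>2 * norm Q ^ M"
    "summable (\<lambda>M. norm (durfee_rect Q r M))"
proof -
  have *: "norm (durfee_rect Q r M) \<le> C\<^sup>2 * norm Q ^ M" for M
  proof -
    have "norm (durfee_rect Q r M) = norm Q ^ (M\<^sup>2 + M * r) * norm (1 / qfact Q M) * norm (1 / qfact Q (M + r))"
      by (simp add: durfee_rect_def norm_mult norm_divide norm_power)
    also have "\<dots> \<le> norm Q ^ M * C * C"
    proof (intro mult_mono C)
      have "M \<le> M\<^sup>2 + M * r" by (cases M) (auto simp: power2_eq_square)
      then show "norm Q ^ (M\<^sup>2 + M * r) \<le> norm Q ^ M"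
        using Q by (intro power_decreasing) auto
      have "0 \<le> C" using C[of 0] by simp
      then show "0 \<le> norm Q ^ M * C" by auto
    qed auto
    finally show ?thesis by (simp add: power2_eq_square mult_ac)
  qed
  then show "norm (durfee_rect Q r M) \<le> C\<^sup>2 * norm Q ^ M" .
  show "summable (\<lambda>M. norm (durfee_rect Q r M))"
    by (rule summable_comparison_test'[of "\<lambda>M. C\<^sup>2 * norm Q ^ M"])
      (use Q * in \<open>auto intro!: summable_mult summable_geometric\<close>)
qed

text \<open>
  Combinatorially the sum sorts partitions by the largest rectangle of shape \<open>M\<close> times \<open>M + r\<close> in their diagram,
  so its value does not depend on \<open>r\<close>. The proof works with the sums \<open>E r\<close> directly. A recurrence gives
  \<open>E r - E (Suc r) = - Q ^ Suc r * (E (Suc r) - E (Suc (Suc r)))\<close>; iterating it makes consecutive differences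
  arbitrarily small, hence \<open>E\<close> is constant, and its limit is read off the term \<open>M = 0\<close>.
\<close>

theorem durfee_rectangle_identity:
  assumes Q: "norm (Q :: complex) < 1"
  shows "(\<lambda>M. durfee_rect Q r M) sums exp (partition_log Q)"
proof -
  obtain C where C: "\<And>n. norm (1 / qfact Q n) \<le> C"
    using qfact_inverse_bounded[OF Q] by blast
  define E where "E r = (\<Sum>M. durfee_rect Q r M)" for r
  have s: "durfee_rect Q r sums E r" for r
    unfolding E_def by (rule summable_sums[OF summable_norm_cancel[OF durfee_rect_summable(2)[OF Q C]]])
  have rec: "E r - E (Suc r) = - (Q ^ Suc r) * (E (Suc r) - E (Suc (Suc r)))" for r
  proof -
    note nz = qfact_nonzero[OF Q] one_minus_power_nonzero[OF Q]
    \<comment> \<open>splitting \<open>1 - Q ^ (M + r + 1) - Q ^ M\<close> as \<open>(1 - Q ^ M) - Q ^ (M + r + 1)\<close>; \<open>F\<close> is the part of \<open>1 - Q ^ M\<close>\<close>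
    define F where "F M = (if M = 0 then 0 else Q ^ (M\<^sup>2 + M * r) / (qfact Q (M - 1) * qfact Q (M + r + 1)))" for M
    have "(\<lambda>M. Q ^ Suc r * durfee_rect Q (Suc (Suc r)) M) sums (Q ^ Suc r * E (Suc (Suc r)))"
      by (intro sums_mult s)
    also have "(\<lambda>M. Q ^ Suc r * durfee_rect Q (Suc (Suc r)) M) = (\<lambda>M. F (Suc M))"
    proof
      fix M
      have e: "(Suc M)\<^sup>2 + Suc M * r = Suc r + (M\<^sup>2 + M * Suc (Suc r))"
        by (simp add: power2_eq_square algebra_simps)
      have "Suc M + r + 1 = M + Suc (Suc r)" by simp
      then show "Q ^ Suc r * durfee_rect Q (Suc (Suc r)) M = F (Suc M)"
        unfolding F_def durfee_rect_def e power_add by simp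
    qed
    finally have F: "F sums (Q ^ Suc r * E (Suc (Suc r)))"
      by (subst (asm) sums_Suc_iff) (simp add: F_def)
    have "(\<lambda>M. F M - Q ^ Suc r * durfee_rect Q (Suc r) M) sums (Q ^ Suc r * E (Suc (Suc r)) - Q ^ Suc r * E (Suc r))"
      by (intro sums_diff sums_mult s F)
    also have "(\<lambda>M. F M - Q ^ Suc r * durfee_rect Q (Suc r) M) = (\<lambda>M. durfee_rect Q r M - durfee_rect Q (Suc r) M)"
    proof
      fix M
      define a b c where "a = Q ^ (M\<^sup>2 + M * r)" and "b = qfact Q M" and "c = qfact Q (M + r)"
      define x y where "x = Q ^ M" and "y = Q ^ Suc r"
      have nzs: "b \<noteq> 0" "c \<noteq> 0" "1 - x * y \<noteq> 0"
        using nz(1) nz(2)[of "M + Suc r"] by (auto simp: b_def c_def x_def y_def power_add mult_ac)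
      have c': "qfact Q (M + Suc r) = c * (1 - x * y)"
        using qfact_Suc[of Q "M + r"] by (simp add: c_def x_def y_def power_add mult_ac)
      have D: "durfee_rect Q r M = a / (b * c)" "durfee_rect Q (Suc r) M = a * x / (b * (c * (1 - x * y)))"
        unfolding durfee_rect_def c' by (simp_all add: a_def b_def c_def x_def power_add mult_ac)
      have F: "F M = a * (1 - x) / (b * (c * (1 - x * y)))"
      proof (cases M)
        case 0
        then show ?thesis by (simp add: F_def x_def)
      next
        case (Suc k)
        have "b = qfact Q k * (1 - x)" unfolding b_def x_def Suc by (rule qfact_Suc)
        moreover have "1 - x \<noteq> 0" using nz(2)[of M] Suc by (simp add: x_def)
        moreover have "F M = a / (qfact Q k * (c * (1 - x * y)))"
          unfolding F_def c'[symmetric] a_def using Suc by simp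
        ultimately show ?thesis by simp
      qed
      show "F M - Q ^ Suc r * durfee_rect Q (Suc r) M = durfee_rect Q r M - durfee_rect Q (Suc r) M"
        unfolding F D y_def[symmetric] using nzs by (simp add: divide_simps) (simp add: algebra_simps)
    qed
    finally have "Q ^ Suc r * E (Suc (Suc r)) - Q ^ Suc r * E (Suc r) = E r - E (Suc r)"
      using sums_diff[OF s[of r] s[of "Suc r"]] sums_unique2 by blast
    then show ?thesis by (simp add: algebra_simps)
  qed
  have lim: "E \<longlonglongrightarrow> exp (partition_log Q)"
  proof -
    have "((\<lambda>r. \<Sum>M. durfee_rect Q r M) \<longlongrightarrow> (\<Sum>M. if M = 0 then exp (partition_log Q) else 0)) sequentially"
    proof (rule tannerys_theorem[THEN conjunct2, THEN conjunct2])
      fix M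
      show "(\<lambda>r. durfee_rect Q r M) \<longlonglongrightarrow> (if M = 0 then exp (partition_log Q) else 0)"
      proof (cases "M = 0")
        case True
        have "(\<lambda>r. 1 / qfact Q r) \<longlonglongrightarrow> 1 / exp (- partition_log Q)"
          by (intro tendsto_intros qfact_tendsto Q) auto
        then show ?thesis
          using True by (simp add: durfee_rect_def exp_minus field_simps)
      next
        case False
        have "(\<lambda>r. (Q ^ M) ^ r) \<longlonglongrightarrow> 0"
          using False by (intro LIMSEQ_power_zero norm_power_less_one Q) simp
        moreover have "(\<lambda>r. 1 / qfact Q (r + M)) \<longlonglongrightarrow> 1 / exp (- partition_log Q)"
          by (intro tendsto_intros LIMSEQ_ignore_initial_segment[OF qfact_tendsto[OF Q]]) auto
        ultimately have "(\<lambda>r. (Q ^ M) ^ r * (1 / qfact Q (r + M)) * (Q ^ (M\<^sup>2) / qfact Q M)) \<longlonglongrightarrow>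
            0 * (1 / exp (- partition_log Q)) * (Q ^ (M\<^sup>2) / qfact Q M)"
          by (intro tendsto_mult tendsto_const)
        moreover have "(Q ^ M) ^ r * (1 / qfact Q (r + M)) * (Q ^ (M\<^sup>2) / qfact Q M) = durfee_rect Q r M" for r
          by (simp add: durfee_rect_def power_add power_mult add_ac)
        ultimately show ?thesis using False by simp
      qed
    next
      show "\<forall>\<^sub>F (M, r) in sequentially \<times>\<^sub>F sequentially. norm (durfee_rect Q r M) \<le> C\<^sup>2 * norm Q ^ M"
        using durfee_rect_summable(1)[OF Q C] by (auto intro!: always_eventually)
    qed (use Q in \<open>auto intro!: summable_mult summable_geometric\<close>)
    moreover have "(\<Sum>M. if M = 0 then exp (partition_log Q) else 0) = exp (partition_log Q)"
      using sums_unique[OF sums_single[of 0 "\<lambda>_. exp (partition_log Q)"]] by simp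
    ultimately show ?thesis unfolding E_def by simp
  qed
  have step: "norm (E r - E (Suc r)) \<le> norm Q ^ k * norm (E (r + k) - E (Suc (r + k)))" for r k
  proof (induction k)
    case (Suc k)
    have "norm (E (r + k) - E (Suc (r + k))) = norm Q ^ Suc (r + k) * norm (E (Suc (r + k)) - E (Suc (Suc (r + k))))"
      by (subst rec) (simp add: norm_mult norm_power)
    also have "\<dots> \<le> norm Q ^ 1 * norm (E (Suc (r + k)) - E (Suc (Suc (r + k))))"
      using Q by (intro mult_right_mono power_decreasing) auto
    finally have "norm Q ^ k * norm (E (r + k) - E (Suc (r + k)))
        \<le> norm Q ^ k * (norm Q ^ 1 * norm (E (Suc (r + k)) - E (Suc (Suc (r + k)))))"
      by (intro mult_left_mono) auto
    with Suc show ?case by (simp add: mult_ac)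
  qed simp
  have const: "E r = E (Suc r)" for r
  proof -
    have "(\<lambda>k. norm Q ^ k * norm (E (r + k) - E (Suc (r + k)))) \<longlonglongrightarrow>
        0 * norm (exp (partition_log Q) - exp (partition_log Q))"
    proof (intro tendsto_mult tendsto_norm tendsto_diff)
      show "(\<lambda>k. norm Q ^ k) \<longlonglongrightarrow> 0" using Q by (intro LIMSEQ_power_zero) simp
      show "(\<lambda>k. E (r + k)) \<longlonglongrightarrow> exp (partition_log Q)"
        using LIMSEQ_ignore_initial_segment[OF lim, of r] by (simp add: add.commute)
      show "(\<lambda>k. E (Suc (r + k))) \<longlonglongrightarrow> exp (partition_log Q)"
        using LIMSEQ_ignore_initial_segment[OF lim, of "Suc r"] by (simp add: add.commute)
    qed
    then have "norm (E r - E (Suc r)) \<le> 0"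
      using step[of r] by (intro LIMSEQ_le_const[where X = "\<lambda>k. norm Q ^ k * norm (E (r + k) - E (Suc (r + k)))"]) auto
    then show ?thesis by simp
  qed
  have E0: "E r = E 0" for r
    by (induction r) (use const in auto)
  then have "E \<longlonglongrightarrow> E 0"
    by (intro tendsto_eventually always_eventually allI)
  from LIMSEQ_unique[OF lim this] have "exp (partition_log Q) = E r"
    unfolding E0[of r] .
  with s[of r] show ?thesis by simp
qed

section \<open>Partial fractions\<close>

text \<open>
  In the induction step the new coefficient, that of \<open>1 / (u a - z)\<close>, comes out as a sum over the old ones; it is
  the required product by the induction hypothesis at the point \<open>z = u a\<close>.
\<close>

lemma partial_fraction_prod_inverse:
  fixes u :: "'a \<Rightarrow> 'b :: field"
  assumes "finite A" "A \<noteq> {}" "inj_on u A" "\<And>j. j \<in> A \<Longrightarrow> u j \<noteq> z"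
  shows "(\<Prod>j\<in>A. 1 / (u j - z)) = (\<Sum>k\<in>A. (\<Prod>j\<in>A - {k}. 1 / (u j - u k)) / (u k - z))"
  using assms
proof (induction A arbitrary: z rule: finite_ne_induct)
  case (singleton x)
  then show ?case by simp
next
  case (insert a A)
  define W where "W k = (\<Prod>j\<in>A - {k}. 1 / (u j - u k))" for k
  have ne: "u a \<noteq> u k" if "k \<in> A" for k
    using insert that by (auto simp: inj_on_def)
  have W: "(\<Prod>j\<in>insert a A - {k}. 1 / (u j - u k)) = W k / (u a - u k)" if "k \<in> A" for k
  proof -
    have "insert a A - {k} = insert a (A - {k})" using that insert by auto
    then show ?thesis using insert by (simp add: W_def)
  qed
  have Wa: "(\<Prod>j\<in>insert a A - {a}. 1 / (u j - u a)) = (\<Sum>k\<in>A. W k / (u k - u a))"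
  proof -
    have "insert a A - {a} = A" using insert by auto
    moreover have "(\<Prod>j\<in>A. 1 / (u j - u a)) = (\<Sum>k\<in>A. W k / (u k - u a))"
      unfolding W_def using insert ne by (intro insert.IH) (auto simp: inj_on_def)
    ultimately show ?thesis by simp
  qed
  have "(\<Prod>j\<in>insert a A. 1 / (u j - z)) = (\<Sum>k\<in>A. W k / (u k - z)) / (u a - z)"
    unfolding W_def using insert by (subst insert.IH[symmetric]) auto
  also have "\<dots> = (\<Sum>k\<in>A. W k / (u k - z) / (u a - z))"
    by (simp add: sum_divide_distrib)
  also have "\<dots> = (\<Sum>k\<in>A. W k / (u a - u k) / (u k - z) + W k / (u k - u a) / (u a - z))"
  proof (rule sum.cong)
    fix k assume k: "k \<in> A"
    have "u k - z \<noteq> 0" "u a - z \<noteq> 0" "u a - u k \<noteq> 0" "u k - u a \<noteq> 0"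
      using k insert ne[OF k] by auto
    then show "W k / (u k - z) / (u a - z) = W k / (u a - u k) / (u k - z) + W k / (u k - u a) / (u a - z)"
      by (simp add: divide_simps) (simp add: algebra_simps power2_eq_square)
  qed simp
  also have "\<dots> = (\<Sum>k\<in>A. W k / (u a - u k) / (u k - z)) + (\<Sum>k\<in>A. W k / (u k - u a)) / (u a - z)"
    by (simp add: sum.distrib sum_divide_distrib)
  also have "(\<Sum>k\<in>A. W k / (u a - u k) / (u k - z))
      = (\<Sum>k\<in>A. (\<Prod>j\<in>insert a A - {k}. 1 / (u j - u k)) / (u k - z))"
    using W by (intro sum.cong) auto
  finally show ?case
    using insert Wa by simp
qed

text \<open>
  The derivative of the preceding expansion with respect to \<open>z\<close>. Repeating the induction proves
  it in every field, where differentiating is not available.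
\<close>

lemma partial_fraction_prod_inverse_deriv:
  fixes u :: "'a \<Rightarrow> 'b :: field"
  assumes "finite A" "A \<noteq> {}" "inj_on u A" "\<And>j. j \<in> A \<Longrightarrow> u j \<noteq> z"
  shows "(\<Prod>j\<in>A. 1 / (u j - z)) * (\<Sum>j\<in>A. 1 / (u j - z))
    = (\<Sum>k\<in>A. (\<Prod>j\<in>A - {k}. 1 / (u j - u k)) / (u k - z)\<^sup>2)"
  using assms
proof (induction A rule: finite_ne_induct)
  case (singleton x)
  then show ?case by (simp add: power2_eq_square)
next
  case (insert a A)
  define W where "W k = (\<Prod>j\<in>A - {k}. 1 / (u j - u k))" for k
  have ne: "u a \<noteq> u k" if "k \<in> A" for k
    using insert that by (auto simp: inj_on_def)
  have W: "(\<Prod>j\<in>insert a A - {k}. 1 / (u j - u k)) = W k / (u a - u k)" if "k \<in> A" for k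
  proof -
    have "insert a A - {k} = insert a (A - {k})" using that insert by auto
    then show ?thesis using insert by (simp add: W_def)
  qed
  have P: "(\<Prod>j\<in>A. 1 / (u j - y)) = (\<Sum>k\<in>A. W k / (u k - y))" if "\<And>j. j \<in> A \<Longrightarrow> u j \<noteq> y" for y
    unfolding W_def using insert that by (intro partial_fraction_prod_inverse) (auto simp: inj_on_def)
  have Wa: "(\<Prod>j\<in>insert a A - {a}. 1 / (u j - u a)) = (\<Sum>k\<in>A. W k / (u k - u a))"
  proof -
    have "insert a A - {a} = A" using insert by auto
    then show ?thesis using P[of "u a"] ne by (metis (no_types, lifting))
  qed
  have IH: "(\<Prod>j\<in>A. 1 / (u j - z)) * (\<Sum>j\<in>A. 1 / (u j - z)) = (\<Sum>k\<in>A. W k / (u k - z)\<^sup>2)"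
    unfolding W_def using insert by (intro insert.IH) (auto simp: inj_on_def)
  have "(\<Prod>j\<in>insert a A. 1 / (u j - z)) * (\<Sum>j\<in>insert a A. 1 / (u j - z))
      = ((\<Prod>j\<in>A. 1 / (u j - z)) * (\<Sum>j\<in>A. 1 / (u j - z))) / (u a - z)
        + (\<Prod>j\<in>A. 1 / (u j - z)) / (u a - z)\<^sup>2"
    using insert by (simp add: algebra_simps power2_eq_square)
  also have "\<dots> = (\<Sum>k\<in>A. W k / (u k - z)\<^sup>2 / (u a - z) + W k / (u k - z) / (u a - z)\<^sup>2)"
    unfolding IH using P[of z] insert by (simp add: sum_divide_distrib sum.distrib)
  also have "\<dots> = (\<Sum>k\<in>A. W k / (u a - u k) / (u k - z)\<^sup>2 + W k / (u k - u a) / (u a - z)\<^sup>2)"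
  proof (rule sum.cong)
    fix k assume k: "k \<in> A"
    have "u k - z \<noteq> 0" "u a - z \<noteq> 0" "u a - u k \<noteq> 0" "u k - u a \<noteq> 0"
      using k insert ne[OF k] by auto
    then show "W k / (u k - z)\<^sup>2 / (u a - z) + W k / (u k - z) / (u a - z)\<^sup>2
        = W k / (u a - u k) / (u k - z)\<^sup>2 + W k / (u k - u a) / (u a - z)\<^sup>2"
      by (simp add: divide_simps) (simp add: algebra_simps power2_eq_square)
  qed simp
  also have "\<dots> = (\<Sum>k\<in>A. W k / (u a - u k) / (u k - z)\<^sup>2) + (\<Sum>k\<in>A. W k / (u k - u a)) / (u a - z)\<^sup>2"
    by (simp add: sum.distrib sum_divide_distrib)
  also have "(\<Sum>k\<in>A. W k / (u a - u k) / (u k - z)\<^sup>2)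
      = (\<Sum>k\<in>A. (\<Prod>j\<in>insert a A - {k}. 1 / (u j - u k)) / (u k - z)\<^sup>2)"
    using W by (intro sum.cong) auto
  finally show ?case
    using insert Wa by simp
qed


lemma qfact_shift: "(\<Prod>j<M. 1 - Q ^ (j + k + 1)) * qfact Q k = qfact Q (M + k)"
proof (induction M)
  case (Suc M)
  have "(\<Prod>j<Suc M. 1 - Q ^ (j + k + 1)) * qfact Q k
      = ((\<Prod>j<M. 1 - Q ^ (j + k + 1)) * qfact Q k) * (1 - Q ^ Suc (M + k))"
    by simp
  then show ?case
    unfolding Suc by (simp add: qfact_Suc)
qed simp

text \<open>
  The factors with negative exponents that partial fractions produce, rewritten in terms of \<open>(q\<^sup>2; q\<^sup>2)\<^sub>k\<close>.
\<close>

lemma qfact_negative_exponents: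
  fixes q :: complex
  assumes "q \<noteq> 0"
  shows "(\<Prod>i=1..k. 1 - 1 / (q\<^sup>2) ^ i) * q ^ (k * (k + 1)) = (-1) ^ k * qfact (q\<^sup>2) k"
proof (induction k)
  case (Suc k)
  have e: "q ^ (Suc k * (Suc k + 1)) = q ^ (k * (k + 1)) * (q\<^sup>2) ^ Suc k"
    unfolding power_mult[symmetric] power_add[symmetric]
    by (rule arg_cong[where f = "power q"]) simp
  have "(\<Prod>i=1..Suc k. 1 - 1 / (q\<^sup>2) ^ i) * q ^ (Suc k * (Suc k + 1))
      = ((\<Prod>i=1..k. 1 - 1 / (q\<^sup>2) ^ i) * q ^ (k * (k + 1))) * ((1 - 1 / (q\<^sup>2) ^ Suc k) * (q\<^sup>2) ^ Suc k)"
    unfolding e by (simp del: power_Suc)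
  also have "(1 - 1 / (q\<^sup>2) ^ Suc k) * (q\<^sup>2) ^ Suc k = (-1) * (1 - (q\<^sup>2) ^ Suc k)"
    using assms by (simp add: divide_simps del: power_Suc)
  also have "(\<Prod>i=1..k. 1 - 1 / (q\<^sup>2) ^ i) * q ^ (k * (k + 1)) * ((-1) * (1 - (q\<^sup>2) ^ Suc k))
      = (-1) ^ Suc k * qfact (q\<^sup>2) (Suc k)"
    unfolding Suc qfact_Suc power_Suc[of "-1"] by (simp only: mult_ac)
  finally show ?case .
qed simp

text \<open>
  Partial fractions in \<open>u = z + 1 / z\<close> at \<open>u = 2\<close>, with poles \<open>u\<^sub>j = x\<^sub>j + 1 / x\<^sub>j\<close>. Two identities make this work:
  \<open>x\<^sub>j * (u\<^sub>j - 2) = (1 - x\<^sub>j)\<^sup>2\<close> and \<open>x\<^sub>j * (u\<^sub>j - u\<^sub>k) = (1 - x\<^sub>j / x\<^sub>k) * (1 - x\<^sub>j * x\<^sub>k)\<close>. In the second one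
  both factors are of the form \<open>1 - q powi (2 * i)\<close>, so that the coefficients collapse to products \<open>(q\<^sup>2; q\<^sup>2)\<^sub>n\<close>.
\<close>

lemma odd_durfee_partial_fractions:
  fixes q :: complex
  assumes q: "norm q < 1" "q \<noteq> 0"
  defines "x \<equiv> \<lambda>j. q ^ (2 * j + 1)"
  shows "(\<Prod>j<Suc N. 1 / (1 - x j))\<^sup>2 * (\<Sum>j<Suc N. x j / (1 - x j)\<^sup>2)
    = (\<Sum>k\<le>N. (-1) ^ k * q ^ (k * (k + 1)) / (qfact (q\<^sup>2) (N - k) * qfact (q\<^sup>2) (N + k + 1))
          * (x k * (1 + x k) / (1 - x k) ^ 3))"
proof -
  let ?Q = "q\<^sup>2"
  let ?c = "\<lambda>k. (-1) ^ k * q ^ (k * (k + 1)) / (qfact ?Q (N - k) * qfact ?Q (N + k + 1))"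
  let ?D = "(\<Prod>j<Suc N. 1 / (1 - x j))\<^sup>2 * (\<Sum>j<Suc N. x j / (1 - x j)\<^sup>2)"
  have Q: "norm ?Q < 1" using norm_power_less_one[OF q(1), of 2] by simp
  define u where "u j = x j + 1 / x j" for j
  have x0: "x j \<noteq> 0" for j using q by (simp add: x_def)
  have x1: "1 - x j \<noteq> 0" for j unfolding x_def by (intro one_minus_power_nonzero q) simp
  have xx: "x j * x k = ?Q ^ (j + k + 1)" for j k
    by (simp add: x_def flip: power_mult power_add)
  have x1x: "1 - x j * x k \<noteq> 0" for j k
    unfolding xx by (intro one_minus_power_nonzero Q) simp
  have xQ: "x k = x j * ?Q ^ (k - j)" if "j \<le> k" for j k
    unfolding x_def power_mult[symmetric] power_add[symmetric]
    by (rule arg_cong[where f = "power q"]) (use that in simp)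
  have xne: "x j \<noteq> x k" if "j < k" for j k
  proof
    assume e: "x j = x k"
    have "x k = x j * ?Q ^ (k - j)"
      using that by (intro xQ) simp
    with e x0[of j] have "1 - ?Q ^ (k - j) = 0" by simp
    with one_minus_power_nonzero[OF Q, of "k - j"] that show False by simp
  qed
  have xu: "x j * (u j - u k) = (1 - x j / x k) * (1 - x j * x k)" for j k
    using x0[of j] x0[of k] by (simp add: u_def field_simps)
  have u2: "u j - 2 = (1 - x j)\<^sup>2 / x j" for j
    using x0[of j] by (simp add: u_def field_simps power2_eq_square)
  have inj: "inj_on u {..<Suc N}"
  proof (rule inj_onI, rule ccontr)
    fix j k assume "u j = u k" "j \<noteq> k"
    then have "(1 - x j / x k) * (1 - x j * x k) = 0" using xu[of j k] by simp
    then have "x j = x k" using x1x[of j k] x0[of k] by simp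
    with \<open>j \<noteq> k\<close> xne[of j k] xne[of k j] show False by (cases "j < k") auto
  qed
  have un2: "u j \<noteq> 2" for j
    using u2[of j] x0[of j] x1[of j] by auto
  let ?W = "\<lambda>k. \<Prod>j\<in>{..<Suc N} - {k}. 1 / (u j - u k)"
  define X where "X = (\<Prod>j<Suc N. x j)"
  have X0: "X \<noteq> 0" using x0 by (simp add: X_def)
  \<comment> \<open>multiplying the \<open>k\<close>-th coefficient by \<open>x k\<close> completes the product of the \<open>x j\<close> to \<open>X\<close>\<close>
  have coeff: "x k * ?W k = X * (1 - x k * x k) *
     (?c k)" if k: "k \<le> N" for k
  proof -
    let ?A = "{..<Suc N} - {k}"
    have X: "X = x k * (\<Prod>j\<in>?A. x j)"
      unfolding X_def using k by (subst prod.remove[of _ k]) auto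
    have "(\<Prod>j\<in>?A. 1 / (u j - u k)) = (\<Prod>j\<in>?A. x j * (1 / ((1 - x j / x k) * (1 - x j * x k))))"
    proof (rule prod.cong)
      fix j assume j: "j \<in> ?A"
      then have "u j - u k \<noteq> 0" using inj k by (auto simp: inj_on_def)
      moreover have "(1 - x j / x k) * (1 - x j * x k) \<noteq> 0"
        using xu[of j k] calculation x0[of j] by (metis mult_eq_0_iff)
      ultimately show "1 / (u j - u k) = x j * (1 / ((1 - x j / x k) * (1 - x j * x k)))"
        unfolding xu[symmetric] using x0[of j] by simp
    qed simp
    then have "x k * (\<Prod>j\<in>?A. 1 / (u j - u k)) = X * (\<Prod>j\<in>?A. 1 / ((1 - x j / x k) * (1 - x j * x k)))"
      unfolding X by (simp only: prod.distrib mult.assoc)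
    also have "(\<Prod>j\<in>?A. 1 / ((1 - x j / x k) * (1 - x j * x k))) = 1 / ((\<Prod>j\<in>?A. 1 - x j / x k) * (\<Prod>j\<in>?A. 1 - x j * x k))"
      by (simp add: prod_dividef prod.distrib)
    also have "(\<Prod>j\<in>?A. 1 - x j * x k) = qfact ?Q (N + k + 1) / qfact ?Q k / (1 - x k * x k)"
    proof -
      have "(\<Prod>j<Suc N. 1 - x j * x k) = (1 - x k * x k) * (\<Prod>j\<in>?A. 1 - x j * x k)"
        using k by (subst prod.remove[of _ k]) auto
      moreover have "(\<Prod>j<Suc N. 1 - x j * x k) * qfact ?Q k = qfact ?Q (N + k + 1)"
        using qfact_shift[of ?Q k "Suc N"] by (simp add: xx)
      moreover have "P2 = b / a / f" if "P1 = f * P2" "P1 * a = b" "a \<noteq> 0" "f \<noteq> 0" for P1 P2 a b f :: complex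
        using that by (auto simp: field_simps)
      ultimately show ?thesis
        using qfact_nonzero[OF Q, of k] x1x[of k k] by blast
    qed
    also have "(\<Prod>j\<in>?A. 1 - x j / x k) = (-1) ^ k * qfact ?Q k / q ^ (k * (k + 1)) * qfact ?Q (N - k)"
    proof -
      have A: "?A = {..<k} \<union> {Suc k..N}" using k by auto
      have "(\<Prod>j\<in>?A. 1 - x j / x k) = (\<Prod>j<k. 1 - x j / x k) * (\<Prod>j=Suc k..N. 1 - x j / x k)"
        unfolding A by (rule prod.union_disjoint) auto
      also have "(\<Prod>j<k. 1 - x j / x k) = (\<Prod>i=1..k. 1 - 1 / ?Q ^ i)"
      proof (rule prod.reindex_bij_witness[of _ "\<lambda>i. k - i" "\<lambda>j. k - j"])
        fix j assume j: "j \<in> {..<k}"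
        have "x k = x j * ?Q ^ (k - j)" using j by (intro xQ) simp
        then show "1 - 1 / ?Q ^ (k - j) = 1 - x j / x k" using x0[of j] by simp
      qed auto
      also have "\<dots> = (-1) ^ k * qfact ?Q k / q ^ (k * (k + 1))"
        using qfact_negative_exponents[OF q(2), of k] q by (simp add: field_simps)
      also have "(\<Prod>j=Suc k..N. 1 - x j / x k) = (\<Prod>i=1..N-k. 1 - ?Q ^ i)"
      proof (rule prod.reindex_bij_witness[of _ "\<lambda>i. i + k" "\<lambda>j. j - k"])
        fix j assume j: "j \<in> {Suc k..N}"
        have "x j = x k * ?Q ^ (j - k)" using j by (intro xQ) simp
        then show "1 - ?Q ^ (j - k) = 1 - x j / x k" using x0[of k] by simp
      qed auto
      finally show ?thesis by (simp add: qfact_def)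
    qed
    also have "1 / ((-1) ^ k * qfact ?Q k / q ^ (k * (k + 1)) * qfact ?Q (N - k) *
        (qfact ?Q (N + k + 1) / qfact ?Q k / (1 - x k * x k)))
       = (1 - x k * x k) * (?c k)"
    proof -
      have s: "(-1 :: complex) ^ k * (-1) ^ k = 1" by (simp flip: power_mult_distrib)
      have "1 / ((s * b / c) * d * (e / b / f)) = f * (s * c / (d * e))"
        if "s * s = 1" "b \<noteq> 0" "c \<noteq> 0" "d \<noteq> 0" "e \<noteq> 0" "f \<noteq> 0" for s b c d e f :: complex
      proof -
        have "s \<noteq> 0" using that(1) by auto
        then have "1 / ((s * b / c) * d * (e / b / f)) = f * (c / (s * d * e))"
          using that by (simp add: field_simps)
        also have "c / (s * d * e) = (s * s) * c / (s * d * e)" using that(1) by simp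
        also have "\<dots> = s * c / (d * e)" using \<open>s \<noteq> 0\<close> by simp
        finally show ?thesis .
      qed
      from this[OF s qfact_nonzero[OF Q] _ qfact_nonzero[OF Q] qfact_nonzero[OF Q] x1x] q
      show ?thesis by simp
    qed
    finally show ?thesis by (simp only: mult.assoc)
  qed
  have "(\<Prod>j<Suc N. 1 / (u j - 2)) = X * (\<Prod>j<Suc N. 1 / (1 - x j))\<^sup>2"
  proof -
    have "1 / (u j - 2) = x j * (1 / (1 - x j))\<^sup>2" for j
      unfolding u2 by (simp add: power_divide)
    then show ?thesis
      unfolding X_def prod_power_distrib prod.distrib[symmetric] by simp
  qed
  moreover have "(\<Sum>j<Suc N. 1 / (u j - 2)) = (\<Sum>j<Suc N. x j / (1 - x j)\<^sup>2)"
    unfolding u2 by simp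
  ultimately have "X * (?D)
      = (\<Prod>j<Suc N. 1 / (u j - 2)) * (\<Sum>j<Suc N. 1 / (u j - 2))"
    by simp
  also have "\<dots> = (\<Sum>k<Suc N. ?W k / (u k - 2)\<^sup>2)"
    by (rule partial_fraction_prod_inverse_deriv) (use inj un2 in auto)
  finally have "?D
      = (\<Sum>k<Suc N. ?W k / (u k - 2)\<^sup>2) / X"
    using X0 by (simp add: field_simps)
  also have "\<dots> = (\<Sum>k<Suc N. ?c k
          * (x k * (1 + x k) / (1 - x k) ^ 3))"
    unfolding sum_divide_distrib
  proof (rule sum.cong)
    fix k assume "k \<in> {..<Suc N}"
    then have "k \<le> N" by simp
    define c where "c = ?c k"
    define W where "W = ?W k"
    have W: "W = X * (1 - x k * x k) * c / x k"
      using coeff[OF \<open>k \<le> N\<close>, folded c_def W_def] x0[of k] by (simp add: field_simps)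
    have "1 - x k * x k = (1 + x k) * (1 - x k)" by (simp add: algebra_simps)
    then have "W / (u k - 2)\<^sup>2 / X = c * (x k * (1 + x k) / (1 - x k) ^ 3)"
      unfolding W u2 using X0 x0[of k] x1[of k]
      by (simp add: power2_eq_square power3_eq_cube mult_ac)
    then show "?W k / (u k - 2)\<^sup>2 / X
        = ?c k
          * (x k * (1 + x k) / (1 - x k) ^ 3)"
      by (simp only: c_def W_def)
  qed simp
  finally show ?thesis
    by (simp only: lessThan_Suc_atMost)
qed

text \<open>
  The contribution of the symbols with subscript \<open>N\<close> to the generating function.
\<close>

definition symbol_gf :: "complex \<Rightarrow> nat \<Rightarrow> complex" where
  "symbol_gf q N = q ^ (2 * N\<^sup>2 + 2 * N + 1) *
     ((\<Prod>j<Suc N. 1 / (1 - q ^ (2 * j + 1)))\<^sup>2 * (\<Sum>j<Suc N. q ^ (2 * j + 1) / (1 - q ^ (2 * j + 1))\<^sup>2))"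

text \<open>
  A term of the Appell-Lerch sum
  \<open>\<Sum>n\<in>\<int>. (-1) ^ n * q ^ (3 * n\<^sup>2 + 5 * n + 2) / (1 - q ^ (2 * n + 1)) ^ 3\<close>, with the indices \<open>k\<close> and
  \<open>- 1 - k\<close> combined.
\<close>

definition appell_term :: "complex \<Rightarrow> nat \<Rightarrow> complex" where
  "appell_term q k = (-1) ^ k * q ^ (3 * k\<^sup>2 + 3 * k + 1) *
     (q ^ (2 * k + 1) * (1 + q ^ (2 * k + 1)) / (1 - q ^ (2 * k + 1)) ^ 3)"

lemma appell_term_bound:
  assumes q: "norm q < 1"
  shows "norm (appell_term q k) \<le> norm q ^ k * (2 / (1 - norm q) ^ 3)"
proof -
  define x where "x = q ^ (2 * k + 1)"
  have nx: "norm x \<le> norm q"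
    unfolding x_def norm_power using q power_decreasing[of 1 "2 * k + 1" "norm q"] by simp
  have "norm (1 - x) \<ge> 1 - norm q"
    using norm_triangle_ineq2[of 1 x] nx by simp
  then have d: "norm (1 - x) ^ 3 \<ge> (1 - norm q) ^ 3"
    using q by (intro power_mono) auto
  have n: "norm x * norm (1 + x) \<le> 1 * 2"
    using nx q norm_triangle_ineq[of 1 x] by (intro mult_mono) auto
  have "norm (appell_term q k) = norm q ^ (3 * k\<^sup>2 + 3 * k + 1) * (norm x * norm (1 + x) / norm (1 - x) ^ 3)"
    unfolding appell_term_def x_def[symmetric] by (simp add: norm_mult norm_divide norm_power)
  also have "\<dots> \<le> norm q ^ k * (2 / (1 - norm q) ^ 3)"
    using q n d by (intro mult_mono power_decreasing frac_le) auto
  finally show ?thesis .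
qed

lemma appell_term_summable:
  assumes q: "norm q < 1"
  shows "summable (\<lambda>k. norm (appell_term q k))"
  by (rule summable_comparison_test'[of "\<lambda>k. norm q ^ k * (2 / (1 - norm q) ^ 3)"])
    (use q appell_term_bound[OF q] in \<open>auto intro!: summable_mult2 summable_geometric\<close>)

text \<open>
  Exchanging the sums over \<open>N\<close> and \<open>k \<le> N\<close>: with \<open>N = k + M\<close> the exponent of \<open>q\<close> splits into
  \<open>3 * k\<^sup>2 + 3 * k + 1\<close> and twice \<open>M\<^sup>2 + M * (2 * k + 1)\<close>, and the sum over \<open>M\<close> is a Durfee rectangle sum
  in \<open>q\<^sup>2\<close>.
\<close>

lemma symbol_gf_has_sum:
  assumes q: "norm q < 1" "q \<noteq> 0"
  shows "(symbol_gf q has_sum (exp (partition_log (q\<^sup>2)) * (\<Sum>k. appell_term q k))) UNIV"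
proof -
  let ?Q = "q\<^sup>2"
  have Q: "norm ?Q < 1" using norm_power_less_one[OF q(1), of 2] by simp
  obtain C where C: "\<And>n. norm (1 / qfact ?Q n) \<le> C"
    using qfact_inverse_bounded[OF Q] by blast
  define f where "f = (\<lambda>(k, M). appell_term q k * durfee_rect ?Q (2 * k + 1) M)"
  define s where "s = exp (partition_log ?Q) * (\<Sum>k. appell_term q k)"
  have f: "(f has_sum s) (UNIV \<times> UNIV)"
  proof (rule has_sum_Sigma_abs(2)[where g = "\<lambda>k. appell_term q k * exp (partition_log ?Q)"
      and G = "\<lambda>k. norm (appell_term q k) * (\<Sum>M. norm (durfee_rect ?Q (2 * k + 1) M))"])
    fix k
    note sm = durfee_rect_summable(2)[OF Q C, of "2 * k + 1"]
    show "((\<lambda>M. f (k, M)) has_sum appell_term q k * exp (partition_log ?Q)) UNIV"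
      unfolding f_def prod.case
      by (intro has_sum_cmult_right norm_summable_imp_has_sum[OF sm durfee_rectangle_identity[OF Q]])
    show "((\<lambda>M. norm (f (k, M))) has_sum norm (appell_term q k) * (\<Sum>M. norm (durfee_rect ?Q (2 * k + 1) M))) UNIV"
      unfolding f_def prod.case norm_mult
      by (intro has_sum_cmult_right norm_summable_imp_has_sum summable_sums) (use sm in auto)
  next
    have "0 \<le> C" using C[of 0] by simp
    have b: "(\<Sum>M. norm (durfee_rect ?Q (2 * k + 1) M)) \<le> C\<^sup>2 * (1 / (1 - norm ?Q))" for k
    proof -
      have "(\<Sum>M. norm (durfee_rect ?Q (2 * k + 1) M)) \<le> (\<Sum>M. C\<^sup>2 * norm ?Q ^ M)"
        using Q by (intro suminf_le durfee_rect_summable[OF Q C] summable_mult summable_geometric) auto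
      also have "\<dots> = C\<^sup>2 * (1 / (1 - norm ?Q))"
        using Q by (subst suminf_mult) (auto simp: suminf_geometric summable_geometric)
      finally show ?thesis .
    qed
    have n0: "(\<Sum>M. norm (durfee_rect ?Q (2 * k + 1) M)) \<ge> 0" for k
      by (intro suminf_nonneg durfee_rect_summable[OF Q C]) auto
    have "summable (\<lambda>k. norm (appell_term q k) * (\<Sum>M. norm (durfee_rect ?Q (2 * k + 1) M)))"
    proof (rule summable_comparison_test')
      show "summable (\<lambda>k. norm (appell_term q k) * (C\<^sup>2 * (1 / (1 - norm ?Q))))"
        by (intro summable_mult2 appell_term_summable q)
      show "norm (norm (appell_term q k) * (\<Sum>M. norm (durfee_rect ?Q (2 * k + 1) M)))
          \<le> norm (appell_term q k) * (C\<^sup>2 * (1 / (1 - norm ?Q)))" for k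
        unfolding real_norm_def abs_mult abs_norm_cancel abs_of_nonneg[OF n0] by (intro mult_left_mono b) simp
    qed
    then show "(\<lambda>k. norm (appell_term q k) * (\<Sum>M. norm (durfee_rect ?Q (2 * k + 1) M))) summable_on UNIV"
      by (rule summable_nonneg_imp_summable_on) (use n0 in auto)
    have "(\<lambda>k. appell_term q k) sums (\<Sum>k. appell_term q k)"
      by (rule summable_sums[OF summable_norm_cancel[OF appell_term_summable[OF q(1)]]])
    from norm_summable_imp_has_sum[OF appell_term_summable[OF q(1)] this]
    show "((\<lambda>k. appell_term q k * exp (partition_log ?Q)) has_sum s) UNIV"
      unfolding s_def by (subst mult.commute) (rule has_sum_cmult_left)
  qed
  have "((\<lambda>(N, k). f (k, N - k)) has_sum s) (Sigma UNIV (\<lambda>N. {..N}))"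
    by (rule has_sum_reindex_bij_witness[THEN iffD2, OF _ _ _ _ _ refl f,
        of _ "\<lambda>(k, M). (k + M, k)" "\<lambda>(N, k). (k, N - k)"]) auto
  then have "((\<lambda>N. \<Sum>k\<le>N. f (k, N - k)) has_sum s) UNIV"
    by (rule has_sum_Sigma[OF isUCont_plus]) (auto intro: has_sum_finiteI)
  moreover have "(\<Sum>k\<le>N. f (k, N - k)) = symbol_gf q N" for N
  proof -
    have "symbol_gf q N = (\<Sum>k\<le>N. q ^ (2 * N\<^sup>2 + 2 * N + 1) *
       ((-1) ^ k * q ^ (k * (k + 1)) / (qfact ?Q (N - k) * qfact ?Q (N + k + 1))
          * (q ^ (2 * k + 1) * (1 + q ^ (2 * k + 1)) / (1 - q ^ (2 * k + 1)) ^ 3)))"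
      unfolding symbol_gf_def odd_durfee_partial_fractions[OF q] by (rule sum_distrib_left)
    also have "\<dots> = (\<Sum>k\<le>N. f (k, N - k))"
    proof (rule sum.cong)
      fix k assume "k \<in> {..N}"
      then obtain M where M: "N = k + M" using le_Suc_ex by auto
      have pw: "q ^ (2 * N\<^sup>2 + 2 * N + 1) * q ^ (k * (k + 1))
          = q ^ (3 * k\<^sup>2 + 3 * k + 1) * ?Q ^ (M\<^sup>2 + M * (2 * k + 1))"
        unfolding M power_add[symmetric] power_mult[symmetric]
        by (rule arg_cong[where f = "power q"]) (simp add: power2_eq_square algebra_simps)
      have nk: "N + k + 1 = M + (2 * k + 1)" "N - k = M" using M by auto
      have H: "a * (t * b / d * g) = t * c * g * (h / d)" if "a * b = c * h" for a b c d g h t :: complex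
      proof -
        have "a * (t * b / d * g) = (a * b) * t * g / d" by simp
        also have "\<dots> = t * c * g * (h / d)" unfolding that by simp
        finally show ?thesis .
      qed
      show "q ^ (2 * N\<^sup>2 + 2 * N + 1) *
       ((-1) ^ k * q ^ (k * (k + 1)) / (qfact ?Q (N - k) * qfact ?Q (N + k + 1))
          * (q ^ (2 * k + 1) * (1 + q ^ (2 * k + 1)) / (1 - q ^ (2 * k + 1)) ^ 3)) = f (k, N - k)"
        unfolding f_def prod.case appell_term_def durfee_rect_def nk by (rule H[OF pw])
    qed simp
    finally show ?thesis ..
  qed
  ultimately show ?thesis by (simp add: s_def)
qed

section \<open>The generating function of the second rank moment\<close>

text \<open>
  Twice the weight of a symbol, which keeps the definition within the integers.
\<close>

definition rank_weight :: "nat list \<Rightarrow> nat list \<Rightarrow> int" where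
  "rank_weight as bs = (int (length as) - int (length bs)) * (int (length as) - int (length bs) + 1)"

lemma rank_weight_nonneg: "rank_weight as bs \<ge> 0"
proof -
  have "d * (d + 1) \<ge> 0" for d :: int
    by (cases "d \<ge> 0") (auto simp: mult_nonpos_nonpos)
  then show ?thesis by (simp add: rank_weight_def)
qed

definition symbols_of_size :: "nat \<Rightarrow> (nat \<times> nat list \<times> nat list) set" where
  "symbols_of_size n = {(N, as, bs). odd_durfee_symbol (as, bs, N) \<and> odd_durfee_size (as, bs, N) = n}"

lemma finite_symbols_of_size: "finite (symbols_of_size n)"
proof (rule finite_subset)
  let ?L = "{xs. set xs \<subseteq> {..n} \<and> length xs \<le> n}"
  show "symbols_of_size n \<subseteq> {..n} \<times> ?L \<times> ?L"
    by (fastforce simp: symbols_of_size_def dest: odd_durfee_row_bounds)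
  show "finite ({..n} \<times> ?L \<times> ?L)"
    by (simp add: finite_lists_length_le)
qed

text \<open>
  Grouping the symbols by their rank turns the definition by rank counts into one sum over symbols.
\<close>

lemma eta2_odd_eq_sum_symbols:
  "eta2_odd n = (\<Sum>(N, as, bs)\<in>symbols_of_size n. of_int (rank_weight as bs) / 2)"
proof -
  let ?f = "\<lambda>(N, as, bs). of_int (rank_weight as bs) / 2 :: real"
  let ?rk = "\<lambda>(N, as, bs). int (length (as :: nat list)) - int (length (bs :: nat list))"
  have rk: "?rk ` symbols_of_size n \<subseteq> {- int n..int n}"
  proof (rule image_subsetI)
    fix s assume s: "s \<in> symbols_of_size n"
    obtain N as bs where sd: "s = (N, as, bs)" by (cases s)
    with s have "length as \<le> sum_list as" "length bs \<le> sum_list bs" "sum_list as + sum_list bs \<le> n"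
      by (auto simp: symbols_of_size_def odd_durfee_row_bounds)
    then show "?rk s \<in> {- int n..int n}" by (simp add: sd)
  qed
  have "(\<Sum>s\<in>symbols_of_size n. ?f s)
      = (\<Sum>m = - int n..int n. \<Sum>s\<in>{s \<in> symbols_of_size n. ?rk s = m}. ?f s)"
    by (rule sum.group[symmetric, OF finite_symbols_of_size _ rk]) simp
  also have "\<dots> = (\<Sum>m = - int n..int n. (real_of_int m * (real_of_int m + 1) / 2) * real (odd_rank_count m n))"
  proof (rule sum.cong)
    fix m
    let ?S = "{s \<in> symbols_of_size n. ?rk s = m}"
    have "(\<Sum>s\<in>?S. ?f s) = (\<Sum>s\<in>?S. real_of_int m * (real_of_int m + 1) / 2)"
      by (rule sum.cong) (auto simp: rank_weight_def)
    also have "\<dots> = (real_of_int m * (real_of_int m + 1) / 2) * real (card ?S)"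
      by simp
    also have "card ?S = odd_rank_count m n"
      unfolding odd_rank_count_def odd_durfee_symbols_def
      by (rule bij_betw_same_card[of "\<lambda>(N, as, bs). (as, bs, N)"],
          rule bij_betw_byWitness[where f' = "\<lambda>(as, bs, N). (N, as, bs)"])
        (auto simp: symbols_of_size_def)
    finally show "(\<Sum>s\<in>?S. ?f s) = (real_of_int m * (real_of_int m + 1) / 2) * real (odd_rank_count m n)" .
  qed simp
  finally show ?thesis
    by (simp add: eta2_odd_finite_sum)
qed

text \<open>
  The products stay bounded because \<open>1 / (r; r)\<^sub>n\<close> does; the sum grows at most linearly in \<open>N\<close>, and the
  prefactor decays.
\<close>

lemma eta_majorant_summable:
  fixes r :: real
  assumes r: "0 \<le> r" "r < 1"
  shows "summable (\<lambda>N. r ^ (2 * N\<^sup>2 + 2 * N + 1) *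
     ((\<Prod>j<Suc N. 1 / (1 - r ^ (2 * j + 1)))\<^sup>2 * (\<Sum>j<Suc N. r ^ (2 * j + 1) / (1 - r ^ (2 * j + 1))\<^sup>2)))"
    (is "summable ?f")
proof -
  obtain C where C: "\<And>n. norm (1 / qfact (complex_of_real r) n) \<le> C"
    using qfact_inverse_bounded[of "of_real r"] r by auto
  have pow: "r ^ (2 * j + 1) \<le> r ^ Suc j" "r ^ (2 * j + 1) \<le> r" "r ^ Suc j < 1" for j
    using r power_decreasing[of "Suc j" "2 * j + 1" r] power_decreasing[of 1 "2 * j + 1" r]
      power_less_one_iff[of r "Suc j"] by auto
  have P: "(\<Prod>j<Suc N. 1 / (1 - r ^ (2 * j + 1))) \<le> C" for N
  proof -
    have "(\<Prod>j<Suc N. 1 / (1 - r ^ (2 * j + 1))) \<le> (\<Prod>j<Suc N. 1 / (1 - r ^ Suc j))"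
    proof (rule prod_mono)
      fix j
      show "0 \<le> 1 / (1 - r ^ (2 * j + 1)) \<and> 1 / (1 - r ^ (2 * j + 1)) \<le> 1 / (1 - r ^ Suc j)"
        using pow[of j] by (auto intro!: divide_left_mono mult_pos_pos simp del: power_Suc)
    qed
    also have "\<dots> = 1 / (\<Prod>j=1..Suc N. 1 - r ^ j)"
    proof -
      have "(\<Prod>j=1..Suc N. 1 - r ^ j) = (\<Prod>j<Suc N. 1 - r ^ Suc j)"
        by (rule prod.reindex_bij_witness[of _ Suc "\<lambda>j. j - 1"]) auto
      then show ?thesis by (simp add: prod_dividef del: power_Suc prod.lessThan_Suc)
    qed
    also have "\<dots> \<le> \<bar>\<dots>\<bar>" by (rule abs_ge_self)
    also have "\<dots> = norm (1 / qfact (complex_of_real r) (Suc N))"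
    proof -
      have "qfact (complex_of_real r) (Suc N) = complex_of_real (\<Prod>j=1..Suc N. 1 - r ^ j)"
        by (simp add: qfact_def del: prod.cl_ivl_Suc)
      then show ?thesis by (simp only: norm_divide norm_of_real norm_one abs_divide abs_one)
    qed
    also have "\<dots> \<le> C" by (rule C)
    finally show ?thesis .
  qed
  have P0: "0 \<le> (\<Prod>j<Suc N. 1 / (1 - r ^ (2 * j + 1)))" for N
    using pow r by (intro prod_nonneg) (auto intro: order_trans[of _ r] less_imp_le)
  have B: "(\<Sum>j<Suc N. r ^ (2 * j + 1) / (1 - r ^ (2 * j + 1))\<^sup>2) \<le> real (Suc N) * (1 / (1 - r)\<^sup>2)" for N
  proof -
    have "r ^ (2 * j + 1) / (1 - r ^ (2 * j + 1))\<^sup>2 \<le> 1 / (1 - r)\<^sup>2" for j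
      using pow[of j] r by (intro frac_le power_mono) (auto intro: order_trans[of _ r])
    from sum_bounded_above[of "{..<Suc N}", OF this] show ?thesis by simp
  qed
  have B0: "0 \<le> (\<Sum>j<Suc N. r ^ (2 * j + 1) / (1 - r ^ (2 * j + 1))\<^sup>2)" for N
    using r by (intro sum_nonneg) auto
  have f0: "0 \<le> ?f N" for N
    using r B0 by (intro mult_nonneg_nonneg) auto
  have fle: "?f N \<le> (of_nat N * r ^ N + r ^ N) * (C\<^sup>2 * (1 / (1 - r)\<^sup>2))" for N
  proof -
    have "?f N \<le> r ^ N * (C\<^sup>2 * (real (Suc N) * (1 / (1 - r)\<^sup>2)))"
      using r P P0 B B0 by (intro mult_mono power_mono power_decreasing) auto
    also have "\<dots> = (of_nat N * r ^ N + r ^ N) * (C\<^sup>2 * (1 / (1 - r)\<^sup>2))"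
      by (simp add: algebra_simps)
    finally show ?thesis .
  qed
  have "summable (\<lambda>N. (of_nat N * r ^ N + r ^ N) * (C\<^sup>2 * (1 / (1 - r)\<^sup>2)))"
  proof (intro summable_mult2 summable_add)
    have nr: "norm r < 1" using r by simp
    show "summable (\<lambda>N. of_nat N * r ^ N)"
      using has_sum_imp_sums[OF geometric_moments(3)[OF nr]] by (simp add: sums_iff)
    show "summable (\<lambda>N. r ^ N)" using r by (simp add: summable_geometric)
  qed
  then show ?thesis
    by (rule summable_comparison_test'[where N = 0]) (use f0 fle in auto)
qed

text \<open>
  All symbols are summed twice: by subscript, which gives the closed form, and by size, which gives the power
  series. Absolute convergence comes from the same sum at \<open>norm q\<close>, since the weights are nonnegative.
\<close>

theorem eta2_odd_generating_function:
  assumes q: "norm q < 1" "q \<noteq> 0"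
  shows "(\<lambda>n. complex_of_real (eta2_odd n) * q ^ n) sums
     (exp (partition_log (q\<^sup>2)) * (\<Sum>k. appell_term q k))"
    "summable (\<lambda>n. norm (complex_of_real (eta2_odd n) * q ^ n))"
proof -
  define r where "r = norm q"
  have r: "0 \<le> r" "r < 1" using q by (auto simp: r_def)
  have nr: "norm r < 1" using r by simp
  define R where "R N = odd_rows (Suc N) \<times> odd_rows (Suc N)" for N
  define f :: "nat \<times> nat list \<times> nat list \<Rightarrow> complex" where
    "f = (\<lambda>(N, as, bs). of_int (rank_weight as bs) / 2 * q ^ odd_durfee_size (as, bs, N))"
  define s where "s = exp (partition_log (q\<^sup>2)) * (\<Sum>k. appell_term q k)"
  define G where "G N = r ^ (2 * N\<^sup>2 + 2 * N + 1) *
     ((\<Prod>j<Suc N. 1 / (1 - r ^ (2 * j + 1)))\<^sup>2 * (\<Sum>j<Suc N. r ^ (2 * j + 1) / (1 - r ^ (2 * j + 1))\<^sup>2))" for N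
  note SG = has_sum_Sigma_abs[where f = f and g = "symbol_gf q" and G = G and A = UNIV and B = R and s = s]
  have 1: "((\<lambda>y. f (N, y)) has_sum symbol_gf q N) (R N)" for N
  proof -
    have "((\<lambda>p. q ^ (2 * N\<^sup>2 + 2 * N + 1) * (case p of (as, bs) \<Rightarrow>
        of_int ((int (length as) - int (length bs)) * (int (length as) - int (length bs) + 1)) / 2
          * q ^ (sum_list as + sum_list bs))) has_sum symbol_gf q N) (R N)"
      unfolding symbol_gf_def R_def by (intro has_sum_cmult_right symbol_pairs_has_sum q)
    then show ?thesis
      by (rule has_sum_cong[THEN iffD1, rotated])
        (auto simp: f_def rank_weight_def power_add mult_ac)
  qed
  have 2: "((\<lambda>y. norm (f (N, y))) has_sum G N) (R N)" for N
  proof -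
    have "((\<lambda>p. r ^ (2 * N\<^sup>2 + 2 * N + 1) * (case p of (as, bs) \<Rightarrow>
        of_int ((int (length as) - int (length bs)) * (int (length as) - int (length bs) + 1)) / 2
          * r ^ (sum_list as + sum_list bs))) has_sum G N) (R N)"
      unfolding G_def R_def by (intro has_sum_cmult_right symbol_pairs_has_sum nr)
    then show ?thesis
    proof (rule has_sum_cong[THEN iffD1, rotated])
      fix p :: "nat list \<times> nat list"
      obtain as bs where p: "p = (as, bs)" by (cases p)
      have "norm (f (N, p)) = \<bar>of_int (rank_weight as bs)\<bar> / 2 * r ^ odd_durfee_size (as, bs, N)"
        unfolding p f_def prod.case norm_mult norm_divide norm_power r_def[symmetric] norm_of_int by simp
      also have "\<bar>real_of_int (rank_weight as bs)\<bar> = of_int (rank_weight as bs)"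
        using rank_weight_nonneg by simp
      finally show "r ^ (2 * N\<^sup>2 + 2 * N + 1) * (case p of (as, bs) \<Rightarrow>
        of_int ((int (length as) - int (length bs)) * (int (length as) - int (length bs) + 1)) / 2
          * r ^ (sum_list as + sum_list bs)) = norm (f (N, p))"
        unfolding p prod.case rank_weight_def by (simp add: power_add mult_ac)
    qed
  qed
  have G0: "G N \<ge> 0" for N
    using 2[of N] by (rule has_sum_nonneg) auto
  have 3: "G summable_on UNIV"
    using eta_majorant_summable[OF r, folded G_def] G0 by (intro summable_nonneg_imp_summable_on) auto
  have 4: "(symbol_gf q has_sum s) UNIV"
    unfolding s_def by (rule symbol_gf_has_sum[OF q])
  have fs: "(f has_sum s) (Sigma UNIV R)" and fa: "(\<lambda>x. norm (f x)) summable_on (Sigma UNIV R)"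
    using SG[OF 1 2 3 4] by auto
  have bij: "bij_betw snd (Sigma UNIV symbols_of_size) (Sigma UNIV R)"
    by (rule bij_betw_byWitness[where f' = "\<lambda>(N, as, bs). (odd_durfee_size (as, bs, N), (N, as, bs))"])
      (auto simp: symbols_of_size_def R_def odd_durfee_row_odd_rows[symmetric])
  have fs': "((\<lambda>p. f (snd p)) has_sum s) (Sigma UNIV symbols_of_size)"
    using fs has_sum_reindex_bij_betw[OF bij] by blast
  have inner: "(\<Sum>t\<in>symbols_of_size n. f t) = complex_of_real (eta2_odd n) * q ^ n" for n
  proof -
    have "(\<Sum>t\<in>symbols_of_size n. f t) = (\<Sum>t\<in>symbols_of_size n. complex_of_real (case t of (N, as, bs) \<Rightarrow> of_int (rank_weight as bs) / 2) * q ^ n)"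
      by (rule sum.cong) (auto simp: f_def symbols_of_size_def simp del: odd_durfee_size.simps)
    then show ?thesis
      unfolding eta2_odd_eq_sum_symbols of_real_sum sum_distrib_right .
  qed
  have hs: "((\<lambda>n. complex_of_real (eta2_odd n) * q ^ n) has_sum s) UNIV"
    by (rule has_sum_Sigma[OF isUCont_plus fs']) (auto simp: inner finite_symbols_of_size intro!: has_sum_finiteI)
  from has_sum_imp_sums[OF this]
  show "(\<lambda>n. complex_of_real (eta2_odd n) * q ^ n) sums (exp (partition_log (q\<^sup>2)) * (\<Sum>k. appell_term q k))"
    unfolding s_def .
  have "(\<lambda>n. complex_of_real (eta2_odd n) * q ^ n) summable_on UNIV"
    using hs has_sum_imp_summable by blast
  then have "(\<lambda>n. norm (complex_of_real (eta2_odd n) * q ^ n)) summable_on UNIV"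
    by (simp only: summable_on_iff_abs_summable_on_complex)
  then show "summable (\<lambda>n. norm (complex_of_real (eta2_odd n) * q ^ n))"
    by (rule summable_on_imp_summable)
qed

section \<open>The partition product near 1 on the real axis\<close>

definition partition_log_real :: "real \<Rightarrow> real" where
  "partition_log_real t = (\<Sum>m. exp (- t) ^ Suc m / (of_nat (Suc m) * (1 - exp (- t) ^ Suc m)))"

lemma partition_log_real_sums:
  assumes "t > 0"
  shows "(\<lambda>m. exp (- t) ^ Suc m / (of_nat (Suc m) * (1 - exp (- t) ^ Suc m))) sums partition_log_real t"
  unfolding partition_log_real_def using assms
  by (intro summable_sums partition_log_summable_real) auto

lemma partition_log_of_real:
  assumes "t > 0"
  shows "partition_log (exp (- complex_of_real t)) = of_real (partition_log_real t)"
proof -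
  have "(\<lambda>m. complex_of_real (exp (- t) ^ Suc m / (of_nat (Suc m) * (1 - exp (- t) ^ Suc m)))) sums of_real (partition_log_real t)"
    by (intro sums_of_real partition_log_real_sums assms)
  then have "(\<Sum>m. complex_of_real (exp (- t) ^ Suc m / (of_nat (Suc m) * (1 - exp (- t) ^ Suc m)))) = of_real (partition_log_real t)"
    by (rule sums_unique[symmetric])
  then show ?thesis
    unfolding partition_log_def by (simp flip: exp_of_real)
qed

lemma partition_log_real_eq_sum_ln:
  assumes t: "t > 0"
  shows "(\<lambda>j. - ln (1 - exp (- (real (Suc j) * t)))) sums partition_log_real t"
proof -
  define r where "r = exp (- t)"
  have r: "0 < r" "r < 1" using t by (auto simp: r_def)
  have pos: "1 - r ^ j > 0" if "j > 0" for j
    using r that power_less_one_iff[of r j] by simp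
  have nz: "r ^ j \<noteq> 1" if "Suc 0 \<le> j" for j
    using pos[of j] that by auto
  have "(\<lambda>n. complex_of_real (\<Prod>j=1..n. 1 - r ^ j)) \<longlonglongrightarrow> complex_of_real (exp (- partition_log_real t))"
  proof -
    have "norm (complex_of_real r) < 1" using r by simp
    from qfact_tendsto[OF this] have "(\<lambda>n. qfact (complex_of_real r) n) \<longlonglongrightarrow> exp (- partition_log (complex_of_real r))" .
    moreover have "partition_log (complex_of_real r) = of_real (partition_log_real t)"
      using partition_log_of_real[OF t] by (simp add: r_def flip: exp_of_real)
    moreover have "qfact (complex_of_real r) n = complex_of_real (\<Prod>j=1..n. 1 - r ^ j)" for n
      by (simp add: qfact_def)
    ultimately show ?thesis by (simp only: exp_of_real of_real_minus[symmetric])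
  qed
  then have "(\<lambda>n. \<Prod>j=1..n. 1 - r ^ j) \<longlonglongrightarrow> exp (- partition_log_real t)"
    by (simp only: tendsto_of_real_iff)
  then have "(\<lambda>n. ln (\<Prod>j=1..n. 1 - r ^ j)) \<longlonglongrightarrow> ln (exp (- partition_log_real t))"
    by (rule tendsto_ln) simp
  moreover have "ln (\<Prod>j=1..n. 1 - r ^ j) = - (\<Sum>j<n. - ln (1 - exp (- (real (Suc j) * t))))" for n
  proof -
    have "ln (\<Prod>j=1..n. 1 - r ^ j) = (\<Sum>j=1..n. ln (1 - r ^ j))"
      by (rule ln_prod) (use nz in auto)
    also have "\<dots> = (\<Sum>j<n. ln (1 - r ^ Suc j))"
      by (rule sum.reindex_bij_witness[of _ Suc "\<lambda>j. j - 1"]) auto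
    also have "\<dots> = (\<Sum>j<n. ln (1 - exp (- (real (Suc j) * t))))"
      by (intro sum.cong) (auto simp: r_def algebra_simps simp flip: exp_of_nat_mult exp_add)
    finally show ?thesis by (simp add: sum_negf)
  qed
  ultimately have "(\<lambda>n. - (\<Sum>j<n. - ln (1 - exp (- (real (Suc j) * t))))) \<longlonglongrightarrow> - partition_log_real t"
    by simp
  then show ?thesis
    unfolding sums_def by (simp only: tendsto_minus_cancel_left[symmetric] minus_minus)
qed

text \<open>
  Euler's product for the sine at the imaginary point \<open>\<i> / t\<close>.
\<close>

lemma sum_ln_sinh_product:
  assumes t: "t > 0"
  shows "(\<lambda>j. ln (1 + 1 / (real (Suc j) * t)\<^sup>2) / 2) sums (ln (sinh (pi / t) / (pi / t)) / 2)"
proof -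
  define z where "z = \<i> * complex_of_real (1 / t)"
  have z2: "z\<^sup>2 = complex_of_real (- (1 / t\<^sup>2))"
    by (simp add: z_def power_mult_distrib power_divide)
  have "(\<lambda>n. of_real pi * z * (\<Prod>k=1..n. 1 - z\<^sup>2 / of_nat k^2)) \<longlonglongrightarrow> sin (of_real pi * z)"
    by (rule sin_product_formula_complex)
  then have "(\<lambda>n. of_real pi * z * (\<Prod>k=1..n. 1 - z\<^sup>2 / of_nat k^2) / (of_real pi * z)) \<longlonglongrightarrow> sin (of_real pi * z) / (of_real pi * z)"
    by (rule tendsto_divide[OF _ tendsto_const]) (use t in \<open>simp add: z_def\<close>)
  moreover have "of_real pi * z * (\<Prod>k=1..n. 1 - z\<^sup>2 / of_nat k^2) / (of_real pi * z)
      = complex_of_real (\<Prod>k=1..n. 1 + 1 / (real k * t)\<^sup>2)" for n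
  proof -
    have "of_real pi * z \<noteq> 0" using t by (simp add: z_def)
    then have "of_real pi * z * (\<Prod>k=1..n. 1 - z\<^sup>2 / of_nat k^2) / (of_real pi * z) = (\<Prod>k=1..n. 1 - z\<^sup>2 / of_nat k^2)"
      by simp
    also have "\<dots> = (\<Prod>k=1..n. complex_of_real (1 + 1 / (real k * t)\<^sup>2))"
      by (rule prod.cong) (auto simp: z2 power_mult_distrib mult.commute)
    finally show ?thesis by simp
  qed
  moreover have "sin (of_real pi * z) / (of_real pi * z) = complex_of_real (sinh (pi / t) / (pi / t))"
  proof -
    have "sin (of_real pi * z) = \<i> * sinh (complex_of_real (pi / t))"
      by (simp add: sinh_conv_sin z_def mult.commute mult.left_commute)
    moreover have "sinh (complex_of_real y) = of_real (sinh y)" for y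
      by (simp add: sinh_def scaleR_conv_of_real flip: exp_of_real)
    ultimately show ?thesis
      using t by (simp only:) (simp add: z_def)
  qed
  ultimately have "(\<lambda>n. complex_of_real (\<Prod>k=1..n. 1 + 1 / (real k * t)\<^sup>2)) \<longlonglongrightarrow> complex_of_real (sinh (pi / t) / (pi / t))"
    by (simp only:)
  then have P: "(\<lambda>n. \<Prod>k=1..n. 1 + 1 / (real k * t)\<^sup>2) \<longlonglongrightarrow> sinh (pi / t) / (pi / t)"
    by (simp only: tendsto_of_real_iff)
  have pos: "1 + 1 / (real k * t)\<^sup>2 > 0" for k
    by (intro add_pos_nonneg) auto
  have "(\<lambda>n. ln (\<Prod>k=1..n. 1 + 1 / (real k * t)\<^sup>2)) \<longlonglongrightarrow> ln (sinh (pi / t) / (pi / t))"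
    by (rule tendsto_ln[OF P]) (use t in simp)
  moreover have "ln (\<Prod>k=1..n. 1 + 1 / (real k * t)\<^sup>2) = (\<Sum>j<n. ln (1 + 1 / (real (Suc j) * t)\<^sup>2))" for n
  proof -
    have "ln (\<Prod>k=1..n. 1 + 1 / (real k * t)\<^sup>2) = (\<Sum>k=1..n. ln (1 + 1 / (real k * t)\<^sup>2))"
      by (rule ln_prod) (use pos in \<open>auto simp: less_le\<close>)
    also have "\<dots> = (\<Sum>j<n. ln (1 + 1 / (real (Suc j) * t)\<^sup>2))"
      by (rule sum.reindex_bij_witness[of _ Suc "\<lambda>j. j - 1"]) auto
    finally show ?thesis .
  qed
  ultimately have "(\<lambda>j. ln (1 + 1 / (real (Suc j) * t)\<^sup>2)) sums ln (sinh (pi / t) / (pi / t))"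
    unfolding sums_def by simp
  then show ?thesis by (rule sums_divide)
qed

text \<open>
  Summing \<open>- ln (1 - exp (- x))\<close> over the multiples of \<open>t\<close> gives \<open>partition_log_real t\<close>, but the logarithmic
  singularity at \<open>0\<close> spoils a comparison with an integral. The subtracted function has the same singularity and its
  sum is known in closed form. At \<open>0\<close> the convention for division by \<open>0\<close> yields the continuous value \<open>0\<close>.
\<close>

definition log_defect :: "real \<Rightarrow> real" where
  "log_defect x = - ln (1 - exp (- x)) - ln (1 + 1 / x\<^sup>2) / 2"

lemma log_defect_0 [simp]: "log_defect 0 = 0"
  by (simp add: log_defect_def)

lemma log_defect_near_0:
  assumes x: "0 < x" "x \<le> 1"
  shows "\<bar>log_defect x\<bar> \<le> x"
proof -
  define y where "y = (1 - exp (- x)) / x"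
  have "1 - exp (- x) > 0" using x by simp
  then have y0: "y > 0" using x by (simp add: y_def)
  have "1 - x \<le> exp (- x)" using exp_ge_add_one_self[of "- x"] by simp
  then have y1: "y \<le> 1" using x by (simp add: y_def)
  have y2: "y \<ge> 1 - x / 2"
  proof -
    have "exp (- x) \<le> 1 - x + x\<^sup>2 / 2"
    proof -
      let ?F = "\<lambda>x. 1 - x + x\<^sup>2 / 2 - exp (- x)"
      have "?F 0 \<le> ?F x"
      proof (rule DERIV_nonneg_imp_nondecreasing[where f = ?F])
        fix u :: real assume "0 \<le> u"
        have "((\<lambda>x. 1 - x + x\<^sup>2 / 2 - exp (- x)) has_real_derivative (- 1 + u + exp (- u))) (at u)"
          by (auto intro!: derivative_eq_intros)
        moreover have "- 1 + u + exp (- u) \<ge> 0" using exp_ge_add_one_self[of "- u"] by simp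
        ultimately show "\<exists>y. ((\<lambda>x. 1 - x + x\<^sup>2 / 2 - exp (- x)) has_real_derivative y) (at u) \<and> 0 \<le> y" by blast
      qed (use x in auto)
      then show ?thesis by simp
    qed
    then show ?thesis using x by (simp add: y_def field_simps power2_eq_square)
  qed
  have eq: "log_defect x = - ln y - ln (1 + x\<^sup>2) / 2"
  proof -
    have "1 + 1 / x\<^sup>2 = (1 + x\<^sup>2) / x\<^sup>2" using x by (simp add: field_simps)
    moreover have "1 + x\<^sup>2 > 0" by (intro add_pos_nonneg) auto
    ultimately have "ln (1 + 1 / x\<^sup>2) = ln (1 + x\<^sup>2) - 2 * ln x"
      using x by (simp add: ln_div ln_realpow)
    moreover have "ln y = ln (1 - exp (- x)) - ln x"
      using x \<open>1 - exp (- x) > 0\<close> by (simp add: y_def ln_div)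
    ultimately show ?thesis by (simp add: log_defect_def field_simps)
  qed
  have "ln y \<le> 0" using y0 y1 by simp
  moreover have "ln y \<ge> - x"
  proof -
    have "- (x / 2) - 2 * (x / 2)\<^sup>2 \<le> ln (1 - x / 2)"
      using x by (intro ln_one_minus_pos_lower_bound) auto
    also have "\<dots> \<le> ln y" using y2 x by (intro ln_mono) auto
    finally have "- (x / 2) - 2 * (x / 2)\<^sup>2 \<le> ln y" .
    moreover have "2 * (x / 2)\<^sup>2 \<le> x / 2" using x by (simp add: power2_eq_square)
    ultimately show ?thesis by linarith
  qed
  moreover have "ln (1 + x\<^sup>2) \<le> x"
  proof -
    have "ln (1 + x\<^sup>2) \<le> x\<^sup>2" by (intro ln_add_one_self_le_self) auto
    also have "\<dots> \<le> x" using x by (simp add: power2_eq_square mult_left_le)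
    finally show ?thesis .
  qed
  moreover have "ln (1 + x\<^sup>2) \<ge> 0" by simp
  ultimately show ?thesis unfolding eq by linarith
qed

definition log_defect' :: "real \<Rightarrow> real" where
  "log_defect' x = - 1 / (exp x - 1) + 1 / (x ^ 3 + x)"

definition log_defect'' :: "real \<Rightarrow> real" where
  "log_defect'' x = exp x / (exp x - 1)\<^sup>2 - (3 * x\<^sup>2 + 1) / (x ^ 3 + x)\<^sup>2"

lemma log_defect_deriv:
  assumes x: "x > 0"
  shows "(log_defect has_real_derivative log_defect' x) (at x)"
    "(log_defect' has_real_derivative log_defect'' x) (at x)"
proof -
  have e: "exp x - 1 > 0" "1 - exp (- x) > 0" using x by auto
  have p: "x ^ 3 + x > 0" using x by (intro add_pos_pos) auto
  have q: "1 + 1 / x\<^sup>2 > 0" by (intro add_pos_nonneg) auto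
  have "(log_defect has_real_derivative (- (exp (- x) / (1 - exp (- x))) - ((- (2 * x)) / (x\<^sup>2)\<^sup>2) / (1 + 1 / x\<^sup>2) / 2)) (at x)"
    unfolding log_defect_def using e q x
    by (auto intro!: derivative_eq_intros simp: power2_eq_square)
  moreover have "exp (- x) / (1 - exp (- x)) = 1 / (exp x - 1)"
    using e by (simp add: exp_minus field_simps)
  moreover have "((- (2 * x)) / (x\<^sup>2)\<^sup>2) / (1 + 1 / x\<^sup>2) / 2 = - 1 / (x ^ 3 + x)"
  proof -
    have "x * x + 1 > 0" using x by (intro add_nonneg_pos) auto
    then show ?thesis using x p by (simp add: divide_simps power2_eq_square power3_eq_cube) (simp add: algebra_simps)
  qed
  ultimately show "(log_defect has_real_derivative log_defect' x) (at x)"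
    by (simp add: log_defect'_def)
  have "((\<lambda>x. - 1 / (exp x - 1)) has_real_derivative exp x / (exp x - 1)\<^sup>2) (at x)"
    using e by (auto intro!: derivative_eq_intros simp: power2_eq_square)
  moreover have "((\<lambda>x. 1 / (x ^ 3 + x)) has_real_derivative - ((3 * x\<^sup>2 + 1) / (x ^ 3 + x)\<^sup>2)) (at x)"
    by (rule derivative_eq_intros refl)+ (use p in \<open>simp_all add: divide_simps power2_eq_square\<close>)
  ultimately have "((\<lambda>x. - 1 / (exp x - 1) + 1 / (x ^ 3 + x)) has_real_derivative
      exp x / (exp x - 1)\<^sup>2 + - ((3 * x\<^sup>2 + 1) / (x ^ 3 + x)\<^sup>2)) (at x)"
    by (rule DERIV_add)
  then show "(log_defect' has_real_derivative log_defect'' x) (at x)"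
    by (simp add: log_defect'_def[abs_def] log_defect''_def)
qed

text \<open>
  Both parts of the second derivative differ from \<open>1 / x\<^sup>2\<close> by at most the smaller of \<open>1 / x\<close> and \<open>1 / x\<^sup>2\<close>. The
  geometric mean of these two is enough: it is summable over the multiples of \<open>t\<close>.
\<close>

lemma log_defect''_bound:
  assumes x: "x > 0"
  shows "\<bar>log_defect'' x\<bar> \<le> 2 / (x * sqrt x)"
proof -
  have m: "min (1 / x) (1 / x\<^sup>2) \<le> 1 / (x * sqrt x)"
  proof (cases "x \<le> 1")
    case True
    then have "sqrt x \<le> 1" using x by simp
    then have "x * sqrt x \<le> x" using x by (simp add: mult_left_le)
    then have "1 / x \<le> 1 / (x * sqrt x)" using x by (intro divide_left_mono) auto
    then show ?thesis by linarith
  next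
    case False
    then have "x \<le> x\<^sup>2" using x by (simp add: power2_eq_square)
    then have "sqrt x \<le> sqrt (x\<^sup>2)" by (rule real_sqrt_le_mono)
    then have "sqrt x \<le> x" using x by simp
    then have "x * sqrt x \<le> x\<^sup>2" using x by (simp add: power2_eq_square)
    then have "1 / x\<^sup>2 \<le> 1 / (x * sqrt x)" using x by (intro divide_left_mono) auto
    then show ?thesis by linarith
  qed
  define E where "E = exp x / (exp x - 1)\<^sup>2"
  have e: "exp x - 1 > 0" using x by simp
  have E0: "E \<ge> 0" by (simp add: E_def)
  have E1: "E \<le> 1 / x\<^sup>2"
  proof -
    have s: "exp (x / 2) - exp (- x / 2) \<ge> x"
    proof -
      let ?F = "\<lambda>x. exp (x / 2) - exp (- x / 2) - x"
      have "?F 0 \<le> ?F x"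
      proof (rule DERIV_nonneg_imp_nondecreasing[where f = ?F])
        fix u :: real assume "0 \<le> u"
        have "((\<lambda>x. exp (x / 2) - exp (- x / 2) - x) has_real_derivative (exp (u / 2) / 2 + exp (- u / 2) / 2 - 1)) (at u)"
          by (auto intro!: derivative_eq_intros)
        moreover have "exp (u / 2) / 2 + exp (- u / 2) / 2 - 1 \<ge> 0"
          using exp_ge_add_one_self[of "u / 2"] exp_ge_add_one_self[of "- u / 2"] by linarith
        ultimately show "\<exists>y. ((\<lambda>x. exp (x / 2) - exp (- x / 2) - x) has_real_derivative y) (at u) \<and> 0 \<le> y" by blast
      qed (use x in auto)
      then show ?thesis by simp
    qed
    have "exp x - 1 = exp (x / 2) * (exp (x / 2) - exp (- x / 2))"
      by (simp add: algebra_simps flip: exp_add)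
    then have "(exp x - 1)\<^sup>2 = exp x * (exp (x / 2) - exp (- x / 2))\<^sup>2"
      by (simp add: power_mult_distrib flip: exp_double)
    moreover have "(exp (x / 2) - exp (- x / 2))\<^sup>2 \<ge> x\<^sup>2"
      using s x by (intro power_mono) auto
    ultimately have "(exp x - 1)\<^sup>2 \<ge> exp x * x\<^sup>2" by simp
    then show ?thesis unfolding E_def using x e by (simp add: divide_simps mult_ac)
  qed
  have E2: "E \<ge> 1 / x\<^sup>2 - 1 / x"
  proof -
    have a: "1 - exp (- x) \<le> x" using exp_ge_add_one_self[of "- x"] by simp
    have "exp x - 1 = exp x * (1 - exp (- x))" by (simp add: algebra_simps flip: exp_add)
    then have "(exp x - 1)\<^sup>2 = (exp x)\<^sup>2 * (1 - exp (- x))\<^sup>2" by (simp add: power_mult_distrib)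
    also have "\<dots> \<le> (exp x)\<^sup>2 * x\<^sup>2" using a x by (intro mult_left_mono power_mono) auto
    finally have "exp x / ((exp x)\<^sup>2 * x\<^sup>2) \<le> E"
      unfolding E_def using x e by (intro divide_left_mono) auto
    moreover have "exp x / ((exp x)\<^sup>2 * x\<^sup>2) = exp (- x) / x\<^sup>2"
      by (simp add: exp_minus power2_eq_square field_simps)
    moreover have "exp (- x) / x\<^sup>2 \<ge> (1 - x) / x\<^sup>2"
      using exp_ge_add_one_self[of "- x"] by (intro divide_right_mono) auto
    moreover have "(1 - x) / x\<^sup>2 = 1 / x\<^sup>2 - 1 / x" using x by (simp add: field_simps power2_eq_square)
    ultimately show ?thesis by linarith
  qed
  have A: "\<bar>E - 1 / x\<^sup>2\<bar> \<le> 1 / (x * sqrt x)"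
    using E0 E1 E2 m by linarith
  define R where "R = (3 * x\<^sup>2 + 1) / (x ^ 3 + x)\<^sup>2"
  have pos: "x\<^sup>2 + 1 > 0" by (intro add_nonneg_pos) auto
  have R: "1 / x\<^sup>2 - R = (x\<^sup>2 - 1) / (x\<^sup>2 + 1)\<^sup>2"
  proof -
    have "x ^ 3 + x = x * (x\<^sup>2 + 1)" by (simp add: power2_eq_square power3_eq_cube algebra_simps)
    then show ?thesis unfolding R_def using x pos
      by (simp add: power_mult_distrib divide_simps) (simp add: algebra_simps power2_eq_square)
  qed
  have "\<bar>1 / x\<^sup>2 - R\<bar> \<le> 1 / (x\<^sup>2 + 1)"
  proof -
    have "\<bar>x\<^sup>2 - 1\<bar> \<le> x\<^sup>2 + 1" by (simp add: abs_le_iff)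
    then have "\<bar>x\<^sup>2 - 1\<bar> / (x\<^sup>2 + 1)\<^sup>2 \<le> (x\<^sup>2 + 1) / (x\<^sup>2 + 1)\<^sup>2"
      by (intro divide_right_mono) auto
    also have "\<dots> = 1 / (x\<^sup>2 + 1)" using pos by (simp add: power2_eq_square)
    finally show ?thesis unfolding R by simp
  qed
  also have "1 / (x\<^sup>2 + 1) \<le> min (1 / x) (1 / x\<^sup>2)"
  proof -
    have "x \<le> x\<^sup>2 + 1" using sum_squares_bound[of x 1] x by simp
    then have "1 / (x\<^sup>2 + 1) \<le> 1 / x" using x pos by (intro divide_left_mono) auto
    moreover have "1 / (x\<^sup>2 + 1) \<le> 1 / x\<^sup>2" using x pos by (intro divide_left_mono) auto
    ultimately show ?thesis by simp
  qed
  also note m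
  finally have B: "\<bar>1 / x\<^sup>2 - R\<bar> \<le> 1 / (x * sqrt x)" .
  have "log_defect'' x = (E - 1 / x\<^sup>2) + (1 / x\<^sup>2 - R)"
    by (simp add: log_defect''_def E_def R_def)
  moreover have "2 / (x * sqrt x) = 1 / (x * sqrt x) + 1 / (x * sqrt x)" by simp
  ultimately show ?thesis using A B by linarith
qed

text \<open>
  Two mean value theorems on the halves of the interval, and one for \<open>f'\<close> between the intermediate points.
\<close>

lemma second_difference_bound:
  fixes f f' f'' :: "real \<Rightarrow> real"
  assumes h: "h > 0"
    and f: "\<And>x. m - h \<le> x \<Longrightarrow> x \<le> m + h \<Longrightarrow> (f has_real_derivative f' x) (at x)"
    and f': "\<And>x. m - h \<le> x \<Longrightarrow> x \<le> m + h \<Longrightarrow> (f' has_real_derivative f'' x) (at x)"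
    and B: "\<And>x. m - h \<le> x \<Longrightarrow> x \<le> m + h \<Longrightarrow> \<bar>f'' x\<bar> \<le> B"
  shows "\<bar>f m - (f (m - h) + f (m + h)) / 2\<bar> \<le> B * h\<^sup>2"
proof -
  have "\<exists>z>m. z < m + h \<and> f (m + h) - f m = (m + h - m) * f' z"
    by (rule MVT2) (use h f in auto)
  then obtain z1 where z1: "m < z1" "z1 < m + h" "f (m + h) - f m = h * f' z1" by auto
  have "\<exists>z>m - h. z < m \<and> f m - f (m - h) = (m - (m - h)) * f' z"
    by (rule MVT2) (use h f in auto)
  then obtain z2 where z2: "m - h < z2" "z2 < m" "f m - f (m - h) = h * f' z2" by auto
  have "\<exists>z>z2. z < z1 \<and> f' z1 - f' z2 = (z1 - z2) * f'' z"
    by (rule MVT2) (use z1 z2 f' in auto)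
  then obtain w where w: "z2 < w" "w < z1" "f' z1 - f' z2 = (z1 - z2) * f'' w" by auto
  have "f m - (f (m - h) + f (m + h)) / 2 = - (h / 2) * (f' z1 - f' z2)"
    using z1(3) z2(3) by (simp add: field_simps)
  also have "\<dots> = - (h / 2) * ((z1 - z2) * f'' w)"
    unfolding w(3) ..
  finally have "f m - (f (m - h) + f (m + h)) / 2 = - (h / 2) * ((z1 - z2) * f'' w)" .
  then have "\<bar>f m - (f (m - h) + f (m + h)) / 2\<bar> = h / 2 * ((z1 - z2) * \<bar>f'' w\<bar>)"
    using h z1 z2 by (simp add: abs_mult)
  also have "\<dots> \<le> h / 2 * ((2 * h) * B)"
  proof -
    have "\<bar>f'' w\<bar> \<le> B" using w z1 z2 by (intro B) auto
    then show ?thesis using h z1 z2 by (intro mult_left_mono mult_mono) auto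
  qed
  finally show ?thesis by (simp add: power2_eq_square mult_ac)
qed

lemma log_defect_sums:
  assumes t: "t > 0"
  shows "(\<lambda>j. log_defect (real (Suc j) * t)) sums (partition_log_real t - ln (sinh (pi / t) / (pi / t)) / 2)"
  unfolding log_defect_def
  by (intro sums_diff partition_log_real_eq_sum_ln sum_ln_sinh_product t)

text \<open>
  Halving the step size of the trapezoidal sum \<open>T\<close> adds the midpoints. So the change is a sum of second differences
  of \<open>log_defect\<close>, which the bound on the second derivative controls on every interval but the first; there
  \<open>log_defect\<close> itself is small. Comparing \<open>T t\<close> with \<open>T (t / 2)\<close> in place of the integral keeps integrals out of the
  argument.
\<close>

lemma log_defect_trapezoid_sum:
  assumes t: "0 < t" "t \<le> 1"
  defines "T \<equiv> \<lambda>t. t * (\<Sum>j. log_defect (real (Suc j) * t))"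
  shows "\<bar>T (t / 2) - T t\<bar> \<le> t * sqrt t * (1 + (\<Sum>j. 1 / (real (Suc j) * sqrt (real (Suc j)))))"
proof -
  define g where "g j = 1 / (real (Suc j) * sqrt (real (Suc j)))" for j
  have g0: "g j \<ge> 0" for j by (simp add: g_def)
  have g: "summable g"
  proof -
    have "summable (\<lambda>j. real j powr (- 3 / 2))" by (subst summable_real_powr_iff) simp
    then have "summable (\<lambda>j. real (Suc j) powr (- 3 / 2))" by (subst summable_Suc_iff)
    moreover have "real (Suc j) powr (- 3 / 2) = g j" for j
    proof -
      have "real (Suc j) powr (- 3 / 2) = 1 / real (Suc j) powr (1 + 1 / 2)"
        by (simp only: powr_minus_divide[symmetric]) simp
      also have "real (Suc j) powr (1 + 1 / 2) = real (Suc j) * sqrt (real (Suc j))"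
        by (subst powr_add) (simp add: powr_half_sqrt)
      finally show ?thesis by (simp add: g_def)
    qed
    ultimately show ?thesis by simp
  qed
  let ?f = "\<lambda>j. log_defect (real j * t)"
  let ?m = "\<lambda>j. log_defect ((real j + 1 / 2) * t)"
  let ?S = "\<Sum>j. ?f (Suc j)" and ?S' = "\<Sum>j. log_defect (real (Suc j) * (t / 2))"
  have s1: "(\<lambda>j. ?f (Suc j)) sums ?S"
    using summable_sums[OF sums_summable[OF log_defect_sums[OF t(1)]]] .
  then have s0: "?f sums ?S"
    by (subst (asm) sums_Suc_iff) simp
  have t2: "t / 2 > 0" using t by simp
  have h: "(\<lambda>j. log_defect (real (Suc j) * (t / 2))) sums ?S'"
    using summable_sums[OF sums_summable[OF log_defect_sums[OF t2]]] .
  \<comment> \<open>odd multiples of \<open>t / 2\<close> are the midpoints, even ones the old nodes\<close>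
  from sums_group[OF this, of 2]
  have "(\<lambda>n. \<Sum>j = n * 2..<n * 2 + 2. log_defect (real (Suc j) * (t / 2))) sums ?S'"
    by simp
  moreover have "(\<Sum>j = n * 2..<n * 2 + 2. log_defect (real (Suc j) * (t / 2))) = ?m n + ?f (Suc n)" for n
  proof -
    have "{n * 2..<n * 2 + 2} = {2 * n, Suc (2 * n)}" by auto
    then have "(\<Sum>j = n * 2..<n * 2 + 2. log_defect (real (Suc j) * (t / 2)))
        = log_defect (real (Suc (2 * n)) * (t / 2)) + log_defect (real (Suc (Suc (2 * n))) * (t / 2))" by simp
    also have "real (Suc (2 * n)) * (t / 2) = (real n + 1 / 2) * t" by (simp add: field_simps)
    also have "real (Suc (Suc (2 * n))) * (t / 2) = real (Suc n) * t" by (simp add: field_simps)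
    finally show ?thesis .
  qed
  ultimately have "(\<lambda>n. ?m n + ?f (Suc n)) sums ?S'"
    by simp
  then have "(\<lambda>n. (?m n + ?f (Suc n)) - (?f n + ?f (Suc n)) / 2 - ?f (Suc n)) sums
      (?S' - (?S + ?S) / 2 - ?S)"
    by (intro sums_diff sums_divide sums_add s0 s1)
  then have D: "(\<lambda>n. ?m n - (?f n + ?f (Suc n)) / 2) sums
      (?S' - 2 * ?S)"
    by (simp add: algebra_simps)
  have b: "\<bar>?m (Suc n) - (?f (Suc n) + ?f (Suc (Suc n))) / 2\<bar> \<le> sqrt t * g n" for n
  proof -
    define x where "x = real (Suc n) * t"
    have x: "x > 0" using t by (simp add: x_def)
    have "\<bar>log_defect (x + t / 2) - (log_defect (x + t / 2 - t / 2) + log_defect (x + t / 2 + t / 2)) / 2\<bar>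
        \<le> (2 / (x * sqrt x)) * (t / 2)\<^sup>2"
    proof (rule second_difference_bound)
      fix y assume y: "x + t / 2 - t / 2 \<le> y"
      then have y0: "y > 0" "x \<le> y" using x by auto
      show "(log_defect has_real_derivative log_defect' y) (at y)" "(log_defect' has_real_derivative log_defect'' y) (at y)"
        by (rule log_defect_deriv[OF y0(1)])+
      have "\<bar>log_defect'' y\<bar> \<le> 2 / (y * sqrt y)" by (rule log_defect''_bound[OF y0(1)])
      also have "\<dots> \<le> 2 / (x * sqrt x)" using x y0 by (intro divide_left_mono mult_mono) auto
      finally show "\<bar>log_defect'' y\<bar> \<le> 2 / (x * sqrt x)" .
    qed (use t in auto)
    also have "(2 / (x * sqrt x)) * (t / 2)\<^sup>2 = sqrt t / 2 * g n"
    proof -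
      have X: "x * sqrt x = (real (Suc n) * sqrt (real (Suc n))) * (t * sqrt t)"
        unfolding x_def by (simp only: real_sqrt_mult mult_ac)
      have "2 / (G * (u * s)) * (u / 2)\<^sup>2 = s / 2 * (1 / G)" if "s > 0" "G > 0" "u = s * s" for s G u :: real
        using that(1,2) unfolding that(3) by (simp add: power2_eq_square)
      from this[of "sqrt t" "real (Suc n) * sqrt (real (Suc n))" t] t show ?thesis
        unfolding X g_def by (simp del: of_nat_Suc)
    qed
    also have "\<dots> \<le> sqrt t * g n" using t g0[of n] by simp
    finally show ?thesis
      by (simp add: x_def algebra_simps)
  qed
  have b0: "\<bar>?m 0 - (?f 0 + ?f (Suc 0)) / 2\<bar> \<le> sqrt t"
  proof -
    have "\<bar>log_defect (t / 2)\<bar> \<le> t / 2" "\<bar>log_defect t\<bar> \<le> t"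
      using log_defect_near_0[of "t / 2"] log_defect_near_0[of t] t by simp_all
    then have "\<bar>log_defect (t / 2) - log_defect t / 2\<bar> \<le> t" by linarith
    also have "t \<le> sqrt t" using t by (simp add: real_le_rsqrt power2_eq_square mult_left_le)
    finally show ?thesis by simp
  qed
  let ?d = "\<lambda>n. ?m n - (?f n + ?f (Suc n)) / 2"
  have "\<bar>?S' - 2 * ?S\<bar> \<le> sqrt t * (1 + suminf g)"
  proof -
    have "(\<lambda>n. ?d (Suc n)) sums (?S' - 2 * ?S - ?d 0)"
      using D by (subst sums_Suc_iff) simp
    then have "?S' - 2 * ?S - ?d 0 = (\<Sum>n. ?d (Suc n))"
      by (rule sums_unique)
    moreover have "norm (\<Sum>n. ?d (Suc n)) \<le> (\<Sum>n. sqrt t * g n)"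
      by (rule norm_suminf_le) (use b summable_mult[OF g] in auto)
    then have "\<bar>\<Sum>n. ?d (Suc n)\<bar> \<le> sqrt t * suminf g"
      by (simp add: suminf_mult[OF g])
    ultimately have "\<bar>?S' - 2 * ?S\<bar> \<le> sqrt t + sqrt t * suminf g"
      using b0 by linarith
    then show ?thesis by (simp add: distrib_left)
  qed
  then have "t / 2 * \<bar>?S' - 2 * ?S\<bar> \<le> t / 2 * (sqrt t * (1 + suminf g))"
    using t by (intro mult_left_mono) auto
  moreover have "\<bar>T (t / 2) - T t\<bar> = t / 2 * \<bar>?S' - 2 * ?S\<bar>"
  proof -
    have eq: "T (t / 2) - T t = t / 2 * (?S' - 2 * ?S)"
      unfolding T_def by (simp add: right_diff_distrib del: of_nat_Suc times_divide_eq_right)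
    show ?thesis unfolding eq abs_mult using t by simp
  qed
  moreover have "t / 2 * (sqrt t * (1 + suminf g)) \<le> t * sqrt t * (1 + suminf g)"
    using t suminf_nonneg[OF g g0] by (simp add: mult_ac)
  ultimately show ?thesis unfolding g_def by linarith
qed

text \<open>
  Termwise, \<open>t / (k * (exp (k * t) - 1))\<close> increases to \<open>1 / k\<^sup>2\<close> as \<open>t\<close> decreases to \<open>0\<close>.
\<close>

lemma partition_log_real_leading:
  "((\<lambda>t. t * partition_log_real t) \<longlongrightarrow> pi\<^sup>2 / 6) (at_right 0)"
proof -
  let ?a = "\<lambda>m t :: real. t * (exp (- t) ^ Suc m / (of_nat (Suc m) * (1 - exp (- t) ^ Suc m)))"
  have "((\<lambda>t. \<Sum>m. ?a m t) \<longlongrightarrow> (\<Sum>m. 1 / (real m + 1)\<^sup>2)) (at_right 0)"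
  proof (rule tannerys_theorem[THEN conjunct2, THEN conjunct2])
    fix m
    define k where "k = real (Suc m)"
    have k: "k > 0" by (simp add: k_def)
    have "((\<lambda>t. t * (exp (- k * t) / (k * (1 - exp (- k * t))))) \<longlongrightarrow> inverse k * inverse k) (at_right 0)"
      using k by real_asymp
    moreover have "exp (- t) ^ Suc m = exp (- k * t)" for t :: real
      unfolding k_def by (simp only: exp_of_nat_mult[symmetric] mult_minus_right mult_minus_left)
    ultimately show "((\<lambda>t. ?a m t) \<longlongrightarrow> 1 / (real m + 1)\<^sup>2) (at_right 0)"
      by (simp add: k_def add.commute power2_eq_square inverse_eq_divide)
  next
    have "norm (?a m t) \<le> 1 / (real m + 1)\<^sup>2" if t: "t > 0" for m and t :: real
    proof -
      define k where "k = real (Suc m)"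
      have k: "k > 0" by (simp add: k_def)
      define E where "E = exp (k * t)"
      have E: "E - 1 \<ge> k * t" "k * t > 0" using exp_ge_add_one_self[of "k * t"] k t unfolding E_def by (linarith, simp)
      have E1: "E - 1 > 0" using E by linarith
      have "exp (- t) ^ Suc m = 1 / E"
        unfolding E_def k_def exp_of_nat_mult by (simp add: exp_minus inverse_eq_divide power_one_over del: power_Suc)
      then have "?a m t = t * ((1 / E) / (k * (1 - 1 / E)))" by (simp add: k_def)
      also have "\<dots> = t / (k * (E - 1))" using E1 k by (simp add: field_simps)
      finally have "norm (?a m t) = t / (k * (E - 1))" using t k E1 by (simp add: abs_mult)
      also have "\<dots> \<le> t / (k * (k * t))" using t k E E1 by (intro divide_left_mono mult_left_mono mult_pos_pos) auto
      also have "\<dots> = 1 / (real m + 1)\<^sup>2" using t by (simp add: k_def power2_eq_square add.commute)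
      finally show ?thesis .
    qed
    then have "eventually (\<lambda>t :: real. \<forall>m. norm (?a m t) \<le> 1 / (real m + 1)\<^sup>2) (at_right 0)"
      by (intro eventually_mono[OF eventually_at_right_less]) blast
    then have "eventually (\<lambda>p :: nat \<times> real. \<forall>m. norm (?a m (snd p)) \<le> 1 / (real m + 1)\<^sup>2) (sequentially \<times>\<^sub>F at_right 0)"
      by (rule eventually_compose_filterlim[OF _ filterlim_snd])
    then show "\<forall>\<^sub>F (m, t) in sequentially \<times>\<^sub>F at_right 0. norm (?a m t) \<le> 1 / (real m + 1)\<^sup>2"
      by (rule eventually_mono) auto
    show "summable (\<lambda>m. 1 / (real m + 1)\<^sup>2)"
      using inverse_squares_sums by (simp add: sums_iff add_ac)
  qed simp
  also have "(\<Sum>m. 1 / (real m + 1)\<^sup>2) = pi\<^sup>2 / 6"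
    using inverse_squares_sums by (simp add: sums_iff add_ac)
  finally show ?thesis
  proof (rule Lim_transform_eventually)
    have "(\<Sum>m. ?a m t) = t * partition_log_real t" if "t > 0" for t
      unfolding partition_log_real_def
      by (rule suminf_mult[OF sums_summable[OF partition_log_real_sums[OF that]]])
    then show "\<forall>\<^sub>F t in at_right 0. (\<Sum>m. ?a m t) = t * partition_log_real t"
      unfolding eventually_at_filter by (intro always_eventually allI impI) auto
  qed
qed

text \<open>
  The trapezoidal sums \<open>T t\<close> of \<open>log_defect\<close> approach their limit \<open>c\<close> at speed \<open>t * sqrt t\<close>, because halving the
  step changes them by that amount and the changes form a geometric series. The limit itself is known from the leading
  order of both sums, so \<open>T t / t = c / t + o(1)\<close>. The terms \<open>ln (t / (2 * \<pi>)) / 2\<close> and \<open>\<pi> / (2 * t)\<close> come from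
  \<open>sinh\<close>.
\<close>

theorem partition_log_real_asymptotics:
  "((\<lambda>t. partition_log_real t - pi\<^sup>2 / 6 / t - ln (t / (2 * pi)) / 2) \<longlongrightarrow> 0) (at_right 0)"
proof -
  define U where "U t = ln (sinh (pi / t) / (pi / t)) / 2" for t
  define T where "T t = t * (\<Sum>j. log_defect (real (Suc j) * t))" for t
  define c where "c = pi\<^sup>2 / 6 - pi / 2"
  define K where "K = 1 + (\<Sum>j. 1 / (real (Suc j) * sqrt (real (Suc j))))"
  have T: "T t = t * (partition_log_real t - U t)" if "t > 0" for t
    using log_defect_sums[OF that] by (simp add: T_def U_def sums_iff)
  have U': "U t = ln ((exp (pi / t) - exp (- (pi / t))) / 2 / (pi / t)) / 2" for t
    by (simp add: U_def sinh_def)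
  have "((\<lambda>t. t * U t) \<longlongrightarrow> pi / 2) (at_right 0)"
    unfolding U' by real_asymp
  then have "((\<lambda>t. t * partition_log_real t - t * U t) \<longlongrightarrow> c) (at_right 0)"
    unfolding c_def by (intro tendsto_diff partition_log_real_leading)
  then have Tlim: "(T \<longlongrightarrow> c) (at_right 0)"
    by (rule Lim_transform_eventually) (auto simp: eventually_at_filter T algebra_simps)
  have step: "\<bar>T (t / 2) - T t\<bar> \<le> t * sqrt t * K" if "0 < t" "t \<le> 1" for t
    using log_defect_trapezoid_sum[OF that] by (simp add: T_def K_def)
  have K: "K \<ge> 0"
    using step[of 1] abs_ge_zero[of "T (1 / 2) - T 1"] by simp
  have "\<bar>T t - c\<bar> \<le> 2 * K * (t * sqrt t)" if t: "0 < t" "t \<le> 1" for t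
  proof -
    have "\<bar>T (t / 2 ^ n) - T t\<bar> \<le> 2 * K * (t * sqrt t) * (1 - 1 / 2 ^ n)" for n
    proof (induction n)
      case (Suc n)
      define s where "s = t / 2 ^ n"
      have "t / 2 ^ n \<le> t / 1" using t by (intro divide_left_mono) auto
      then have s: "0 < s" "s \<le> t / 2 ^ n" "s \<le> t" using t by (auto simp: s_def)
      have "\<bar>T (s / 2) - T s\<bar> \<le> s * sqrt s * K" using s t by (intro step) auto
      also have "\<dots> \<le> t / 2 ^ n * sqrt t * K" using s K t by (intro mult_right_mono mult_mono) auto
      also have "\<dots> = 2 * K * (t * sqrt t) * (1 / 2 ^ n - 1 / 2 ^ Suc n)"
        by simp
      finally have "\<bar>T (t / 2 ^ Suc n) - T s\<bar> \<le> 2 * K * (t * sqrt t) * (1 / 2 ^ n - 1 / 2 ^ Suc n)"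
        by (simp add: s_def mult.commute)
      then have "\<bar>T (t / 2 ^ Suc n) - T s\<bar> + \<bar>T s - T t\<bar>
          \<le> 2 * K * (t * sqrt t) * (1 / 2 ^ n - 1 / 2 ^ Suc n) + 2 * K * (t * sqrt t) * (1 - 1 / 2 ^ n)"
        using Suc.IH unfolding s_def by (rule add_mono)
      also have "\<dots> = 2 * K * (t * sqrt t) * (1 - 1 / 2 ^ Suc n)"
        by (simp only: distrib_left[symmetric]) simp
      finally show ?case by linarith
    qed simp
    moreover have "2 * K * (t * sqrt t) * (1 - 1 / 2 ^ n) \<le> 2 * K * (t * sqrt t)" for n :: nat
      using K t by (intro mult_left_le) auto
    ultimately have "\<bar>T (t / 2 ^ n) - T t\<bar> \<le> 2 * K * (t * sqrt t)" for n
      by (meson order_trans)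
    moreover have "(\<lambda>n. \<bar>T (t / 2 ^ n) - T t\<bar>) \<longlonglongrightarrow> \<bar>c - T t\<bar>"
    proof (intro tendsto_rabs tendsto_diff tendsto_const)
      have "filterlim (\<lambda>n. t / 2 ^ n) (at_right 0) sequentially"
        using t by real_asymp
      then show "(\<lambda>n. T (t / 2 ^ n)) \<longlonglongrightarrow> c"
        by (rule filterlim_compose[OF Tlim])
    qed
    ultimately have "\<bar>c - T t\<bar> \<le> 2 * K * (t * sqrt t)"
      by (intro LIMSEQ_le_const2) auto
    then show ?thesis by (simp add: abs_minus_commute)
  qed
  then have TK: "\<bar>T t / t - c / t\<bar> \<le> 2 * K * sqrt t" if "0 < t" "t \<le> 1" for t
  proof -
    have "\<bar>T t - c\<bar> / t \<le> 2 * K * (t * sqrt t) / t"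
      using \<open>\<And>t. 0 < t \<Longrightarrow> t \<le> 1 \<Longrightarrow> \<bar>T t - c\<bar> \<le> 2 * K * (t * sqrt t)\<close>[OF that] that
      by (intro divide_right_mono) auto
    then show ?thesis using that by (simp flip: diff_divide_distrib)
  qed
  have "((\<lambda>t. T t / t - c / t) \<longlongrightarrow> 0) (at_right 0)"
  proof (rule Lim_null_comparison)
    have "eventually (\<lambda>t :: real. t \<in> {0<..<1}) (at_right 0)"
      by (rule eventually_at_right_real) simp
    then show "\<forall>\<^sub>F t in at_right 0. norm (T t / t - c / t) \<le> 2 * K * sqrt t"
      by eventually_elim (use TK in auto)
    show "((\<lambda>t. 2 * K * sqrt t) \<longlongrightarrow> 0) (at_right 0)" by real_asymp
  qed
  moreover have "((\<lambda>t. U t - pi / 2 / t - ln (t / (2 * pi)) / 2) \<longlongrightarrow> 0) (at_right 0)"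
    unfolding U' by real_asymp
  ultimately have "((\<lambda>t. (T t / t - c / t) + (U t - pi / 2 / t - ln (t / (2 * pi)) / 2)) \<longlongrightarrow> 0 + 0) (at_right 0)"
    by (rule tendsto_add)
  then have "((\<lambda>t. (T t / t - c / t) + (U t - pi / 2 / t - ln (t / (2 * pi)) / 2)) \<longlongrightarrow> 0) (at_right 0)"
    by simp
  then show ?thesis
    by (rule Lim_transform_eventually)
      (auto simp: eventually_at_filter T c_def diff_divide_distrib)
qed

section \<open>The partition product in a sector\<close>

text \<open>
  What remains of \<open>1 / (exp z - 1)\<close> when its pole at \<open>0\<close> is removed. Substituting it termwise into the Lambert series
  takes away exactly \<open>\<pi>\<^sup>2 / (6 * z)\<close>.
\<close>

definition polar_part_defect :: "complex \<Rightarrow> complex" where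
  "polar_part_defect z = 1 / (exp z - 1) - 1 / z"

lemma exp_minus_1_lower:
  assumes "Re z > 0"
  shows "norm (exp z - 1) \<ge> Re z" "exp z - 1 \<noteq> 0"
proof -
  have "Re z \<le> exp (Re z) - 1" using exp_ge_add_one_self[of "Re z"] by linarith
  also have "\<dots> \<le> norm (exp z - 1)"
    using norm_triangle_ineq2[of "exp z" 1] by simp
  finally show "norm (exp z - 1) \<ge> Re z" .
  then show "exp z - 1 \<noteq> 0" using assms by auto
qed

lemma powr_quarter_bounds:
  fixes x :: real
  assumes x: "x > 0"
  shows "x \<le> 1 / 4 \<Longrightarrow> 4 \<le> 12 * x powr (- 1 / 4)" "1 / 4 \<le> x \<Longrightarrow> 3 / x \<le> 12 * x powr (- 1 / 4)"
proof -
  show "4 \<le> 12 * x powr (- 1 / 4)" if "x \<le> 1 / 4"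
  proof -
    have "1 \<le> x powr (- 1 / 4)"
      using that x powr_mono2'[of "- 1 / 4" x 1] by simp
    then show ?thesis by simp
  qed
  show "3 / x \<le> 12 * x powr (- 1 / 4)" if "1 / 4 \<le> x"
  proof -
    have "x powr (- 3 / 4) \<le> (1 / 4) powr (- 3 / 4)"
      using that by (intro powr_mono2') auto
    also have "\<dots> \<le> (1 / 4) powr (- 1)"
      by (intro powr_mono') auto
    also have "\<dots> = 4" by (simp add: powr_minus)
    finally have "x powr (- 3 / 4) \<le> 4" .
    moreover have "1 / x = x powr (- 3 / 4) * x powr (- 1 / 4)"
      using x by (simp add: powr_minus powr_add[symmetric] field_simps)
    ultimately have "1 / x \<le> 4 * x powr (- 1 / 4)"
      by (simp add: mult_right_mono)
    then show ?thesis by simp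
  qed
qed

text \<open>
  The function is bounded near \<open>0\<close> and \<open>O(1 / norm z)\<close> for large \<open>z\<close> in the sector. The exponent \<open>-1/4\<close>
  interpolates: any exponent strictly between \<open>-1/2\<close> and \<open>0\<close> would serve, as the derivative then gets an exponent
  strictly between \<open>-3/2\<close> and \<open>-1\<close>, which is summable and still loses against deviations of size
  \<open>t powr (3 / 2)\<close>.
\<close>

lemma polar_part_defect_bound:
  assumes z: "Re z > 0" "\<bar>Im z\<bar> \<le> Re z"
  shows "norm (polar_part_defect z) \<le> 12 * norm z powr (- 1 / 4)"
proof -
  have z0: "z \<noteq> 0" using z by auto
  then have nz: "norm z > 0" by simp
  show ?thesis
  proof (cases "norm z \<le> 1 / 4")
    case True
    have T: "norm (exp z - 1 - z) \<le> 2 * norm z ^ 2"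
    proof -
      have "norm (exp z - (\<Sum>k\<le>1. z ^ k / fact k)) \<le> exp \<bar>Re z\<bar> * norm z ^ Suc 1 / fact 1"
        by (rule Taylor_exp)
      moreover have "exp \<bar>Re z\<bar> \<le> 2"
      proof -
        have "\<bar>Re z\<bar> \<le> 1 / 2" using abs_Re_le_cmod[of z] True by linarith
        then show ?thesis using exp_bound_half[of "\<bar>Re z\<bar>"] by simp
      qed
      ultimately have "norm (exp z - (1 + z)) \<le> exp \<bar>Re z\<bar> * norm z ^ 2" by (simp add: power2_eq_square)
      also have "\<dots> \<le> 2 * norm z ^ 2" using \<open>exp \<bar>Re z\<bar> \<le> 2\<close> by (intro mult_right_mono) auto
      finally show ?thesis by (simp add: diff_diff_eq)
    qed
    have sq: "2 * norm z ^ 2 \<le> norm z / 2"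
    proof -
      have "norm z * norm z \<le> 1 / 4 * norm z" using True by (intro mult_right_mono) auto
      then show ?thesis by (simp add: power2_eq_square)
    qed
    have "norm z - norm (exp z - 1 - z) \<le> norm (exp z - 1)"
      using norm_triangle_ineq2[of z "z - (exp z - 1)"] by (simp add: norm_minus_commute)
    then have E: "norm z / 2 \<le> norm (exp z - 1)" using T sq by linarith
    have "polar_part_defect z = - (exp z - 1 - z) / (z * (exp z - 1))"
      using z0 exp_minus_1_lower(2)[OF z(1)] by (simp add: polar_part_defect_def divide_simps)
    then have "norm (polar_part_defect z) = norm (exp z - 1 - z) / (norm z * norm (exp z - 1))"
      by (simp add: norm_divide norm_mult norm_minus_commute)
    also have "\<dots> \<le> (2 * norm z ^ 2) / (norm z * (norm z / 2))"
      using T E nz by (intro frac_le mult_left_mono mult_pos_pos) auto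
    also have "\<dots> = 4" using nz by (simp add: power2_eq_square)
    also have "\<dots> \<le> 12 * norm z powr (- 1 / 4)" by (rule powr_quarter_bounds(1)[OF nz True])
    finally show ?thesis .
  next
    case False
    have "norm z \<le> 2 * Re z" using cmod_le[of z] z by linarith
    then have "norm z / 2 \<le> norm (exp z - 1)" using exp_minus_1_lower(1)[OF z(1)] by linarith
    then have "1 / norm (exp z - 1) \<le> 1 / (norm z / 2)"
      using nz exp_minus_1_lower(2)[OF z(1)] by (intro divide_left_mono) auto
    moreover have "norm (polar_part_defect z) \<le> 1 / norm (exp z - 1) + 1 / norm z"
      unfolding polar_part_defect_def using norm_triangle_ineq4[of "1 / (exp z - 1)" "1 / z"]
      by (simp add: norm_divide)
    ultimately have "norm (polar_part_defect z) \<le> 3 / norm z" by simp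
    also have "\<dots> \<le> 12 * norm z powr (- 1 / 4)"
      by (rule powr_quarter_bounds(2)[OF nz]) (use False in simp)
    finally show ?thesis .
  qed
qed

text \<open>
  Cauchy's estimate on a disc of radius proportional to \<open>Re z\<close>, which stays in the wider sector of the
  preceding bound.
\<close>

lemma polar_part_defect_deriv_bound:
  assumes z: "Re z > 0" "\<bar>Im z\<bar> \<le> Re z / 2"
  shows "norm (deriv polar_part_defect z) \<le> 100 * Re z powr (- 5 / 4)"
    "(polar_part_defect has_field_derivative deriv polar_part_defect z) (at z)"
proof -
  have hol: "polar_part_defect holomorphic_on {z. Re z > 0}"
    unfolding polar_part_defect_def using exp_minus_1_lower(2) by (intro holomorphic_intros) auto
  have op: "open {z. Re z > 0}" by (rule open_halfspace_Re_gt)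
  show "(polar_part_defect has_field_derivative deriv polar_part_defect z) (at z)"
    using holomorphic_derivI[OF hol op, of z] z by simp
  define R where "R = Re z / 4"
  have R: "R > 0" using z by (simp add: R_def)
  have cb: "Re w \<ge> 3 * R \<and> \<bar>Im w\<bar> \<le> Re w" if "w \<in> cball z R" for w
  proof -
    have "\<bar>Re (w - z)\<bar> \<le> R" "\<bar>Im (w - z)\<bar> \<le> R"
      using that abs_Re_le_cmod[of "w - z"] abs_Im_le_cmod[of "w - z"] by (auto simp: dist_norm norm_minus_commute)
    then have "Re z - R \<le> Re w" "Im w \<le> Im z + R" "Im z - R \<le> Im w"
      by (auto simp: abs_le_iff)
    then show ?thesis using z unfolding R_def abs_le_iff by linarith
  qed
  have sub: "cball z R \<subseteq> {z. Re z > 0}" using cb R by force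
  define B where "B = 13 * (3 * R) powr (- 1 / 4)"
  have "norm ((deriv ^^ 1) polar_part_defect z) \<le> fact 1 * B / R ^ 1"
  proof (rule Cauchy_higher_deriv_bound[where y = 0])
    show "polar_part_defect holomorphic_on ball z R"
      using hol sub by (meson ball_subset_cball holomorphic_on_subset order_trans)
    show "continuous_on (cball z R) polar_part_defect"
      using hol sub by (meson holomorphic_on_imp_continuous_on holomorphic_on_subset)
    fix w assume "w \<in> ball z R"
    then have w: "Re w \<ge> 3 * R" "\<bar>Im w\<bar> \<le> Re w" using cb[of w] by auto
    have "norm (polar_part_defect w) \<le> 12 * norm w powr (- 1 / 4)"
      by (rule polar_part_defect_bound) (use w R in auto)
    also have "norm w powr (- 1 / 4) \<le> (3 * R) powr (- 1 / 4)"
      using w R complex_Re_le_cmod[of w] by (intro powr_mono2') auto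
    also have "12 * (3 * R) powr (- 1 / 4) < B"
      unfolding B_def using R by simp
    finally show "polar_part_defect w \<in> ball 0 B" by simp
  qed (use R in auto)
  then have "norm (deriv polar_part_defect z) \<le> 52 * ((3 * R) powr (- 1 / 4) / Re z)"
    by (simp add: B_def R_def)
  also have "(3 * R) powr (- 1 / 4) / Re z \<le> (Re z / 2) powr (- 1 / 4) / Re z"
    using z by (intro divide_right_mono powr_mono2') (auto simp: R_def)
  also have "(Re z / 2) powr (- 1 / 4) / Re z = (1 / 2) powr (- 1 / 4) * Re z powr (- 5 / 4)"
  proof -
    have "(Re z / 2) powr (- 1 / 4) = (1 / 2) powr (- 1 / 4) * Re z powr (- 1 / 4)"
      using z powr_mult[of "1 / 2" "Re z" "- 1 / 4"] by simp
    moreover have "Re z powr (- 1 / 4) / Re z = Re z powr (- 5 / 4)"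
    proof -
      have "Re z powr (- 5 / 4) * Re z powr 1 = Re z powr (- 1 / 4)"
        by (simp only: powr_add[symmetric]) simp
      then show ?thesis using z by (simp add: field_simps)
    qed
    ultimately show ?thesis by (simp only: times_divide_eq_right[symmetric])
  qed
  also have "52 * ((1 / 2) powr (- 1 / 4) * Re z powr (- 5 / 4)) \<le> 100 * Re z powr (- 5 / 4)"
  proof -
    have "(1 / 2) powr (- 1 / 4) \<le> ((16 / 27) ^ 4) powr (- 1 / 4 :: real)"
      by (intro powr_mono2') (auto simp: power_divide)
    also have "\<dots> = (16 / 27) powr (4 * (- 1 / 4) :: real)"
      by (simp only: powr_powr[symmetric] powr_numeral)
    also have "\<dots> = 27 / 16" by (simp add: powr_minus)
    finally have "52 * (1 / 2) powr (- 1 / 4 :: real) \<le> 100" by simp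
    then have "52 * (1 / 2) powr (- 1 / 4) * Re z powr (- 5 / 4) \<le> 100 * Re z powr (- 5 / 4)"
      by (rule mult_right_mono) simp
    then show ?thesis by simp
  qed
  finally show "norm (deriv polar_part_defect z) \<le> 100 * Re z powr (- 5 / 4)" by simp
qed

definition partition_log_defect :: "complex \<Rightarrow> complex" where
  "partition_log_defect z = partition_log (exp (- z)) - of_real (pi\<^sup>2 / 6) / z"

lemma partition_log_defect_sums:
  assumes z: "Re z > 0"
  shows "(\<lambda>m. polar_part_defect (of_nat (Suc m) * z) / of_nat (Suc m)) sums partition_log_defect z"
proof -
  have z0: "z \<noteq> 0" using z by auto
  have n: "norm (exp (- z)) < 1" using z by simp
  let ?a = "\<lambda>m. exp (- z) ^ Suc m / (of_nat (Suc m) * (1 - exp (- z) ^ Suc m))"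
  let ?b = "\<lambda>m. complex_of_real (1 / (real m + 1)\<^sup>2)" and ?h = "\<lambda>m. polar_part_defect (of_nat (Suc m) * z) / of_nat (Suc m)"
  have "(\<lambda>m. ?b m) sums of_real (pi\<^sup>2 / 6)"
    using inverse_squares_sums by (intro sums_of_real) (simp add: add_ac)
  then have "(\<lambda>m. ?b m / z) sums (of_real (pi\<^sup>2 / 6) / z)"
    by (rule sums_divide)
  moreover have "(\<lambda>m. ?a m) sums partition_log (exp (- z))"
    unfolding partition_log_def
    by (rule summable_sums[OF summable_norm_cancel[OF partition_log_summable[OF n]]])
  ultimately have "(\<lambda>m. ?a m - ?b m / z)
      sums partition_log_defect z"
    unfolding partition_log_defect_def by (intro sums_diff)
  also have "(\<lambda>m. ?a m - ?b m / z)
    = (\<lambda>m. ?h m)"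
  proof
    fix m
    define k where "k = complex_of_nat (Suc m)"
    have k0: "k \<noteq> 0" unfolding k_def by (simp del: of_nat_Suc)
    define E where "E = exp (k * z)"
    have "Re (k * z) > 0" using z by (simp add: k_def)
    then have E: "E - 1 \<noteq> 0" "E \<noteq> 0" using exp_minus_1_lower(2) by (auto simp: E_def)
    have "exp (- z) ^ Suc m = 1 / E"
      unfolding E_def k_def exp_of_nat_mult by (simp add: exp_minus inverse_eq_divide power_one_over del: power_Suc)
    then have "exp (- z) ^ Suc m / (k * (1 - exp (- z) ^ Suc m)) = 1 / (k * (E - 1))"
      by (simp only:) (use E k0 in \<open>simp add: field_simps\<close>)
    moreover have "?b m / z = 1 / (k * z) / k"
      unfolding k_def by (simp add: power2_eq_square add.commute)
    ultimately show "?a m - ?b m / z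
      = ?h m"
      unfolding k_def[symmetric] polar_part_defect_def E_def[symmetric] by (simp add: diff_divide_distrib mult.commute)
  qed
  finally show ?thesis .
qed

text \<open>
  The derivative bound for \<open>polar_part_defect\<close> along the vertical segment, applied to each term. For deviations \<open>d\<close> of
  order \<open>t powr (3 / 2)\<close> the bound tends to \<open>0\<close>, so that near the saddle point the real axis determines the
  behaviour.
\<close>

lemma partition_log_defect_lipschitz:
  "\<exists>K\<ge>0. \<forall>t d. t > 0 \<longrightarrow> \<bar>d\<bar> \<le> t / 2 \<longrightarrow>
     norm (partition_log_defect (Complex t d) - partition_log_defect (of_real t)) \<le> K * (\<bar>d\<bar> * t powr (- 5 / 4))"
proof -
  define g where "g m = real (Suc m) powr (- 5 / 4)" for m
  have g: "summable g"
  proof -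
    have "summable (\<lambda>m. real m powr (- 5 / 4))" by (subst summable_real_powr_iff) simp
    then show ?thesis unfolding g_def by (subst summable_Suc_iff)
  qed
  have g0: "g m \<ge> 0" for m by (simp add: g_def)
  show ?thesis
  proof (intro exI[of _ "100 * suminf g"] conjI allI impI)
    show "0 \<le> 100 * suminf g" using suminf_nonneg[OF g g0] by simp
    fix t d :: real assume t: "t > 0" and d: "\<bar>d\<bar> \<le> t / 2"
    define z where "z = Complex t d"
    let ?a = "\<lambda>m. polar_part_defect (of_nat (Suc m) * z) / of_nat (Suc m) - polar_part_defect (of_nat (Suc m) * of_real t) / of_nat (Suc m)"
    have S: "?a sums (partition_log_defect z - partition_log_defect (of_real t))"
      using t by (intro sums_diff partition_log_defect_sums) (auto simp: z_def)
    have b: "norm (?a m) \<le> 100 * (\<bar>d\<bar> * t powr (- 5 / 4)) * g m" for m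
    proof -
      define k where "k = real (Suc m)"
      have k: "k > 0" by (simp add: k_def)
      have kc: "complex_of_nat (Suc m) = of_real k" by (simp add: k_def)
      define S where "S = closed_segment (of_real k * z) (of_real k * of_real t)"
      have S': "Re w = k * t \<and> \<bar>Im w\<bar> \<le> k * \<bar>d\<bar>" if "w \<in> S" for w
      proof -
        obtain u where u: "0 \<le> u" "u \<le> 1" "w = (1 - u) *\<^sub>R (of_real k * z) + u *\<^sub>R (of_real k * of_real t)"
          using \<open>w \<in> S\<close> unfolding S_def closed_segment_def by auto
        have "Re w = k * t" unfolding u(3) by (simp add: z_def algebra_simps)
        moreover have "Im w = (1 - u) * (k * d)" unfolding u(3) by (simp add: z_def)
        then have "\<bar>Im w\<bar> = (1 - u) * (k * \<bar>d\<bar>)" using u(1,2) k by (simp add: abs_mult)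
        then have "\<bar>Im w\<bar> \<le> 1 * (k * \<bar>d\<bar>)" using mult_right_mono[of "1 - u" 1 "k * \<bar>d\<bar>"] u(1,2) k by simp
        ultimately show ?thesis by simp
      qed
      have w: "Re w > 0" "\<bar>Im w\<bar> \<le> Re w / 2" if "w \<in> S" for w
      proof -
        have "k * \<bar>d\<bar> \<le> k * (t / 2)" using d k by (intro mult_left_mono) auto
        then show "\<bar>Im w\<bar> \<le> Re w / 2" using S'[OF that] by simp
        show "Re w > 0" using S'[OF that] k t by simp
      qed
      have "norm (polar_part_defect (of_real k * z) - polar_part_defect (of_real k * of_real t))
         \<le> 100 * (k * t) powr (- 5 / 4) * norm (of_real k * z - of_real k * of_real t)"
      proof (rule field_differentiable_bound[where S = S and f' = "deriv polar_part_defect"])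
        show "convex S" by (simp add: S_def)
        fix w assume w': "w \<in> S"
        show "(polar_part_defect has_field_derivative deriv polar_part_defect w) (at w within S)"
          by (rule has_field_derivative_at_within[OF polar_part_defect_deriv_bound(2)[OF w[OF w']]])
        show "norm (deriv polar_part_defect w) \<le> 100 * (k * t) powr (- 5 / 4)"
          using polar_part_defect_deriv_bound(1)[OF w[OF w']] S'[OF w'] by simp
      qed (auto simp: S_def)
      also have "norm (of_real k * z - of_real k * of_real t) = k * \<bar>d\<bar>"
      proof -
        have "of_real k * z - of_real k * of_real t = Complex 0 (k * d)"
          by (simp add: z_def complex_eq_iff)
        then show ?thesis using k by (simp add: complex_norm abs_mult)
      qed
      also have "(k * t) powr (- 5 / 4) = k powr (- 5 / 4) * t powr (- 5 / 4)"
        using k t by (simp add: powr_mult)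
      finally have "norm (polar_part_defect (of_real k * z) - polar_part_defect (of_real k * of_real t)) / k
          \<le> 100 * (k powr (- 5 / 4) * t powr (- 5 / 4)) * (k * \<bar>d\<bar>) / k"
        using k by (intro divide_right_mono) auto
      moreover have "norm (?a m) = norm (polar_part_defect (of_real k * z) - polar_part_defect (of_real k * of_real t)) / k"
        unfolding kc diff_divide_distrib[symmetric] norm_divide using k by simp
      moreover have "100 * (k powr (- 5 / 4) * t powr (- 5 / 4)) * (k * \<bar>d\<bar>) / k = 100 * (\<bar>d\<bar> * t powr (- 5 / 4)) * g m"
        using k unfolding g_def k_def[symmetric] by simp
      ultimately show ?thesis by (simp only:)
    qed
    have "norm (partition_log_defect z - partition_log_defect (of_real t)) \<le> (\<Sum>m. 100 * (\<bar>d\<bar> * t powr (- 5 / 4)) * g m)"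
      unfolding sums_unique[OF S] by (intro norm_suminf_le b summable_mult g)
    also have "\<dots> = 100 * suminf g * (\<bar>d\<bar> * t powr (- 5 / 4))"
      by (subst suminf_mult[OF g]) (simp add: mult_ac)
    finally show "norm (partition_log_defect (Complex t d) - partition_log_defect (of_real t)) \<le> 100 * suminf g * (\<bar>d\<bar> * t powr (- 5 / 4))"
      by (simp add: z_def)
  qed
qed

section \<open>The partition product on the whole circle\<close>

lemma sin_ge_half:
  assumes "0 \<le> y" "y \<le> pi / 2"
  shows "y / 2 \<le> sin y"
proof (cases "y \<le> pi / 3")
  case True
  let ?F = "\<lambda>y. sin y - y / 2"
  have "?F 0 \<le> ?F y"
  proof (rule DERIV_nonneg_imp_nondecreasing[where f = ?F])
    fix u :: real assume u: "0 \<le> u" "u \<le> y"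
    have "(?F has_real_derivative (cos u - 1 / 2)) (at u)"
      by (auto intro!: derivative_eq_intros)
    moreover have "cos (pi / 3) \<le> cos u"
      using u True by (intro cos_monotone_0_pi_le) auto
    then have "cos u - 1 / 2 \<ge> 0" by (simp add: cos_60)
    ultimately show "\<exists>z. (?F has_real_derivative z) (at u) \<and> 0 \<le> z" by blast
  qed (use assms in auto)
  then show ?thesis by simp
next
  case False
  have "sin (pi / 3) \<le> sin y"
    using False assms by (intro sin_monotone_2pi_le) auto
  moreover have "sqrt 3 \<ge> 17 / 10" by (rule real_le_rsqrt) (simp add: power2_eq_square)
  moreover have "pi \<le> 16 / 5" using pi_approx by simp
  ultimately show ?thesis using assms by (simp add: sin_60)
qed

lemma exp_minus_le_cube:
  fixes X :: real
  assumes "X > 0"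
  shows "exp (- X) \<le> 27 / X ^ 3"
proof -
  have "(X / 3) ^ 3 \<le> (1 + X / 3) ^ 3" using assms by (intro power_mono) auto
  also have "\<dots> \<le> exp X" using exp_ge_one_plus_x_over_n_power_n[of 3 X] assms by simp
  finally have "X ^ 3 / 27 \<le> exp X" by (simp add: power_divide)
  then show ?thesis using assms by (simp add: exp_minus field_simps)
qed

text \<open>
  All terms of the Lambert series are largest in modulus on the real axis. Already the loss in its first term suffices to
  bound the partition product away from the axis.
\<close>

lemma partition_log_off_axis:
  assumes t: "t > 0"
  shows "Re (partition_log (exp (- Complex t d))) \<le> partition_log_real t
    - (exp (- t) / (1 - exp (- t)) - exp (- t) / norm (1 - exp (- Complex t d)))"
proof -
  define Q where "Q = exp (- Complex t d)"
  have nQ: "norm Q = exp (- t)" by (simp add: Q_def)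
  have Q1: "norm Q < 1" using t by (simp add: nQ)
  let ?a = "\<lambda>m. Q ^ Suc m / (of_nat (Suc m) * (1 - Q ^ Suc m))"
  let ?b = "\<lambda>m. exp (- t) ^ Suc m / (of_nat (Suc m) * (1 - exp (- t) ^ Suc m))"
  have "?a sums partition_log Q"
    unfolding partition_log_def by (rule summable_sums[OF summable_norm_cancel[OF partition_log_summable[OF Q1]]])
  then have a: "(\<lambda>m. Re (?a m)) sums Re (partition_log Q)" by (rule sums_Re)
  have S: "(\<lambda>m. ?b m - Re (?a m)) sums (partition_log_real t - Re (partition_log Q))"
    by (intro sums_diff a partition_log_real_sums t)
  have nonneg: "?b m - Re (?a m) \<ge> 0" for m
  proof -
    have "Re (?a m) \<le> norm (?a m)" by (rule complex_Re_le_cmod)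
    also have "\<dots> \<le> ?b m" using partition_log_bound[OF Q1, of m] by (simp only: nQ)
    finally show ?thesis by simp
  qed
  have "?b 0 - Re (?a 0) = (\<Sum>m\<in>{0}. ?b m - Re (?a m))" by simp
  also have "\<dots> \<le> (\<Sum>m. ?b m - Re (?a m))"
    by (rule sum_le_suminf[OF sums_summable[OF S]]) (use nonneg in auto)
  also have "\<dots> = partition_log_real t - Re (partition_log Q)"
    using sums_unique[OF S] by simp
  finally have "?b 0 - Re (?a 0) \<le> partition_log_real t - Re (partition_log Q)" .
  moreover have "Re (?a 0) \<le> exp (- t) / norm (1 - Q)"
    using complex_Re_le_cmod[of "?a 0"] by (simp add: norm_divide nQ)
  ultimately show ?thesis unfolding Q_def by simp
qed

lemma norm_one_minus_exp_lower:
  assumes t: "0 < t" "t \<le> 1" and d: "\<bar>d\<bar> \<le> pi"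
  shows "(norm (1 - exp (- Complex t d)))\<^sup>2 \<ge> (1 - exp (- t))\<^sup>2 * (1 + d\<^sup>2 / (16 * t\<^sup>2))"
proof -
  define r where "r = exp (- t)"
  have r: "0 < r" "r < 1" using t by (auto simp: r_def)
  have "(norm (1 - exp (- Complex t d)))\<^sup>2 = (1 - r * cos d)\<^sup>2 + (r * sin d)\<^sup>2"
    by (simp add: cmod_power2 exp_eq_polar r_def cis.simps Re_exp Im_exp)
  also have "\<dots> = 1 - 2 * r * cos d + r\<^sup>2 * ((cos d)\<^sup>2 + (sin d)\<^sup>2)"
    by (simp only: power2_eq_square) (simp only: algebra_simps mult_2 mult_2_right)
  also have "\<dots> = 1 - 2 * r * cos d + r\<^sup>2" by simp
  also have "cos d = 1 - 2 * (sin (d / 2))\<^sup>2"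
    using cos_double_sin[of "d / 2"] by simp
  also have "1 - 2 * r * (1 - 2 * (sin (d / 2))\<^sup>2) + r\<^sup>2 = (1 - r)\<^sup>2 + 4 * r * (sin (d / 2))\<^sup>2"
    by (simp add: power2_eq_square algebra_simps)
  finally have N: "(norm (1 - exp (- Complex t d)))\<^sup>2 = (1 - r)\<^sup>2 + 4 * r * (sin (d / 2))\<^sup>2" .
  have "\<bar>d\<bar> / 4 \<le> \<bar>sin (d / 2)\<bar>"
  proof -
    have "\<bar>d / 2\<bar> / 2 \<le> sin \<bar>d / 2\<bar>" using d by (intro sin_ge_half) auto
    also have "\<dots> \<le> \<bar>sin (d / 2)\<bar>" by (simp add: abs_if)
    finally show ?thesis by simp
  qed
  then have "(\<bar>d\<bar> / 4)\<^sup>2 \<le> \<bar>sin (d / 2)\<bar>\<^sup>2" by (intro power_mono) auto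
  then have s: "d\<^sup>2 / 16 \<le> (sin (d / 2))\<^sup>2" by (simp add: power_divide)
  have "exp (- 1) \<le> r" unfolding r_def using t by simp
  moreover have "exp (- 1 :: real) \<ge> 1 / 4"
    using exp_le by (simp add: exp_minus field_simps)
  ultimately have r4: "4 * r \<ge> 1" by linarith
  have "1 - r \<le> t" using exp_ge_add_one_self[of "- t"] by (simp add: r_def)
  then have "(1 - r)\<^sup>2 \<le> t\<^sup>2" using r by (intro power_mono) auto
  then have "(1 - r)\<^sup>2 * (d\<^sup>2 / (16 * t\<^sup>2)) \<le> t\<^sup>2 * (d\<^sup>2 / (16 * t\<^sup>2))" by (intro mult_right_mono) auto
  also have "\<dots> = 1 * (d\<^sup>2 / 16)" using t by simp
  also have "\<dots> \<le> 4 * r * (sin (d / 2))\<^sup>2" using s r4 r by (intro mult_mono) auto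
  finally show ?thesis unfolding N r_def[symmetric] by (simp add: distrib_left)
qed

text \<open>
  The majorant for dominated convergence: with \<open>d = v * t powr (3 / 2)\<close> it is a multiple of \<open>1 / (1 + v\<^sup>2)\<close>, uniformly
  for the whole circle \<open>\<bar>d\<bar> \<le> \<pi>\<close>. The exponential loss \<open>X\<close> is at least a multiple of \<open>V / (1 + s)\<close>, where \<open>V = v\<^sup>2\<close> and
  \<open>s\<close> is a multiple of \<open>V * t\<close>. It is quadratic in \<open>v\<close> close to the axis, but far from it only of order \<open>v powr (2 / 3)\<close>,
  whose cube still beats \<open>v\<^sup>2\<close>; this is why the cubic bound for \<open>exp\<close> is used.
\<close>

lemma partition_log_dominated:
  assumes t: "0 < t" "t \<le> 1" and d: "\<bar>d\<bar> \<le> pi"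
  shows "norm (exp (partition_log (exp (- Complex t d)))) \<le>
    exp (partition_log_real t) * (2 * (216 * 128 ^ 3) / (1 + d\<^sup>2 / t ^ 3))"
proof -
  define r where "r = exp (- t)"
  have r: "0 < r" "r < 1" using t by (auto simp: r_def)
  define V where "V = d\<^sup>2 / t ^ 3"
  have V0: "V \<ge> 0" using t by (simp add: V_def)
  define s where "s = d\<^sup>2 / (16 * t\<^sup>2)"
  have s0: "s \<ge> 0" by (simp add: s_def)
  define w where "w = norm (1 - exp (- Complex t d)) / (1 - r)"
  have "w\<^sup>2 \<ge> 1 + s"
    using norm_one_minus_exp_lower[OF t d] r
    unfolding w_def s_def r_def by (simp add: power_divide divide_simps mult_ac)
  moreover have w0: "w \<ge> 0" using r by (simp add: w_def)
  ultimately have w1: "w \<ge> 1" using s0 by (metis add.commute le_add_same_cancel1 one_power2 order_trans power2_le_imp_le)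
  have "1 / w\<^sup>2 \<le> 1 / (1 + s)" using \<open>w\<^sup>2 \<ge> 1 + s\<close> s0 w1 by (intro divide_left_mono) auto
  have "1 - 1 / w\<^sup>2 = (1 - 1 / w) * (1 + 1 / w)"
    using w1 by (simp add: field_simps power2_eq_square)
  also have "\<dots> \<le> (1 - 1 / w) * 2" using w1 by (intro mult_left_mono) auto
  finally have W: "1 - 1 / w \<ge> s / (2 * (1 + s))"
  proof -
    assume "1 - 1 / w\<^sup>2 \<le> (1 - 1 / w) * 2"
    moreover have "(1 - b) / 2 \<le> 1 - c" if "a \<le> b" "1 - a \<le> (1 - c) * 2" for a b c :: real
    proof -
      have "1 - b \<le> (1 - c) * 2" using that by (rule order_trans[OF diff_left_mono])
      then show ?thesis by (simp add: field_simps)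
    qed
    ultimately have "1 - 1 / w \<ge> (1 - 1 / (1 + s)) / 2"
      using \<open>1 / w\<^sup>2 \<le> 1 / (1 + s)\<close> by blast
    also have "(1 - 1 / (1 + s)) / 2 = s / (2 * (1 + s))" using s0 by (simp add: field_simps)
    finally show ?thesis .
  qed
  define X where "X = r / (1 - r) - r / norm (1 - exp (- Complex t d))"
  have X: "X \<ge> V / (128 * (1 + s))"
  proof -
    have nw: "norm (1 - exp (- Complex t d)) = w * (1 - r)" using r by (simp add: w_def)
    have "X = r / (1 - r) * (1 - 1 / w)"
    proof -
      have "r / b - r / (w * b) = r / b * (1 - 1 / w)" if "b > 0" for b
        using that w1 by (simp add: field_simps)
      then show ?thesis unfolding X_def nw using r by simp
    qed
    moreover have "r / (1 - r) \<ge> (1 / 4) / t"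
    proof -
      have "exp (- 1) \<le> r" unfolding r_def using t by simp
      moreover have "exp (- 1 :: real) \<ge> 1 / 4"
        using exp_le by (simp add: exp_minus field_simps)
      moreover have "1 - r \<le> t" using exp_ge_add_one_self[of "- t"] by (simp add: r_def)
      ultimately show ?thesis using r t by (intro frac_le) auto
    qed
    ultimately have "X \<ge> (1 / 4) / t * (s / (2 * (1 + s)))"
      using W s0 t r by (simp only:) (intro mult_mono, auto)
    moreover have "(1 / 4) / t * (s / (2 * (1 + s))) = V / (128 * (1 + s))"
    proof -
      have "s / (8 * t) = V / 128" using t by (simp add: s_def V_def power2_eq_square power3_eq_cube)
      have "(1 / 4) / t * (s / (2 * (1 + s))) = s / (8 * t) / (1 + s)" by simp
      also have "\<dots> = V / (128 * (1 + s))" unfolding \<open>s / (8 * t) = V / 128\<close> by simp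
      finally show ?thesis .
    qed
    ultimately show ?thesis by simp
  qed
  have "exp (- X) \<le> 2 * (216 * 128 ^ 3) / (1 + V)"
  proof (cases "V \<ge> 1")
    case False
    have "X \<ge> 0" using X V0 s0 by (meson divide_nonneg_nonneg mult_nonneg_nonneg order_trans add_nonneg_nonneg zero_le_one zero_le_numeral)
    then have "exp (- X) \<le> 1" by simp
    also have "1 \<le> 2 * (216 * 128 ^ 3) / (1 + V)" using False V0 by (simp add: field_simps)
    finally show ?thesis .
  next
    case True
    define Y where "Y = V / (128 * (1 + s))"
    have Y: "Y > 0" using True s0 by (simp add: Y_def)
    have "exp (- X) \<le> exp (- Y)" using X by (simp add: Y_def)
    also have "\<dots> \<le> 27 / Y ^ 3" by (rule exp_minus_le_cube[OF Y])
    also have "\<dots> = 27 * 128 ^ 3 * (1 + s) ^ 3 / V ^ 3"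
      unfolding Y_def power_divide power_mult_distrib by simp
    also have "(1 + s) ^ 3 \<le> 8 * V\<^sup>2"
    proof -
      have "s ^ 3 = V\<^sup>2 * (d\<^sup>2 / 4096)"
        using t by (simp add: s_def V_def power_divide power_mult_distrib field_simps flip: power_mult power_add)
      also have "\<dots> \<le> V\<^sup>2 * 1"
      proof (intro mult_left_mono)
        have "d\<^sup>2 \<le> 4\<^sup>2" using d pi_less_4 by (intro power2_le_iff_abs_le[THEN iffD2]) auto
        then show "d\<^sup>2 / 4096 \<le> 1" by simp
      qed auto
      finally have "s ^ 3 \<le> V\<^sup>2" by simp
      moreover have "(1 + s) ^ 3 \<le> 4 * (1 + s ^ 3)"
      proof -
        have "4 * (1 + s ^ 3) - (1 + s) ^ 3 = 3 * (s + 1) * (s - 1)\<^sup>2"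
          by (simp add: power2_eq_square power3_eq_cube algebra_simps)
        moreover have "3 * (s + 1) * (s - 1)\<^sup>2 \<ge> 0" using s0 by simp
        ultimately show ?thesis by linarith
      qed
      moreover have "4 * (1 + s ^ 3) \<le> 4 * (V\<^sup>2 + V\<^sup>2)"
        using \<open>s ^ 3 \<le> V\<^sup>2\<close> True by (intro mult_left_mono add_mono) auto
      ultimately have "(1 + s) ^ 3 \<le> 4 * (V\<^sup>2 + V\<^sup>2)" by (meson order_trans)
      then show ?thesis by simp
    qed
    then have "27 * 128 ^ 3 * (1 + s) ^ 3 / V ^ 3 \<le> 27 * 128 ^ 3 * (8 * V\<^sup>2) / V ^ 3"
      using True by (intro divide_right_mono mult_left_mono) auto
    also have "\<dots> = 216 * 128 ^ 3 / V" using True by (simp add: power2_eq_square power3_eq_cube)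
    also have "\<dots> \<le> 2 * (216 * 128 ^ 3) / (1 + V)" using True by (simp add: field_simps)
    finally show ?thesis .
  qed
  moreover have "norm (exp (partition_log (exp (- Complex t d)))) \<le> exp (partition_log_real t) * exp (- X)"
    using partition_log_off_axis[OF t(1), of d] by (simp add: X_def r_def flip: exp_add)
  ultimately show ?thesis
    unfolding V_def using mult_left_mono[of "exp (- X)" _ "exp (partition_log_real t)"] by (meson exp_ge_zero order_trans)
qed


section \<open>The Appell-Lerch sum near the unit circle\<close>

text \<open>
  The logarithm of Euler's reflection formula, differentiated three times, relates \<open>Polygamma 2 (1 - x)\<close> and
  \<open>Polygamma 2 x\<close>. At \<open>x = 1 / 4\<close> these two values are multiples of the sums of the inverse cubes of the
  numbers congruent to \<open>3\<close> and to \<open>1\<close> modulo \<open>4\<close>.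
\<close>

lemma sum_alternating_inverse_odd_cubes:
  "(\<lambda>k. (-1) ^ k / (2 * real k + 1) ^ 3) sums (pi ^ 3 / 32)"
proof -
  have s: "sin (pi * x) > 0" if "x \<in> {0<..<1}" for x :: real
    using that by (intro sin_gt_zero) (auto simp: mult_less_cancel_left2 not_le)
  have eq_deriv: "D = E" if "x \<in> {0<..<1}" "\<And>y. y \<in> {0<..<1} \<Longrightarrow> f y = g y"
    "(f has_real_derivative D) (at x)" "(g has_real_derivative E) (at x)" for f g :: "real \<Rightarrow> real" and x D E
  proof -
    have "eventually (\<lambda>y. f y = g y) (nhds x)"
      using that(1,2) by (auto intro!: eventually_mono[OF eventually_nhds_in_open[of "{0<..<1}"]])
    then show ?thesis
      using that(3,4) DERIV_cong_ev[OF refl _ refl] DERIV_unique by metis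
  qed
  have D: "Digamma x - Digamma (1 - x) = - (pi * cot (pi * x))" if x: "x \<in> {0<..<1}" for x :: real
  proof (rule eq_deriv[OF x])
    show "ln_Gamma y + ln_Gamma (1 - y) = ln pi - ln (sin (pi * y))" if y: "y \<in> {0<..<1}" for y :: real
    proof -
      have "Gamma y * Gamma (1 - y) = pi / sin (pi * y)"
        using Gamma_reflection_complex[of "of_real y"]
        by (metis Gamma_complex_of_real of_real_1 of_real_diff of_real_divide of_real_eq_iff of_real_mult sin_of_real)
      then have "ln (Gamma y * Gamma (1 - y)) = ln (pi / sin (pi * y))" by simp
      moreover have "Gamma y > 0" "Gamma (1 - y) > 0"
        using y by (auto intro!: Gamma_real_pos)
      ultimately show ?thesis
        using s[OF y] y by (simp add: ln_mult ln_div ln_Gamma_real_pos)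
    qed
    show "((\<lambda>y. ln_Gamma y + ln_Gamma (1 - y)) has_real_derivative (Digamma x - Digamma (1 - x))) (at x)"
      using x by (auto intro!: derivative_eq_intros)
    show "((\<lambda>y. ln pi - ln (sin (pi * y))) has_real_derivative - (pi * cot (pi * x))) (at x)"
      using s[OF x] by (auto intro!: derivative_eq_intros simp: cot_def field_simps)
  qed
  have np: "x \<notin> \<int>\<^sub>\<le>\<^sub>0" "1 - x \<notin> \<int>\<^sub>\<le>\<^sub>0" if "x \<in> {0<..<1}" for x :: real
    using that by (auto elim!: nonpos_Ints_cases)
  have P1: "Polygamma 1 x + Polygamma 1 (1 - x) = pi\<^sup>2 / (sin (pi * x))\<^sup>2" if x: "x \<in> {0<..<1}" for x :: real
  proof (rule eq_deriv[OF x D])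
    show "((\<lambda>y. Digamma y - Digamma (1 - y)) has_real_derivative (Polygamma 1 x + Polygamma 1 (1 - x))) (at x)"
      using np[OF x] by (auto intro!: derivative_eq_intros)
    show "((\<lambda>y. - (pi * cot (pi * y))) has_real_derivative (pi\<^sup>2 / (sin (pi * x))\<^sup>2)) (at x)"
      using s[OF x] by (auto intro!: derivative_eq_intros DERIV_chain2[OF DERIV_cot] simp: power2_eq_square field_simps)
  qed
  have P2: "Polygamma 2 x - Polygamma 2 (1 - x) = - 2 * pi ^ 3 * cos (pi * x) / (sin (pi * x)) ^ 3"
    if x: "x \<in> {0<..<1}" for x :: real
  proof (rule eq_deriv[OF x P1])
    show "((\<lambda>y. Polygamma 1 y + Polygamma 1 (1 - y)) has_real_derivative (Polygamma 2 x - Polygamma 2 (1 - x))) (at x)"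
      using np[OF x] by (auto intro!: derivative_eq_intros simp: numeral_2_eq_2)
    show "((\<lambda>y. pi\<^sup>2 / (sin (pi * y))\<^sup>2) has_real_derivative (- 2 * pi ^ 3 * cos (pi * x) / (sin (pi * x)) ^ 3)) (at x)"
      using s[OF x] by (auto intro!: derivative_eq_intros simp: power2_eq_square power3_eq_cube field_simps)
  qed
  have "Polygamma 2 (3/4 :: real) - Polygamma 2 (1/4) = 4 * pi ^ 3"
  proof -
    have "sin (pi / 4) ^ 2 = (1/2 :: real)" by (simp add: sin_45 power_divide)
    then have h: "(sqrt 2 / 2) ^ 3 = sqrt 2 / 4" by (simp add: power3_eq_cube power2_eq_square sin_45)
    have "Polygamma 2 (3/4 :: real) - Polygamma 2 (1/4) = pi ^ 3 * sqrt 2 / (sqrt 2 / 2) ^ 3"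
      using P2[of "1/4"] by (simp add: sin_45 cos_45)
    also have "\<dots> = 4 * pi ^ 3"
      unfolding h by simp
    finally show ?thesis .
  qed
  moreover have S: "(\<lambda>k. 1 / (4 * real k + 4 * z) ^ 3) sums (- Polygamma 2 z / 128)" if z: "z > 0" for z :: real
  proof -
    have "(\<lambda>k. inverse ((z + real k) ^ 3)) sums (- Polygamma 2 z / 2)"
      using Polygamma_LIMSEQ[of z 2] z by (auto simp: numeral_3_eq_3 numeral_2_eq_2)
    from sums_divide[OF this, of 64] have "(\<lambda>k. inverse ((z + real k) ^ 3) / 64) sums (- Polygamma 2 z / 128)"
      by simp
    moreover have "inverse ((z + real k) ^ 3) / 64 = 1 / (4 * real k + 4 * z) ^ 3" for k
    proof -
      have "4 * real k + 4 * z = 4 * (z + real k)" by simp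
      then show ?thesis by (simp only: power_mult_distrib) (simp add: field_simps)
    qed
    ultimately show ?thesis by simp
  qed
  have "(\<lambda>k. 1 / (4 * real k + 1) ^ 3 - 1 / (4 * real k + 3) ^ 3) sums (- Polygamma 2 (1/4) / 128 - - Polygamma 2 (3/4) / 128)"
    using sums_diff[OF S[of "1/4"] S[of "3/4"]] by simp
  ultimately have s1: "(\<lambda>k. 1 / (4 * real k + 1) ^ 3 - 1 / (4 * real k + 3) ^ 3) sums (pi ^ 3 / 32)"
    by (simp add: field_simps)
  let ?f = "\<lambda>k. (-1) ^ k / (2 * real k + 1) ^ 3"
  have sm: "summable ?f"
  proof (rule summable_comparison_test')
    show "summable (\<lambda>k. 1 / real (Suc k) ^ 2)"
      using inverse_squares_sums by (simp add: sums_iff add_ac)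
    fix k :: nat
    have "real (Suc k) ^ 2 \<le> real (Suc k) ^ 3" by (intro power_increasing) auto
    also have "\<dots> \<le> (2 * real k + 1) ^ 3" by (intro power_mono) auto
    finally show "norm (?f k) \<le> 1 / real (Suc k) ^ 2"
      by (simp add: norm_divide frac_le)
  qed
  have "(\<lambda>n. sum ?f {n * 2..<n * 2 + 2}) sums suminf ?f"
    using sums_group[OF summable_sums[OF sm], of 2] by simp
  moreover have "sum ?f {n * 2..<n * 2 + 2} = 1 / (4 * real n + 1) ^ 3 - 1 / (4 * real n + 3) ^ 3" for n
  proof -
    have "{n * 2..<n * 2 + 2} = {2 * n, Suc (2 * n)}" by auto
    then show ?thesis by (simp add: algebra_simps)
  qed
  ultimately have "(\<lambda>n. 1 / (4 * real n + 1) ^ 3 - 1 / (4 * real n + 3) ^ 3) sums suminf ?f"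
    by (simp only:)
  then have "suminf ?f = pi ^ 3 / 32"
    using s1 by (rule sums_unique2)
  with sm show ?thesis
    by (simp add: sums_iff)
qed

definition appell_sum :: "complex \<Rightarrow> complex" where
  "appell_sum q = (\<Sum>k. appell_term q k)"

text \<open>
  The bound depends on \<open>norm q\<close> only and is summable in \<open>k\<close>. So it serves both as a bound for the sum on the whole circle
  and as the majorant for its limits.
\<close>

lemma appell_term_norm_le:
  assumes u: "u > 0" and q: "norm q = exp (- u)"
  shows "u ^ 3 * norm (appell_term q k) \<le> 54 / real (2 * k + 1) ^ 3"
proof -
  define K where "K = real (2 * k + 1)"
  have K: "K > 0" by (simp add: K_def)
  define x where "x = q ^ (2 * k + 1)"
  define c where "c = K * u"
  have c: "c > 0" using K u by (simp add: c_def)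
  have nx: "norm x = exp (- c)"
    unfolding x_def norm_power q c_def K_def by (simp only: exp_of_nat_mult[symmetric] mult_minus_right)
  have nx1: "norm x < 1" using c by (simp add: nx)
  have d: "c / (1 + c) \<le> norm (1 - x)"
  proof -
    have "exp (- c) \<le> 1 / (1 + c)"
      using exp_ge_add_one_self[of c] c by (simp add: exp_minus field_simps)
    then have "c / (1 + c) \<le> 1 - exp (- c)" using c by (simp add: field_simps)
    also have "\<dots> \<le> norm (1 - x)" using norm_triangle_ineq2[of 1 x] by (simp add: nx)
    finally show ?thesis .
  qed
  then have d3: "(c / (1 + c)) ^ 3 \<le> norm (1 - x) ^ 3" using c by (intro power_mono) auto
  have "norm q ^ (3 * k\<^sup>2 + 3 * k + 1) \<le> 1"
    unfolding q by (rule power_le_one) (use u in auto)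
  moreover have n2: "norm (1 + x) \<le> 2" using norm_triangle_ineq[of 1 x] nx1 by simp
  moreover have "norm (appell_term q k) = norm q ^ (3 * k\<^sup>2 + 3 * k + 1) * (norm x * norm (1 + x) / norm (1 - x) ^ 3)"
    unfolding appell_term_def x_def[symmetric] by (simp add: norm_mult norm_divide norm_power)
  ultimately have "norm (appell_term q k) \<le> 1 * (norm x * 2 / (c / (1 + c)) ^ 3)"
    using d3 c by (simp only:) (intro mult_mono frac_le, auto)
  also have "\<dots> = 2 * (exp (- c) * (1 + c) ^ 3) / c ^ 3"
    using c by (simp add: nx power_divide)
  also have "exp (- c) * (1 + c) ^ 3 \<le> 27"
  proof -
    have "(1 + c) ^ 3 \<le> (3 * (1 + c / 3)) ^ 3" using c by (intro power_mono) auto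
    also have "\<dots> = 27 * (1 + c / 3) ^ 3" by (simp only: power_mult_distrib) simp
    also have "(1 + c / 3) ^ 3 \<le> exp c" using exp_ge_one_plus_x_over_n_power_n[of 3 c] c by simp
    finally show ?thesis by (simp add: exp_minus field_simps)
  qed
  then have "2 * (exp (- c) * (1 + c) ^ 3) / c ^ 3 \<le> 2 * 27 / c ^ 3"
    using c by (intro divide_right_mono mult_left_mono) auto
  finally have "u ^ 3 * norm (appell_term q k) \<le> u ^ 3 * (54 / c ^ 3)"
    using u by (intro mult_left_mono) auto
  also have "\<dots> = 54 / K ^ 3" using u K by (simp add: c_def power_mult_distrib)
  finally show ?thesis by (simp add: K_def)
qed

lemma summable_inverse_odd_cubes: "summable (\<lambda>k. 54 / real (2 * k + 1) ^ 3)"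
proof (rule summable_comparison_test')
  show "summable (\<lambda>k. 54 * (1 / (real k + 1)\<^sup>2))"
    using inverse_squares_sums by (intro summable_mult) (simp add: sums_iff add_ac)
  fix k :: nat
  have "(real k + 1) ^ 2 \<le> (real k + 1) ^ 3" by (intro power_increasing) auto
  also have "\<dots> \<le> real (2 * k + 1) ^ 3" by (intro power_mono) auto
  finally show "norm (54 / real (2 * k + 1) ^ 3) \<le> 54 * (1 / (real k + 1)\<^sup>2)"
    by (simp add: frac_le)
qed

definition appell_bound :: real where
  "appell_bound = (\<Sum>k. 54 / real (2 * k + 1) ^ 3)"

lemma appell_sum_norm_le:
  assumes u: "u > 0" and q: "norm q = exp (- u)"
  shows "u ^ 3 * norm (appell_sum q) \<le> appell_bound"
proof -
  have n: "norm q < 1" using u q by simp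
  have "u ^ 3 * norm (appell_sum q) \<le> u ^ 3 * (\<Sum>k. norm (appell_term q k))"
    unfolding appell_sum_def using u by (intro mult_left_mono summable_norm appell_term_summable n) auto
  also have "\<dots> = (\<Sum>k. u ^ 3 * norm (appell_term q k))"
    by (rule suminf_mult[symmetric, OF appell_term_summable[OF n]])
  also have "\<dots> \<le> appell_bound"
    unfolding appell_bound_def
    by (intro suminf_le appell_term_norm_le u q summable_mult appell_term_summable n summable_inverse_odd_cubes)
  finally show ?thesis .
qed

lemma appell_sum_tannery:
  assumes u: "\<And>n. u n > 0" and q: "\<And>n. norm (q n) = exp (- u n)"
    and lim: "\<And>k. (\<lambda>n. of_real (u n ^ 3) * appell_term (q n) k) \<longlonglongrightarrow> b k"
  shows "(\<lambda>n. of_real (u n ^ 3) * appell_sum (q n)) \<longlonglongrightarrow> suminf b"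
proof -
  have "(\<lambda>n. \<Sum>k. of_real (u n ^ 3) * appell_term (q n) k) \<longlonglongrightarrow> suminf b"
  proof (rule tannerys_theorem[THEN conjunct2, THEN conjunct2, OF lim _ summable_inverse_odd_cubes])
    show "\<forall>\<^sub>F (k, n) in sequentially \<times>\<^sub>F sequentially.
        norm (of_real (u n ^ 3) * appell_term (q n) k) \<le> 54 / real (2 * k + 1) ^ 3"
    proof (intro always_eventually allI, safe)
      fix k n
      have "norm (of_real (u n ^ 3) * appell_term (q n) k) = u n ^ 3 * norm (appell_term (q n) k)"
        unfolding norm_mult norm_of_real using u[of n] by simp
      then show "norm (of_real (u n ^ 3) * appell_term (q n) k) \<le> 54 / real (2 * k + 1) ^ 3"
        using appell_term_norm_le[OF u q] by simp
    qed
  qed simp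
  moreover have "(\<Sum>k. of_real (u n ^ 3) * appell_term (q n) k) = of_real (u n ^ 3) * appell_sum (q n)" for n
  proof -
    have "norm (q n) < 1" using u[of n] q[of n] by simp
    from suminf_mult[OF summable_norm_cancel[OF appell_term_summable[OF this]]]
    show ?thesis by (simp add: appell_sum_def)
  qed
  ultimately show ?thesis by simp
qed

text \<open>
  In the limit every factor \<open>1 - q ^ (2 * k + 1)\<close> behaves like \<open>(2 * k + 1) * u\<close>, because the points approach \<open>1\<close>
  tangentially to the real axis; the numerators tend to \<open>2 * (-1) ^ k\<close>.
\<close>

lemma appell_sum_near_1:
  assumes u: "\<And>n. u n > 0" "u \<longlonglongrightarrow> 0" and y: "(\<lambda>n. y n / u n) \<longlonglongrightarrow> 0"
  shows "(\<lambda>n. of_real (u n ^ 3) * appell_sum (exp (- Complex (u n) (y n)))) \<longlonglongrightarrow> of_real (pi ^ 3 / 16)"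
proof -
  define z where "z n = Complex (u n) (y n)" for n
  have z0: "z n \<noteq> 0" for n using u(1)[of n] by (auto simp: z_def complex_eq_iff)
  have zu: "(\<lambda>n. z n / of_real (u n)) \<longlonglongrightarrow> 1"
  proof -
    have "(\<lambda>n. Complex 1 (y n / u n)) \<longlonglongrightarrow> Complex 1 0"
      by (intro tendsto_Complex tendsto_const y)
    moreover have "z n / of_real (u n) = Complex 1 (y n / u n)" for n
      using u(1)[of n] by (simp add: z_def complex_eq_iff)
    ultimately show ?thesis by (simp add: one_complex.code)
  qed
  have uz: "(\<lambda>n. of_real (u n) / z n) \<longlonglongrightarrow> 1"
    using tendsto_divide[OF tendsto_const[of 1] zu] by simp
  have zlim: "z \<longlonglongrightarrow> 0"
  proof -
    have "(\<lambda>n. z n / of_real (u n) * of_real (u n)) \<longlonglongrightarrow> 1 * of_real 0"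
      by (intro tendsto_mult zu tendsto_of_real u)
    moreover have "z n / of_real (u n) * of_real (u n) = z n" for n using u(1)[of n] by simp
    ultimately show ?thesis by simp
  qed
  have zat: "filterlim z (at 0) sequentially"
    using zlim z0 by (simp add: filterlim_at)
  have qlim: "(\<lambda>n. exp (- z n)) \<longlonglongrightarrow> 1"
    using tendsto_exp[OF tendsto_minus[OF zlim]] by simp
  define b where "b k = complex_of_real (2 * ((-1) ^ k / (2 * real k + 1) ^ 3))" for k
  have lim: "(\<lambda>n. of_real (u n ^ 3) * appell_term (exp (- z n)) k) \<longlonglongrightarrow> b k" for k
  proof -
    define K where "K = complex_of_nat (2 * k + 1)"
    have K: "K \<noteq> 0" unfolding K_def of_nat_eq_0_iff by simp
    have "((\<lambda>w. 1 - exp (- (K * w))) has_field_derivative K) (at 0)"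
      by (auto intro!: derivative_eq_intros)
    then have "((\<lambda>w. (1 - exp (- (K * w))) / w) \<longlongrightarrow> K) (at 0)"
      by (simp add: has_field_derivative_iff)
    from tendsto_divide[OF tendsto_const[of 1] filterlim_compose[OF this zat] K]
    have zK: "(\<lambda>n. z n / (1 - exp (- (K * z n)))) \<longlonglongrightarrow> 1 / K" by simp
    have cube: "(\<lambda>n. (of_real (u n) / z n * (z n / (1 - exp (- (K * z n))))) ^ 3) \<longlonglongrightarrow> (1 * (1 / K)) ^ 3"
      by (intro tendsto_power tendsto_mult uz zK)
    have "(\<lambda>n. (-1) ^ k * exp (- z n) ^ (3 * k\<^sup>2 + 3 * k + 1) * (exp (- z n) ^ (2 * k + 1) * (1 + exp (- z n) ^ (2 * k + 1))
         * (of_real (u n) / z n * (z n / (1 - exp (- (K * z n))))) ^ 3)) \<longlonglongrightarrow>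
         (-1) ^ k * 1 ^ (3 * k\<^sup>2 + 3 * k + 1) * (1 ^ (2 * k + 1) * (1 + 1 ^ (2 * k + 1)) * (1 * (1 / K)) ^ 3)"
      by (intro tendsto_mult tendsto_add tendsto_power[OF qlim] tendsto_const cube)
    moreover have "(-1) ^ k * exp (- z n) ^ (3 * k\<^sup>2 + 3 * k + 1) * (exp (- z n) ^ (2 * k + 1) * (1 + exp (- z n) ^ (2 * k + 1))
         * (of_real (u n) / z n * (z n / (1 - exp (- (K * z n))))) ^ 3) = of_real (u n ^ 3) * appell_term (exp (- z n)) k" for n
    proof -
      have e: "exp (- z n) ^ (2 * k + 1) = exp (- (K * z n))"
        unfolding K_def by (simp only: exp_of_nat_mult[symmetric] mult_minus_right)
      have "of_real (u n) / z n * (z n / (1 - exp (- (K * z n)))) = of_real (u n) / (1 - exp (- (K * z n)))"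
        using z0[of n] by simp
      then show ?thesis
        unfolding appell_term_def e by (simp add: power_divide mult_ac)
    qed
    moreover have "(-1) ^ k * 1 ^ (3 * k\<^sup>2 + 3 * k + 1) * (1 ^ (2 * k + 1) * (1 + 1 ^ (2 * k + 1)) * (1 * (1 / K)) ^ 3) = b k"
      by (simp add: b_def K_def power_divide add.commute mult.commute)
    ultimately show ?thesis by simp
  qed
  have "b sums complex_of_real (2 * (pi ^ 3 / 32))"
    unfolding b_def by (intro sums_of_real sums_mult sum_alternating_inverse_odd_cubes)
  then have "suminf b = of_real (pi ^ 3 / 16)" by (simp add: sums_iff)
  with appell_sum_tannery[OF u(1) _ lim] show ?thesis by (simp add: z_def)
qed

text \<open>
  Every term is continuous at \<open>-1\<close>, where the denominator is a power of \<open>2\<close>.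
\<close>

lemma appell_sum_near_minus_1:
  assumes u: "\<And>n. u n > 0" "u \<longlonglongrightarrow> 0" and y: "y \<longlonglongrightarrow> 0"
  shows "(\<lambda>n. of_real (u n ^ 3) * appell_sum (- exp (- Complex (u n) (y n)))) \<longlonglongrightarrow> 0"
proof -
  have zlim: "(\<lambda>n. - Complex (u n) (y n)) \<longlonglongrightarrow> - Complex 0 0"
    by (intro tendsto_minus tendsto_Complex u y)
  have q: "(\<lambda>n. - exp (- Complex (u n) (y n))) \<longlonglongrightarrow> - 1"
  proof -
    have "Complex 0 0 = 0" by (simp add: complex_eq_iff)
    then show ?thesis using tendsto_minus[OF tendsto_exp[OF zlim]] by simp
  qed
  have lim: "(\<lambda>n. of_real (u n ^ 3) * appell_term (- exp (- Complex (u n) (y n))) k) \<longlonglongrightarrow> 0" for k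
  proof -
    have "isCont (\<lambda>q. appell_term q k) (- 1)"
      unfolding appell_term_def by (intro continuous_intros) simp
    then have "(\<lambda>n. appell_term (- exp (- Complex (u n) (y n))) k) \<longlonglongrightarrow> appell_term (- 1) k"
      using q by (rule isCont_tendsto_compose)
    then have "(\<lambda>n. of_real (u n ^ 3) * appell_term (- exp (- Complex (u n) (y n))) k) \<longlonglongrightarrow> of_real (0 ^ 3) * appell_term (- 1) k"
      by (intro tendsto_mult tendsto_of_real tendsto_power u)
    then show ?thesis by simp
  qed
  have "(\<lambda>n. of_real (u n ^ 3) * appell_sum (- exp (- Complex (u n) (y n)))) \<longlonglongrightarrow> (\<Sum>k. 0)"
    by (rule appell_sum_tannery[OF u(1) _ lim]) simp
  then show ?thesis by simp
qed

section \<open>Extracting a coefficient\<close>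

text \<open>
  Even frequencies are orthogonal already on half a period.
\<close>

lemma integral_exp_even_frequency:
  fixes j :: int
  shows "(LINT y:{- pi / 2..pi / 2}|lborel. exp (\<i> * of_int (2 * j) * complex_of_real y)) = (if j = 0 then of_real pi else 0)"
proof -
  let ?f = "\<lambda>y. exp (\<i> * of_int (2 * j) * complex_of_real y)"
  have int: "set_integrable lborel {- pi / 2..pi / 2} ?f"
    by (rule borel_integrable_atLeastAtMost') (intro continuous_intros)
  have "(?f has_integral (if j = 0 then of_real pi else 0)) {- pi / 2..pi / 2}"
  proof (cases "j = 0")
    case True
    have "((\<lambda>y. 1 :: complex) has_integral measure lborel {- pi / 2..pi / 2} *\<^sub>R 1) {- pi / 2..pi / 2}"
      by (rule has_integral_const_real)
    then show ?thesis using True by (simp add: scaleR_conv_of_real)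
  next
    case False
    define c where "c = \<i> * of_int (2 * j)"
    have c: "c \<noteq> 0" using False by (simp add: c_def)
    have "(?f has_integral (exp (c * of_real (pi / 2)) / c - exp (c * of_real (- pi / 2)) / c)) {- pi / 2..pi / 2}"
      unfolding c_def[symmetric]
    proof (rule fundamental_theorem_of_calculus)
      fix y :: real
      have "((\<lambda>w. exp (c * w) / c) has_field_derivative exp (c * of_real y)) (at (of_real y))"
        using c by (auto intro!: derivative_eq_intros)
      then show "((\<lambda>y. exp (c * complex_of_real y) / c) has_vector_derivative exp (c * of_real y)) (at y within {- pi / 2..pi / 2})"
        by (rule has_vector_derivative_real_field[THEN has_vector_derivative_at_within])
    qed simp
    moreover have "exp (c * of_real (pi / 2)) = exp (c * of_real (- pi / 2))"
      unfolding exp_eq by (rule exI[of _ j]) (simp add: c_def algebra_simps)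
    ultimately show ?thesis using False by simp
  qed
  then show "(LINT y:{- pi / 2..pi / 2}|lborel. ?f y) = (if j = 0 then of_real pi else 0)"
    using set_borel_integral_eq_integral(2)[OF int] by (simp add: integral_unique)
qed

text \<open>
  Cauchy's formula with the two halves of the circle folded together. In \<open>F q + (-1) ^ n * F (- q)\<close> only the
  coefficients whose index has the parity of \<open>n\<close> survive, so half of the circle is enough, and the arcs around \<open>1\<close> and
  \<open>-1\<close>, on which \<open>1 / (q\<^sup>2; q\<^sup>2)\<^sub>\<infinity>\<close> takes the same values, are treated together.
\<close>

lemma coefficient_integral:
  fixes n :: nat and a :: "nat \<Rightarrow> real" and F :: "complex \<Rightarrow> complex"
  assumes t: "t > 0"
    and F: "\<And>q. norm q = exp (- t) \<Longrightarrow> (\<lambda>k. of_real (a k) * q ^ k) sums F q"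
    and abs: "summable (\<lambda>k. norm (a k) * exp (- t) ^ k)"
  defines "G \<equiv> \<lambda>y. (F (exp (- Complex t y)) + (-1) ^ n * F (- exp (- Complex t y)))
            * exp (\<i> * of_nat n * of_real y)"
  shows "(LINT y:{- pi / 2..pi / 2}|lborel. G y) = of_real (2 * pi * a n * exp (- (real n * t)))"
    "set_integrable lborel {- pi / 2..pi / 2} G"
proof -
  let ?I = "{- pi / 2..pi / 2 :: real}"
  define c where "c k = complex_of_real (a k) * (1 + (-1) ^ (n + k)) * of_real (exp (- t) ^ k)" for k :: nat
  define e where "e k y = exp (\<i> * of_int (int n - int k) * complex_of_real y)" for k y
  let ?f = "\<lambda>k y. indicator ?I y *\<^sub>R (c k * e k y)"
  have e_int: "set_integrable lborel ?I (e k)" for k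
    unfolding e_def by (rule borel_integrable_atLeastAtMost') (intro continuous_intros)
  have f_int: "integrable lborel (?f k)" for k
    using set_integrable_mult_right[of "c k" lborel ?I "e k"] e_int[of k] by (simp add: set_integrable_def)
  have f_val: "(\<integral>y. ?f k y \<partial>lborel) = (if k = n then of_real (2 * pi * a n * exp (- (real n * t))) else 0)" for k
  proof -
    have "(\<integral>y. ?f k y \<partial>lborel) = c k * (LINT y:?I|lborel. e k y)"
      unfolding set_lebesgue_integral_def[symmetric] by (rule set_integral_mult_right)
    also have "\<dots> = (if k = n then of_real (2 * pi * a n * exp (- (real n * t))) else 0)"
    proof (cases "even (n + k)")
      case True
      then have "even (int n - int k)" by simp
      then obtain j where j: "int n - int k = 2 * j" by blast
      have "(LINT y:?I|lborel. e k y) = (if j = 0 then of_real pi else 0)"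
        unfolding e_def j by (rule integral_exp_even_frequency)
      moreover have "j = 0 \<longleftrightarrow> k = n" using j by auto
      ultimately show ?thesis
        using True by (auto simp: c_def simp flip: exp_of_nat_mult)
    next
      case False
      then show ?thesis by (auto simp: c_def)
    qed
    finally show ?thesis .
  qed
  have norm_e: "norm (e k y) = 1" for k y
    unfolding e_def by (metis mult.assoc norm_exp_i_times of_real_mult of_real_of_int_eq)
  have c_le: "norm (c k) \<le> 2 * (norm (a k) * exp (- t) ^ k)" for k
  proof -
    have "norm (1 + (-1 :: complex) ^ (n + k)) \<le> 2"
      using norm_triangle_ineq[of 1 "(-1 :: complex) ^ (n + k)"] by (simp add: norm_power)
    then have "norm (a k) * norm (1 + (-1 :: complex) ^ (n + k)) * exp (- t) ^ k \<le> norm (a k) * 2 * exp (- t) ^ k"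
      by (intro mult_right_mono mult_left_mono) auto
    then show ?thesis by (simp add: c_def norm_mult norm_power mult_ac)
  qed
  have c_sum: "summable (\<lambda>k. norm (c k))"
    by (rule summable_comparison_test'[OF summable_mult[OF abs, of 2]]) (use c_le in auto)
  have pt: "(\<lambda>k. c k * e k y) sums G y" for y
  proof -
    define q where "q = exp (- Complex t y)"
    have nq: "norm q = exp (- t)" "norm (- q) = exp (- t)" by (simp_all add: q_def)
    have "(\<lambda>k. (of_real (a k) * q ^ k + (-1) ^ n * (of_real (a k) * (- q) ^ k)) * exp (\<i> * of_nat n * of_real y))
        sums ((F q + (-1) ^ n * F (- q)) * exp (\<i> * of_nat n * of_real y))"
      by (intro sums_mult2 sums_add sums_mult F nq)
    moreover have "(of_real (a k) * q ^ k + (-1) ^ n * (of_real (a k) * (- q) ^ k)) * exp (\<i> * of_nat n * of_real y) = c k * e k y" for k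
    proof -
      have "q = of_real (exp (- t)) * exp (- (\<i> * of_real y))"
        unfolding q_def exp_of_real[symmetric] exp_add[symmetric] by (rule arg_cong[where f = exp]) (simp add: complex_eq_iff)
      then have "q ^ k = of_real (exp (- t) ^ k) * exp (of_nat k * (- (\<i> * of_real y)))"
        by (simp only: power_mult_distrib exp_of_nat_mult of_real_power)
      moreover have "exp (of_nat k * (- (\<i> * of_real y))) * exp (\<i> * of_nat n * of_real y) = e k y"
        unfolding e_def exp_add[symmetric] by (rule arg_cong[where f = exp]) (simp add: algebra_simps)
      ultimately have "q ^ k * exp (\<i> * of_nat n * of_real y) = of_real (exp (- t) ^ k) * e k y"
        by (simp only: mult.assoc)
      moreover have "(of_real (a k) * q ^ k + (-1) ^ n * (of_real (a k) * (- q) ^ k)) * exp (\<i> * of_nat n * of_real y)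
          = of_real (a k) * (1 + (-1) ^ (n + k)) * (q ^ k * exp (\<i> * of_nat n * of_real y))"
        unfolding power_minus[of q k] power_add by (simp add: algebra_simps)
      ultimately show ?thesis by (simp add: c_def mult_ac)
    qed
    ultimately show ?thesis unfolding q_def G_def by simp
  qed
  have pt': "(\<lambda>k. ?f k y) sums (indicator ?I y *\<^sub>R G y)" for y
    by (intro sums_scaleR_right pt)
  have nf: "norm (?f k y) = indicator ?I y * norm (c k)" for k y
    by (simp add: norm_mult norm_e)
  have ae: "AE y in lborel. summable (\<lambda>k. norm (?f k y))"
    unfolding nf by (intro always_eventually allI summable_mult c_sum)
  have "(\<integral>y. norm (?f k y) \<partial>lborel) = pi * norm (c k)" for k
    unfolding nf by (simp add: mult.commute[of _ "norm (c k)"])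
  then have sm: "summable (\<lambda>k. \<integral>y. norm (?f k y) \<partial>lborel)"
    by (simp only:) (intro summable_mult c_sum)
  have sums_eq: "(\<Sum>k. ?f k y) = indicator ?I y *\<^sub>R G y" for y
    using pt'[of y] by (rule sums_unique[symmetric])
  have "(\<lambda>k. \<integral>y. ?f k y \<partial>lborel) sums (\<integral>y. (\<Sum>k. ?f k y) \<partial>lborel)"
    by (rule sums_integral[OF f_int ae sm])
  moreover have "(\<lambda>k. \<integral>y. ?f k y \<partial>lborel) sums of_real (2 * pi * a n * exp (- (real n * t)))"
    unfolding f_val using sums_single[of n "\<lambda>_. complex_of_real (2 * pi * a n * exp (- (real n * t)))"]
    by (simp only: eq_commute)
  ultimately have "(\<integral>y. (\<Sum>k. ?f k y) \<partial>lborel) = of_real (2 * pi * a n * exp (- (real n * t)))"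
    using sums_unique2 by blast
  then show "(LINT y:?I|lborel. G y) = of_real (2 * pi * a n * exp (- (real n * t)))"
    unfolding set_lebesgue_integral_def sums_eq .
  show "set_integrable lborel ?I G"
    unfolding set_integrable_def using integrable_suminf[OF f_int ae sm] unfolding sums_eq .
qed

section \<open>The saddle point\<close>

lemma eta2_odd_coefficient_integral:
  fixes t :: real and n :: nat
  assumes t: "t > 0"
  defines "G \<equiv> \<lambda>y. exp (partition_log (exp (- Complex (2 * t) (2 * y)))) *
      (appell_sum (exp (- Complex t y)) + (-1) ^ n * appell_sum (- exp (- Complex t y))) * exp (\<i> * of_nat n * of_real y)"
  shows "(LINT y:{- pi / 2..pi / 2}|lborel. G y) = of_real (2 * pi * eta2_odd n * exp (- (real n * t)))"
    "set_integrable lborel {- pi / 2..pi / 2} G"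
proof -
  define F where "F q = exp (partition_log (q\<^sup>2)) * appell_sum q" for q
  have F: "(\<lambda>k. of_real (eta2_odd k) * q ^ k) sums F q" if "norm q = exp (- t)" for q
    unfolding F_def appell_sum_def using that t
    by (intro eta2_odd_generating_function(1)) auto
  have abs: "summable (\<lambda>k. norm (eta2_odd k) * exp (- t) ^ k)"
    using eta2_odd_generating_function(2)[of "exp (- complex_of_real t)"] t
    by (simp add: norm_mult norm_power)
  have G: "(F (exp (- Complex t y)) + (-1) ^ n * F (- exp (- Complex t y))) * exp (\<i> * of_nat n * of_real y) = G y" for y
  proof -
    have "(exp (- Complex t y))\<^sup>2 = exp (- Complex (2 * t) (2 * y))"
      unfolding exp_double[symmetric] by (rule arg_cong[where f = exp]) (simp add: complex_eq_iff)
    then show ?thesis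
      by (simp add: F_def G_def algebra_simps)
  qed
  show "(LINT y:{- pi / 2..pi / 2}|lborel. G y) = of_real (2 * pi * eta2_odd n * exp (- (real n * t)))"
    using coefficient_integral(1)[OF t F abs, of n] unfolding G .
  show "set_integrable lborel {- pi / 2..pi / 2} G"
    using coefficient_integral(2)[OF t F abs, of n] unfolding G .
qed

text \<open>
  The exact exponent at the saddle point, with \<open>s\<^sup>2 = \<tau>\<^sub>0\<close> and \<open>n = 2 * A / s ^ 4\<close>: after the change of variables the
  linear terms cancel and a Gaussian with a small complex perturbation remains.
\<close>

lemma saddle_point_exponent:
  fixes s v A :: real
  assumes s: "s > 0"
  shows "of_real A / Complex (s\<^sup>2) (v * s ^ 3) - of_real (A / s\<^sup>2) + \<i> * of_real (2 * A / s ^ 4 * (v * s ^ 3 / 2))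
    = - of_real (A * v\<^sup>2) / Complex 1 (v * s)"
proof -
  define w where "w = \<i> * of_real v * of_real s"
  have c: "Complex 1 (v * s) = 1 + w" by (simp add: w_def complex_eq_iff)
  have nz: "1 + w \<noteq> 0" unfolding c[symmetric] by (simp add: complex_eq_iff)
  have s0: "complex_of_real s \<noteq> 0" using s by simp
  have t: "Complex (s\<^sup>2) (v * s ^ 3) = (of_real s)\<^sup>2 * (1 + w)"
    by (simp add: w_def complex_eq_iff power2_eq_square power3_eq_cube)
  have i: "\<i> * of_real (2 * A / s ^ 4 * (v * s ^ 3 / 2)) = of_real A / (of_real s)\<^sup>2 * w"
    using s0 by (simp add: w_def power2_eq_square power3_eq_cube power4_eq_xxxx)
  have w2: "w * w = - (of_real v * of_real v * (of_real s * of_real s))"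
    unfolding w_def by (simp add: algebra_simps)
  have "of_real A / ((of_real s)\<^sup>2 * (1 + w)) - of_real (A / s\<^sup>2) + of_real A / (of_real s)\<^sup>2 * w
     = of_real A / (of_real s)\<^sup>2 * (w * w) / (1 + w)"
    using nz s0 by (simp add: divide_simps) (simp add: algebra_simps)
  also have "\<dots> = - of_real (A * v\<^sup>2) / (1 + w)"
    unfolding w2 using s0 by (simp add: power2_eq_square)
  finally show ?thesis unfolding t i c .
qed

lemma exp_integral_gaussian:
  assumes A: "A > 0"
  shows "(\<integral>v. exp (- (A * v\<^sup>2)) \<partial>lborel) = sqrt (pi / A)"
proof -
  define \<sigma> where "\<sigma> = sqrt (1 / (2 * A))"
  have s2: "\<sigma>\<^sup>2 = 1 / (2 * A)" using A by (simp add: \<sigma>_def)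
  have "normal_density 0 \<sigma> v = exp (- (A * v\<^sup>2)) / sqrt (pi / A)" for v
    using A by (simp add: normal_density_def s2 field_simps)
  then have e: "exp (- (A * v\<^sup>2)) = sqrt (pi / A) * normal_density 0 \<sigma> v" for v
    using A by simp
  have sg: "\<sigma> > 0" using A by (simp add: \<sigma>_def)
  show "(\<integral>v. exp (- (A * v\<^sup>2)) \<partial>lborel) = sqrt (pi / A)"
    unfolding e using integral_normal_density[OF sg] by simp
qed

text \<open>
  Dominated convergence for the coefficient integral after the substitution \<open>y = h * v\<close> with
  \<open>h = \<tau> powr (3 / 2) / 2\<close>. The factor \<open>pi / 2 * (\<tau> n * sqrt (\<tau> n))\<close> collects \<open>2 * pi / h\<close> and the normalisation
  \<open>(\<tau> / 2) ^ 3\<close> of the Appell-Lerch sum.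
\<close>

theorem eta2_odd_normalised_limit:
  defines "\<tau> \<equiv> \<lambda>n. pi / sqrt (3 * real n)"
  shows "(\<lambda>n. eta2_odd n * exp (- (real n * (\<tau> n / 2)) - partition_log_real (\<tau> n)) * (pi / 2 * (\<tau> n * sqrt (\<tau> n))))
     \<longlonglongrightarrow> pi ^ 3 / 16 * sqrt (6 / pi)"
proof -
  define A where "A = pi\<^sup>2 / 6"
  have A: "A > 0" by (simp add: A_def)
  \<comment> \<open>the shift by \<open>4\<close> ensures \<open>\<tau> \<le> 1\<close>, which the majorant requires\<close>
  define T where "T m = \<tau> (m + 4)" for m
  define s where "s m = sqrt (T m)" for m
  define h where "h m = T m * s m / 2" for m
  have T0: "T m > 0" for m by (simp add: T_def \<tau>_def)
  have T1: "T m \<le> 1" for m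
  proof -
    have "pi \<le> sqrt (3 * real (m + 4))"
    proof (rule real_le_rsqrt)
      have "pi * pi \<le> (16 / 5) * (16 / 5)" using pi_approx by (intro mult_mono) auto
      then show "pi\<^sup>2 \<le> 3 * real (m + 4)" by (simp add: power2_eq_square)
    qed
    then show ?thesis by (simp add: T_def \<tau>_def divide_le_eq)
  qed
  have s0: "s m > 0" for m using T0 by (simp add: s_def)
  have Ts: "T m = (s m)\<^sup>2" for m using T0[of m] by (simp add: s_def)
  have h0: "h m > 0" for m using T0 s0 by (simp add: h_def)
  have hs: "h m = s m ^ 3 / 2" for m by (simp add: h_def Ts power2_eq_square power3_eq_cube)
  have nT: "real (m + 4) = 2 * A / s m ^ 4" for m
  proof -
    have "s m ^ 4 = (T m)\<^sup>2" unfolding Ts by (simp flip: power_mult)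
    also have "\<dots> = pi\<^sup>2 / (3 * real (m + 4))" by (simp add: T_def \<tau>_def power_divide)
    finally show ?thesis by (simp add: A_def)
  qed
  have Tlim: "T \<longlonglongrightarrow> 0"
    unfolding T_def \<tau>_def by real_asymp
  have slim: "s \<longlonglongrightarrow> 0"
    unfolding s_def using tendsto_real_sqrt[OF Tlim] by simp
  have hlim: "h \<longlonglongrightarrow> 0"
    unfolding h_def using tendsto_mult[OF Tlim slim] tendsto_divide_zero by fastforce
  define q where "q m v = exp (- Complex (T m / 2) (h m * v))" for m v
  define R where "R m v = exp (partition_log (exp (- Complex (T m) (2 * (h m * v))))) / of_real (exp (partition_log_real (T m)))" for m v
  define M where "M m v = of_real ((T m / 2) ^ 3) * (appell_sum (q m v) + (-1) ^ (m + 4) * appell_sum (- q m v))" for m v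
  define E where "E m v = exp (\<i> * of_nat (m + 4) * of_real (h m * v))" for m v
  define H where "H m v = indicator {- pi / 2..pi / 2} (h m * v) *\<^sub>R (R m v * M m v * E m v)" for m and v :: real
  define K where "K m = (T m / 2) ^ 3 / exp (partition_log_real (T m))" for m
  define G where "G m y = exp (partition_log (exp (- Complex (2 * (T m / 2)) (2 * y)))) *
      (appell_sum (exp (- Complex (T m / 2) y)) + (-1) ^ (m + 4) * appell_sum (- exp (- Complex (T m / 2) y))) * exp (\<i> * of_nat (m + 4) * of_real y)" for m y
  have HG: "H m v = of_real (K m) * (indicator {- pi / 2..pi / 2} (h m * v) *\<^sub>R G m (h m * v))" for m v
    by (simp add: H_def G_def R_def M_def E_def K_def q_def scaleR_conv_of_real)
  have T2: "T m / 2 > 0" for m using T0 by simp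
  have G_meas: "(\<lambda>y. indicator {- pi / 2..pi / 2} y *\<^sub>R G m y) \<in> borel_measurable borel" for m
  proof -
    have "set_integrable lborel {- pi / 2..pi / 2} (G m)"
      using eta2_odd_coefficient_integral(2)[OF T2[of m], of "m + 4"] unfolding G_def .
    then show ?thesis
      unfolding set_integrable_def by (auto dest: borel_measurable_integrable)
  qed
  have H_meas: "H m \<in> borel_measurable lborel" for m
  proof -
    have "(\<lambda>v. indicator {- pi / 2..pi / 2} (h m * v) *\<^sub>R G m (h m * v)) \<in> borel_measurable borel"
      by (rule measurable_compose[OF _ G_meas]) simp
    then have "(\<lambda>v. of_real (K m) * (indicator {- pi / 2..pi / 2} (h m * v) *\<^sub>R G m (h m * v))) \<in> borel_measurable borel"
      by (intro borel_measurable_times borel_measurable_const)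
    moreover have "H m = (\<lambda>v. of_real (K m) * (indicator {- pi / 2..pi / 2} (h m * v) *\<^sub>R G m (h m * v)))"
      by (rule ext) (rule HG)
    ultimately show ?thesis by (simp only: measurable_lborel2)
  qed
  have H_int: "(\<integral>v. H m v \<partial>lborel) = of_real (eta2_odd (m + 4) * exp (- (real (m + 4) * (T m / 2)) - partition_log_real (T m))
      * (pi / 2 * (T m * s m)))" for m
  proof -
    let ?I = "\<integral>v. indicator {- pi / 2..pi / 2} (h m * v) *\<^sub>R G m (h m * v) \<partial>lborel"
    let ?c = "2 * pi * eta2_odd (m + 4) * exp (- (real (m + 4) * (T m / 2)))"
    have "(\<integral>y. indicator {- pi / 2..pi / 2} y *\<^sub>R G m y \<partial>lborel)
        = \<bar>h m\<bar> *\<^sub>R (\<integral>v. indicator {- pi / 2..pi / 2} (0 + h m * v) *\<^sub>R G m (0 + h m * v) \<partial>lborel)"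
      using h0[of m] by (intro lborel_integral_real_affine) simp
    moreover have "(\<integral>y. indicator {- pi / 2..pi / 2} y *\<^sub>R G m y \<partial>lborel)
        = of_real (?c)"
      using eta2_odd_coefficient_integral(1)[OF T2[of m], of "m + 4"] unfolding set_lebesgue_integral_def G_def .
    ultimately have "of_real (h m) * ?I
       = of_real (?c)"
      using h0[of m] by (simp add: scaleR_conv_of_real)
    then have "?I
       = of_real (?c / h m)"
      using h0[of m] by (simp add: field_simps)
    moreover have "(\<integral>v. H m v \<partial>lborel)
       = of_real (K m) * ?I"
      unfolding HG by (rule integral_mult_right_zero)
    ultimately have "(\<integral>v. H m v \<partial>lborel) = of_real (K m * (?c / h m))"
      by (simp only: of_real_mult)
    also have "K m * (?c / h m)
       = eta2_odd (m + 4) * exp (- (real (m + 4) * (T m / 2)) - partition_log_real (T m)) * (pi / 2 * (T m * s m))"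
    proof -
      have "(T m / 2) ^ 3 * (2 * pi) / h m = pi / 2 * (T m * s m)"
        unfolding hs Ts using s0[of m] by (simp add: power2_eq_square power3_eq_cube)
      moreover have "K m * (?c / h m)
         = eta2_odd (m + 4) * (exp (- (real (m + 4) * (T m / 2))) / exp (partition_log_real (T m))) * ((T m / 2) ^ 3 * (2 * pi) / h m)"
        by (simp add: K_def)
      ultimately show ?thesis by (simp only: exp_diff)
    qed
    finally show ?thesis .
  qed
  define w where "w v = 2 * (216 * 128 ^ 3) * (2 * appell_bound) * inverse (1 + v\<^sup>2)" for v :: real
  have w_int: "integrable lborel w"
  proof -
    have "integrable lborel (\<lambda>v :: real. inverse (1 + v\<^sup>2))"
      using integrable_inverse_1_plus_square by (simp add: set_integrable_def einterval_eq)
    then show ?thesis unfolding w_def by (rule integrable_mult_right)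
  qed
  have bound: "norm (H m v) \<le> w v" for m v
  proof (cases "h m * v \<in> {- pi / 2..pi / 2}")
    case False
    have "appell_bound \<ge> 0"
      unfolding appell_bound_def by (intro suminf_nonneg summable_inverse_odd_cubes) simp
    then have "w v \<ge> 0" by (simp add: w_def)
    with False show ?thesis by (simp add: H_def)
  next
    case True
    define d where "d = 2 * (h m * v)"
    have d: "\<bar>d\<bar> \<le> pi" using True by (auto simp: d_def abs_le_iff)
    have "d\<^sup>2 / T m ^ 3 = v\<^sup>2"
      unfolding d_def hs Ts using s0[of m] by (simp add: power_mult_distrib power2_eq_square power3_eq_cube)
    with partition_log_dominated[OF T0 T1 d, of m]
    have "norm (exp (partition_log (exp (- Complex (T m) d)))) \<le>
      exp (partition_log_real (T m)) * (2 * (216 * 128 ^ 3) / (1 + v\<^sup>2))" by simp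
    then have R: "norm (R m v) \<le> 2 * (216 * 128 ^ 3) / (1 + v\<^sup>2)"
      unfolding R_def d_def[symmetric] norm_divide norm_of_real by (simp add: divide_le_eq mult.commute)
    have nq: "norm (q m v) = exp (- (T m / 2))" "norm (- q m v) = exp (- (T m / 2))" by (simp_all add: q_def)
    have "norm (M m v) = (T m / 2) ^ 3 * norm (appell_sum (q m v) + (-1) ^ (m + 4) * appell_sum (- q m v))"
      unfolding M_def norm_mult norm_of_real using T0[of m] by simp
    also have "\<dots> \<le> (T m / 2) ^ 3 * (norm (appell_sum (q m v)) + norm (appell_sum (- q m v)))"
    proof (intro mult_left_mono)
      show "norm (appell_sum (q m v) + (-1) ^ (m + 4) * appell_sum (- q m v)) \<le> norm (appell_sum (q m v)) + norm (appell_sum (- q m v))"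
        using norm_triangle_ineq[of "appell_sum (q m v)" "(-1) ^ (m + 4) * appell_sum (- q m v)"]
        by (simp add: norm_mult norm_power)
    qed (use T0[of m] in simp)
    also have "\<dots> \<le> 2 * appell_bound"
      using appell_sum_norm_le[OF T2 nq(1)] appell_sum_norm_le[OF T2 nq(2)] by (simp add: distrib_left)
    finally have M: "norm (M m v) \<le> 2 * appell_bound" .
    have "norm (E m v) = 1"
      unfolding E_def using norm_exp_i_times[of "real (m + 4) * (h m * v)"] by (simp add: mult.assoc)
    then have "norm (H m v) = norm (R m v) * norm (M m v)"
      using True by (simp add: H_def norm_mult)
    also have "\<dots> \<le> 2 * (216 * 128 ^ 3) / (1 + v\<^sup>2) * (2 * appell_bound)"
      by (intro mult_mono R M) auto
    finally show ?thesis by (simp add: w_def divide_inverse mult_ac)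
  qed
  have lim: "(\<lambda>m. H m v) \<longlonglongrightarrow> of_real (pi ^ 3 / 16 * exp (- (A * v\<^sup>2)))" for v
  proof -
    obtain L where L: "L \<ge> 0" "\<And>t d. t > 0 \<Longrightarrow> \<bar>d\<bar> \<le> t / 2 \<Longrightarrow>
        norm (partition_log_defect (Complex t d) - partition_log_defect (of_real t)) \<le> L * (\<bar>d\<bar> * t powr (- 5 / 4))"
      using partition_log_defect_lipschitz by blast
    define d where "d m = 2 * (h m * v)" for m
    define D where "D m = partition_log_defect (Complex (T m) (d m)) - partition_log_defect (of_real (T m))" for m
    have ds: "d m = v * s m ^ 3" for m by (simp add: d_def hs)
    have "D \<longlonglongrightarrow> 0"
    proof (rule Lim_null_comparison)
      have "(\<lambda>m. \<bar>v\<bar> * s m) \<longlonglongrightarrow> \<bar>v\<bar> * 0" by (intro tendsto_mult tendsto_const slim)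
      then have "eventually (\<lambda>m. \<bar>v\<bar> * s m < 1 / 2) sequentially"
        by (rule order_tendstoD) simp
      then show "\<forall>\<^sub>F m in sequentially. norm (D m) \<le> L * \<bar>v\<bar> * T m powr (1 / 4)"
      proof eventually_elim
        case (elim m)
        have "\<bar>d m\<bar> = T m * (\<bar>v\<bar> * s m)"
          unfolding ds Ts using s0[of m] by (simp add: abs_mult power2_eq_square power3_eq_cube)
        also have "\<dots> \<le> T m * (1 / 2)" using elim T0[of m] by (intro mult_left_mono) auto
        finally have "\<bar>d m\<bar> \<le> T m / 2" by simp
        from L(2)[OF T0 this] have "norm (D m) \<le> L * (\<bar>d m\<bar> * T m powr (- 5 / 4))" by (simp add: D_def)
        also have "\<bar>d m\<bar> * T m powr (- 5 / 4) = \<bar>v\<bar> * T m powr (1 / 4)"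
        proof -
          have "\<bar>d m\<bar> = \<bar>v\<bar> * (T m powr 1 * T m powr (1 / 2))"
            using \<open>\<bar>d m\<bar> = T m * (\<bar>v\<bar> * s m)\<close> T0[of m] by (simp add: s_def powr_half_sqrt)
          then have "\<bar>d m\<bar> * T m powr (- 5 / 4) = \<bar>v\<bar> * (T m powr 1 * T m powr (1 / 2) * T m powr (- 5 / 4))"
            by simp
          also have "T m powr 1 * T m powr (1 / 2) * T m powr (- 5 / 4) = T m powr (1 / 4)"
            unfolding powr_add[symmetric] by simp
          finally show ?thesis .
        qed
        finally show ?case by (simp add: mult.assoc)
      qed
      have "(\<lambda>m. T m powr (1 / 4)) \<longlonglongrightarrow> 0"
        unfolding T_def \<tau>_def by real_asymp
      then show "(\<lambda>m. L * \<bar>v\<bar> * T m powr (1 / 4)) \<longlonglongrightarrow> 0"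
        by (rule tendsto_mult_right_zero)
    qed
    have "(\<lambda>m. Complex 1 (v * s m)) \<longlonglongrightarrow> Complex 1 (v * 0)"
      by (intro tendsto_Complex tendsto_mult tendsto_const slim)
    then have "(\<lambda>m. Complex 1 (v * s m)) \<longlonglongrightarrow> 1" by (simp add: one_complex.code)
    then have "(\<lambda>m. - of_real (A * v\<^sup>2) / Complex 1 (v * s m) + D m) \<longlonglongrightarrow> - of_real (A * v\<^sup>2) / 1 + 0"
      by (intro tendsto_add tendsto_divide tendsto_const \<open>D \<longlonglongrightarrow> 0\<close>) auto
    then have "(\<lambda>m. exp (- of_real (A * v\<^sup>2) / Complex 1 (v * s m) + D m)) \<longlonglongrightarrow> exp (- of_real (A * v\<^sup>2) / 1 + 0)"
      by (rule tendsto_exp)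
    moreover have "exp (- of_real (A * v\<^sup>2) / Complex 1 (v * s m) + D m) = R m v * E m v" for m
    proof -
      have pl: "partition_log (exp (- complex_of_real (T m))) = of_real (partition_log_real (T m))"
        by (rule partition_log_of_real[OF T0])
      have Dm: "D m = partition_log (exp (- Complex (T m) (d m))) - of_real A / Complex (T m) (d m)
          - (of_real (partition_log_real (T m)) - of_real (A / (s m)\<^sup>2))"
        unfolding D_def partition_log_defect_def pl A_def by (simp add: Ts)
      have "- of_real (A * v\<^sup>2) / Complex 1 (v * s m) + D m
         = partition_log (exp (- Complex (T m) (d m))) - of_real (partition_log_real (T m))
           + \<i> * of_real (2 * A / s m ^ 4 * (v * s m ^ 3 / 2))"
        unfolding saddle_point_exponent[OF s0, symmetric] Dm ds Ts by simp
      also have "\<i> * of_real (2 * A / s m ^ 4 * (v * s m ^ 3 / 2)) = \<i> * of_nat (m + 4) * of_real (h m * v)"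
        unfolding nT[symmetric] hs by simp
      finally have eq: "- of_real (A * v\<^sup>2) / Complex 1 (v * s m) + D m
         = partition_log (exp (- Complex (T m) (d m))) - of_real (partition_log_real (T m))
           + \<i> * of_nat (m + 4) * of_real (h m * v)" .
      show ?thesis
        unfolding eq R_def E_def d_def[symmetric] by (simp only: exp_add exp_diff exp_of_real)
    qed
    ultimately have RE: "(\<lambda>m. R m v * E m v) \<longlonglongrightarrow> of_real (exp (- (A * v\<^sup>2)))"
      by (simp flip: exp_of_real)
    have Mlim: "(\<lambda>m. M m v) \<longlonglongrightarrow> of_real (pi ^ 3 / 16)"
    proof -
      have u: "\<And>m. T m / 2 > 0" "(\<lambda>m. T m / 2) \<longlonglongrightarrow> 0"
        using T2 tendsto_divide[OF Tlim tendsto_const[of 2]] by auto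
      have y: "(\<lambda>m. h m * v) \<longlonglongrightarrow> 0"
        using tendsto_mult[OF hlim tendsto_const[of v]] by simp
      have "h m * v / (T m / 2) = s m * v" for m using T0[of m] by (simp add: h_def)
      then have yu: "(\<lambda>m. h m * v / (T m / 2)) \<longlonglongrightarrow> 0"
        using tendsto_mult[OF slim tendsto_const[of v]] by simp
      have 1: "(\<lambda>m. of_real ((T m / 2) ^ 3) * appell_sum (q m v)) \<longlonglongrightarrow> of_real (pi ^ 3 / 16)"
        unfolding q_def by (rule appell_sum_near_1[OF u yu])
      have "(\<lambda>m. of_real ((T m / 2) ^ 3) * appell_sum (- q m v)) \<longlonglongrightarrow> 0"
        unfolding q_def by (rule appell_sum_near_minus_1[OF u y])
      then have "(\<lambda>m. norm (of_real ((T m / 2) ^ 3) * appell_sum (- q m v))) \<longlonglongrightarrow> 0"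
        by (rule tendsto_norm_zero)
      moreover have "norm (of_real ((T m / 2) ^ 3) * appell_sum (- q m v))
          = norm ((-1) ^ (m + 4) * (of_real ((T m / 2) ^ 3) * appell_sum (- q m v)))" for m
        by (simp add: norm_mult norm_power)
      ultimately have "(\<lambda>m. norm ((-1) ^ (m + 4) * (of_real ((T m / 2) ^ 3) * appell_sum (- q m v)))) \<longlonglongrightarrow> 0"
        by (simp only:)
      then have 2: "(\<lambda>m. (-1) ^ (m + 4) * (of_real ((T m / 2) ^ 3) * appell_sum (- q m v))) \<longlonglongrightarrow> 0"
        by (rule tendsto_norm_zero_cancel)
      show ?thesis
        using tendsto_add[OF 1 2] by (simp add: M_def algebra_simps)
    qed
    have prod: "(\<lambda>m. R m v * E m v * M m v) \<longlonglongrightarrow> of_real (exp (- (A * v\<^sup>2))) * of_real (pi ^ 3 / 16)"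
      by (intro tendsto_mult RE Mlim)
    have "(\<lambda>m. h m * v) \<longlonglongrightarrow> 0"
      using tendsto_mult[OF hlim tendsto_const[of v]] by simp
    then have "eventually (\<lambda>m. h m * v \<in> {- pi / 2<..<pi / 2}) sequentially"
      by (rule topological_tendstoD) auto
    then have "eventually (\<lambda>m. R m v * E m v * M m v = H m v) sequentially"
      by eventually_elim (simp add: H_def mult_ac)
    with prod have "(\<lambda>m. H m v) \<longlonglongrightarrow> of_real (exp (- (A * v\<^sup>2))) * of_real (pi ^ 3 / 16)"
      by (rule Lim_transform_eventually)
    then show ?thesis by (simp add: mult.commute)
  qed
  have "(\<lambda>m. \<integral>v. H m v \<partial>lborel) \<longlonglongrightarrow> (\<integral>v. of_real (pi ^ 3 / 16 * exp (- (A * v\<^sup>2))) \<partial>lborel)"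
    by (rule integral_dominated_convergence[OF _ H_meas w_int]) (use lim bound in auto)
  also have "(\<integral>v. complex_of_real (pi ^ 3 / 16 * exp (- (A * v\<^sup>2))) \<partial>lborel) = of_real (pi ^ 3 / 16 * sqrt (6 / pi))"
  proof -
    have "(\<integral>v. complex_of_real (pi ^ 3 / 16 * exp (- (A * v\<^sup>2))) \<partial>lborel) = of_real (pi ^ 3 / 16 * sqrt (pi / A))"
      unfolding integral_complex_of_real using exp_integral_gaussian[OF A] by simp
    also have "pi / A = 6 / pi" by (simp add: A_def power2_eq_square)
    finally show ?thesis .
  qed
  finally have "(\<lambda>m. eta2_odd (m + 4) * exp (- (real (m + 4) * (T m / 2)) - partition_log_real (T m)) * (pi / 2 * (T m * s m)))
      \<longlonglongrightarrow> pi ^ 3 / 16 * sqrt (6 / pi)"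
    unfolding H_int by (simp only: tendsto_of_real_iff)
  then show ?thesis
    unfolding T_def s_def by (rule LIMSEQ_offset)
qed


text \<open>
  At the saddle point \<open>n * \<tau> / 2 = \<pi>\<^sup>2 / (6 * \<tau>)\<close>, so the two exponentials combine to
  \<open>exp (\<pi> / 3 * sqrt (3 * n))\<close>. Replacing \<open>3 * n\<close> by \<open>3 * n - 1\<close> under the root changes the exponent by \<open>o(1)\<close>.
\<close>

theorem corollary1p7:
  shows "eta2_odd \<sim>[at_top] (\<lambda>n. 3 / 8 * sqrt (real n) * exp (pi / 3 * sqrt (3 * real n - 1)))"
proof (rule asymp_equivI')
  define \<tau> where "\<tau> n = pi / sqrt (3 * real n)" for n
  define J where "J n = eta2_odd n * exp (- (real n * (\<tau> n / 2)) - partition_log_real (\<tau> n)) * (pi / 2 * (\<tau> n * sqrt (\<tau> n)))" for n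
  define D where "D t = partition_log_real t - pi\<^sup>2 / 6 / t - ln (t / (2 * pi)) / 2" for t
  define B where "B n = exp (pi / 3 * sqrt (3 * real n)) / sqrt (2 * pi) * (2 / (pi * \<tau> n))
      / (3 / 8 * sqrt (real n) * exp (pi / 3 * sqrt (3 * real n - 1)))" for n
  have J: "J \<longlonglongrightarrow> pi ^ 3 / 16 * sqrt (6 / pi)"
    unfolding J_def[abs_def] \<tau>_def by (rule eta2_odd_normalised_limit)
  have "filterlim \<tau> (at_right 0) sequentially"
    unfolding \<tau>_def by real_asymp
  then have D: "(\<lambda>n. D (\<tau> n)) \<longlonglongrightarrow> 0"
    using partition_log_real_asymptotics unfolding D_def[symmetric] by (rule filterlim_compose[rotated])
  have B: "B \<longlonglongrightarrow> 16 / pi ^ 3 / sqrt (6 / pi)"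
  proof -
    have "(\<lambda>n. exp (pi / 3 * sqrt (3 * real n) - pi / 3 * sqrt (3 * real n - 1))) \<longlonglongrightarrow> 1"
      by real_asymp
    then have "(\<lambda>n. 1 / sqrt (2 * pi) * (2 * sqrt 3 / pi\<^sup>2) * (8 / 3)
        * exp (pi / 3 * sqrt (3 * real n) - pi / 3 * sqrt (3 * real n - 1))) \<longlonglongrightarrow> 1 / sqrt (2 * pi) * (2 * sqrt 3 / pi\<^sup>2) * (8 / 3) * 1"
      by (intro tendsto_mult tendsto_const)
    moreover have "eventually (\<lambda>n. 1 / sqrt (2 * pi) * (2 * sqrt 3 / pi\<^sup>2) * (8 / 3)
        * exp (pi / 3 * sqrt (3 * real n) - pi / 3 * sqrt (3 * real n - 1)) = B n) sequentially"
      using eventually_gt_at_top[of 0]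
      by eventually_elim (simp add: B_def \<tau>_def exp_diff real_sqrt_mult power2_eq_square mult_ac)
    ultimately have "B \<longlonglongrightarrow> 1 / sqrt (2 * pi) * (2 * sqrt 3 / pi\<^sup>2) * (8 / 3) * 1"
      by (rule Lim_transform_eventually)
    then have "B \<longlonglongrightarrow> 1 / sqrt (2 * pi) * (2 * sqrt 3 / pi\<^sup>2) * (8 / 3)" by simp
    moreover have "1 / sqrt (2 * pi) * (2 * sqrt 3 / pi\<^sup>2) * (8 / 3) = 16 / pi ^ 3 / sqrt (6 / pi)"
    proof -
      have "1 / (a * p) * (2 * b / x\<^sup>2) * (8 / c) = 16 / x ^ 3 / (a * b / p)"
        if "a > 0" "b > 0" "p > 0" "c = b * b" "x = p * p" for a b c p x :: real
        unfolding that(4,5) using that(1-3) by (simp add: field_simps power2_eq_square power3_eq_cube)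
      from this[of "sqrt 2" "sqrt 3" "sqrt pi" 3 pi]
      have "1 / (sqrt 2 * sqrt pi) * (2 * sqrt 3 / pi\<^sup>2) * (8 / 3) = 16 / pi ^ 3 / (sqrt 2 * sqrt 3 / sqrt pi)"
        by simp
      moreover have "sqrt (6 / pi) = sqrt 2 * sqrt 3 / sqrt pi"
        by (simp add: real_sqrt_divide flip: real_sqrt_mult)
      moreover have "sqrt (2 * pi) = sqrt 2 * sqrt pi" by (simp add: real_sqrt_mult)
      ultimately show ?thesis by (simp only:)
    qed
    ultimately show ?thesis by simp
  qed
  have "(\<lambda>n. J n * exp (D (\<tau> n)) * B n) \<longlonglongrightarrow> pi ^ 3 / 16 * sqrt (6 / pi) * exp 0 * (16 / pi ^ 3 / sqrt (6 / pi))"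
    by (intro tendsto_mult tendsto_exp J D B)
  then have "(\<lambda>n. J n * exp (D (\<tau> n)) * B n) \<longlonglongrightarrow> 1" by simp
  moreover have "eventually (\<lambda>n. J n * exp (D (\<tau> n)) * B n
      = eta2_odd n / (3 / 8 * sqrt (real n) * exp (pi / 3 * sqrt (3 * real n - 1)))) sequentially"
    using eventually_gt_at_top[of 0]
  proof eventually_elim
    case (elim n)
    define t where "t = \<tau> n"
    have t: "t > 0" using elim by (simp add: t_def \<tau>_def)
    have n: "real n * (t / 2) = pi\<^sup>2 / 6 / t"
    proof -
      have "t * t = pi\<^sup>2 / (3 * real n)" by (simp add: t_def \<tau>_def power2_eq_square)
      then show ?thesis using t elim by (simp add: field_simps)
    qed
    have e: "pi / 3 * sqrt (3 * real n) = pi\<^sup>2 / 6 / t + pi\<^sup>2 / 6 / t"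
      using elim by (simp add: t_def \<tau>_def power2_eq_square)
    have "exp (- (real n * (t / 2)) - partition_log_real t) * exp (D t) * exp (pi / 3 * sqrt (3 * real n))
        = exp (- (ln (t / (2 * pi)) / 2))"
      unfolding n e D_def exp_add[symmetric] by (rule arg_cong[where f = exp]) simp
    also have "\<dots> = 1 / sqrt (t / (2 * pi))"
      using t by (simp add: exp_minus inverse_eq_divide ln_sqrt[symmetric])
    also have "\<dots> = sqrt (2 * pi) / sqrt t"
      using t by (simp add: real_sqrt_divide)
    finally have X: "exp (- (real n * (t / 2)) - partition_log_real t) * exp (D t) * exp (pi / 3 * sqrt (3 * real n)) = sqrt (2 * pi) / sqrt t" .
    define Z where "Z = 3 / 8 * sqrt (real n) * exp (pi / 3 * sqrt (3 * real n - 1))"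
    have "J n * exp (D t) * B n = eta2_odd n
        * (exp (- (real n * (t / 2)) - partition_log_real t) * exp (D t) * exp (pi / 3 * sqrt (3 * real n)))
        * (pi / 2 * (t * sqrt t)) / sqrt (2 * pi) * (2 / (pi * t)) / Z"
      by (simp add: J_def B_def t_def Z_def mult_ac)
    also have "\<dots> = eta2_odd n / Z"
      unfolding X using t by simp
    finally show ?case by (simp add: t_def Z_def)
  qed
  ultimately show "(\<lambda>n. eta2_odd n / (3 / 8 * sqrt (real n) * exp (pi / 3 * sqrt (3 * real n - 1)))) \<longlonglongrightarrow> 1"
    by (rule Lim_transform_eventually)
qed

end
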